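(* Let $\{Z_l\}_{l=1}^\infty$ be a family of i.i.d. standard normal random variables and let $$M:=\frac12\sum_{l=1}^\infty 2^{-(l+1)/2}\left|\sum_{j=1}^{l-1}2^{-(l-j)/2}Z_j-Z_l\right|.$$ For the binary coding, as $n=2^N-1\to\infty$ (i.e. $N\to\infty$), $$\frac{I_{\mathrm{lsb}}}{\sigma_u\sqrt{n}}\,\mathrm{INL}_{\max}\longrightarrow M$$ in distribution, in $L^1$ and in $L^2$. Here convergence in $L^1$ and $L^2$ means: there is a probability space carrying a random variable $M'$ with the law of $M$ and, for each $N\ge 1$ with $n=2^N-1$, a random variable $T_N'$ with the law of $\frac{I_{\mathrm{lsb}}}{\sigma_u\sqrt n}\mathrm{INL}_{\max}$, such that $T_N'\to M'$ in $L^1$ and in $L^2$. The expectation of $M$ is $$\mathbb{E}[M]=(2\pi)^{-1/2}\sum_{l=1}^\infty\big(2^{-l}-2^{-2l}\big)^{1/2}\approx 0.839792,$$ and the variance of $M$ is $$\operatorname{Var}(M)=\frac1\pi\sum_{1\le l<k}(2^{-l}-2^{-2l})^{1/2}(2^{-k}-2^{-2k})^{1/2}\Big(\sqrt{1-\rho_{lk}^2}-1+\rho_{lk}\arcsin(\rho_{lk})\Big)+\frac16\left(1-\frac2\pi\right)\approx 0.08007,$$ where $$\rho_{lk}=\frac{-2^{-(l+k)}}{\sqrt{2^{-l}-2^{-2l}}\,\sqrt{2^{-k}-2^{-2k}}}.$$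
   Context: Let $\bar I_u>0$ and $\sigma_u>0$ be constants, and let $I_{u_1},I_{u_2},\dots$ be i.i.d. normal random variables with mean $\bar I_u$ and variance $\sigma_u^2$. For $N\ge1$ let $n=2^N-1$ and put $I_{\mathrm{lsb}}:=\frac1n\sum_{j=1}^n I_{u_j}$. In the binary coding the output currents are $$I_{\mathrm{out}_k}:=\sum_{m=1}^N B_{k,m}\sum_{j=2^{m-1}}^{2^m-1}I_{u_j},\qquad k=0,\dots,n,$$ where $B_{k,m}\in\{0,1\}$ are the binary digits of $k$, i.e. $k=\sum_{m=1}^N B_{k,m}2^{m-1}$. The integrated non-linearity is $\mathrm{INL}_k:=\frac{I_{\mathrm{out}_k}-k\,I_{\mathrm{lsb}}}{I_{\mathrm{lsb}}}$ (defined almost surely), and $\mathrm{INL}_{\max}:=\max_{k=0,\dots,n}|\mathrm{INL}_k|$. *)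

theory Defs
  imports "HOL-Probability.Probability"
begin

abbreviation num_sources :: "nat \<Rightarrow> nat" where
  "num_sources N \<equiv> 2 ^ N - 1"

text \<open>The \<open>m\<close>-th binary digit of \<open>k\<close>, where \<open>m = 1\<close> is the least significant digit.\<close>

definition bin_digit :: "nat \<Rightarrow> nat \<Rightarrow> real" where
  "bin_digit k m = of_bool (bit k (m - 1))"

lemma bin_digit_expansion:
  assumes "k \<le> num_sources N"
  shows "real k = (\<Sum>m=1..N. bin_digit k m * 2 ^ (m - 1))"
proof -
  have "k < 2 ^ N"
    using assms by (metis One_nat_def Suc_pred le_imp_less_Suc pos2 zero_less_power)
  then have "k = take_bit N k"
    by (simp add: take_bit_nat_eq_self)
  also have "\<dots> = (\<Sum>m<N. of_bool (bit k m) * 2 ^ m)"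
    unfolding take_bit_sum push_bit_eq_mult by (simp add: lessThan_atLeast0)
  finally have "k = (\<Sum>m<N. of_bool (bit k m) * 2 ^ m)" .
  then have "real k = real (\<Sum>m<N. of_bool (bit k m) * 2 ^ m)"
    by (rule arg_cong)
  also have "\<dots> = (\<Sum>m<N. of_bool (bit k m) * 2 ^ m)"
    unfolding of_nat_sum by (intro sum.cong) auto
  also have "\<dots> = (\<Sum>m=1..N. bin_digit k m * 2 ^ (m - 1))"
    by (rule sum.reindex_bij_witness[where i = "\<lambda>m. m - 1" and j = Suc])
       (auto simp: bin_digit_def)
  finally show ?thesis .
qed

definition I_lsb :: "(nat \<Rightarrow> 'a \<Rightarrow> real) \<Rightarrow> nat \<Rightarrow> 'a \<Rightarrow> real" where
  "I_lsb Iu N \<omega> = (1 / real (num_sources N)) * (\<Sum>j=1..num_sources N. Iu j \<omega>)"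

definition I_out :: "(nat \<Rightarrow> 'a \<Rightarrow> real) \<Rightarrow> nat \<Rightarrow> nat \<Rightarrow> 'a \<Rightarrow> real" where
  "I_out Iu N k \<omega> = (\<Sum>m=1..N. bin_digit k m * (\<Sum>j=2^(m-1)..2^m-1. Iu j \<omega>))"

text \<open>On the null set where \<open>I_lsb\<close> vanishes, the quotient has the value 0.\<close>

definition INL :: "(nat \<Rightarrow> 'a \<Rightarrow> real) \<Rightarrow> nat \<Rightarrow> nat \<Rightarrow> 'a \<Rightarrow> real" where
  "INL Iu N k \<omega> = (I_out Iu N k \<omega> - real k * I_lsb Iu N \<omega>) / I_lsb Iu N \<omega>"

definition INL_max :: "(nat \<Rightarrow> 'a \<Rightarrow> real) \<Rightarrow> nat \<Rightarrow> 'a \<Rightarrow> real" where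
  "INL_max Iu N \<omega> = Max ((\<lambda>k. \<bar>INL Iu N k \<omega>\<bar>) ` {0..num_sources N})"

text \<open>The factor \<open>I_lsb\<close> is signed, so this can be negative with small probability.\<close>

definition normalized_INL_max :: "real \<Rightarrow> (nat \<Rightarrow> 'a \<Rightarrow> real) \<Rightarrow> nat \<Rightarrow> 'a \<Rightarrow> real" where
  "normalized_INL_max \<sigma> Iu N \<omega> =
     I_lsb Iu N \<omega> / (\<sigma> * sqrt (real (num_sources N))) * INL_max Iu N \<omega>"

definition M_term :: "(nat \<Rightarrow> 'b \<Rightarrow> real) \<Rightarrow> nat \<Rightarrow> 'b \<Rightarrow> real" where
  "M_term Z l \<omega> = 2 powr (- (real l + 1) / 2) *
     \<bar>(\<Sum>j=1..<l. 2 powr (- (real l - real j) / 2) * Z j \<omega>) - Z l \<omega>\<bar>"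

text \<open>The series starts at \<open>l = 1\<close>, hence the shift by \<open>Suc\<close>.\<close>

definition M_limit :: "(nat \<Rightarrow> 'b \<Rightarrow> real) \<Rightarrow> 'b \<Rightarrow> real" where
  "M_limit Z \<omega> = (1 / 2) * (\<Sum>l. M_term Z (Suc l) \<omega>)"

text \<open>\<open>sd_coeff l\<close> is the standard deviation of the signed \<open>l\<close>-th summand of the series in
  \<open>M_limit\<close> (before taking absolute values), and \<open>rho l k\<close> the correlation of two of them.\<close>

definition sd_coeff :: "nat \<Rightarrow> real" where
  "sd_coeff l = sqrt (2 powr (- real l) - 2 powr (- 2 * real l))"

definition rho :: "nat \<Rightarrow> nat \<Rightarrow> real" where
  "rho l k = - (2 powr (- (real l + real k))) / (sd_coeff l * sd_coeff k)"

definition var_term :: "nat \<Rightarrow> nat \<Rightarrow> real" where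
  "var_term l k = sd_coeff l * sd_coeff k *
     (sqrt (1 - (rho l k)\<^sup>2) - 1 + rho l k * arcsin (rho l k))"

text \<open>Independent normal variables indexed by the positive integers; the value of the family
  at index 0 is irrelevant.\<close>

definition iid_normal :: "'a measure \<Rightarrow> (nat \<Rightarrow> 'a \<Rightarrow> real) \<Rightarrow> real \<Rightarrow> real \<Rightarrow> bool" where
  "iid_normal P X \<mu> \<sigma> \<longleftrightarrow>
     prob_space.indep_vars P (\<lambda>_. borel) X {1..} \<and>
     (\<forall>j\<ge>1. distributed P lborel (X j) (normal_density \<mu> \<sigma>))"

definition in_Lp :: "'a measure \<Rightarrow> nat \<Rightarrow> ('a \<Rightarrow> real) \<Rightarrow> bool" where
  "in_Lp R p X \<longleftrightarrow> X \<in> borel_measurable R \<and> integrable R (\<lambda>\<omega>. \<bar>X \<omega>\<bar> ^ p)"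

text \<open>The sequences of interest start at index 1.\<close>

definition conv_Lp :: "'a measure \<Rightarrow> nat \<Rightarrow> (nat \<Rightarrow> 'a \<Rightarrow> real) \<Rightarrow> ('a \<Rightarrow> real) \<Rightarrow> bool" where
  "conv_Lp R p X Y \<longleftrightarrow>
     (\<forall>N\<ge>1. in_Lp R p (X N)) \<and> in_Lp R p Y \<and>
     (\<lambda>N. \<integral>\<omega>. \<bar>X N \<omega> - Y \<omega>\<bar> ^ p \<partial>R) \<longlonglongrightarrow> 0"

end

theory Submission
  imports Defs "HOL-Real_Asymp.Real_Asymp"
begin

text \<open>
  Each block of sources is replaced by its centred and rescaled sum. The blocks are disjoint, so
  these sums are independent standard normal variables. Let \<open>D m\<close> be the deviation of block \<open>m\<close>
  from its share of the total. The deviations add up to zero, hence the largest absolute value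
  among the partial sums selected by the codes is half of the sum of the absolute deviations
  (\<open>max_abs_digit_sum\<close>). Thus the normalised non-linearity is the sign of \<open>I_lsb\<close> times an explicit
  function of independent normal variables (\<open>normalized_INL_max_eq_INL_stat\<close>).

  Numbered from the largest downwards, block \<open>l\<close> has asymptotically the fraction \<open>2 ^ (- l)\<close> of the
  total variance, and equals in variance the sum of all smaller blocks. So the blocks arise by
  repeatedly bisecting a normal variable \<open>z 0\<close>: the two halves of a normal variable \<open>A\<close> are
  \<open>A / 2 + c z\<close> and \<open>A / 2 - c z\<close> with a fresh independent \<open>z\<close>. After rescaling, each bisection is a
  rotation by 45 degrees, which preserves independent standard normal variables
  (\<open>gauss_family_bisect_piece\<close>). One sequence \<open>z\<close> therefore realises the statistics for all \<open>N\<close>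
  on one space. The deviation of a piece from its share \<open>z 0 / 2 ^ l\<close> is, up to sign, the
  combination inside the absolute value of the \<open>l\<close>-th term of \<open>M\<close> (\<open>M_term_bisect\<close>). Pointwise
  convergence then only needs that \<open>\<bar>z l\<bar> / sqrt 2 ^ l\<close> is summable, and the sum of this series is a
  square integrable bound for all statistics. Dominated convergence gives convergence in \<open>L\<^sup>1\<close> and
  \<open>L\<^sup>2\<close>, and weak convergence.

  The mean of \<open>M\<close> is a sum of first absolute moments. For the variance, two linear forms in
  independent normal variables are brought by rotations to the shape \<open>t U\<close> and \<open>\<beta> U + \<gamma> V\<close>
  (\<open>gauss_family_two_forms\<close>), and the mean of the absolute product is computed by integrating
  over the slope \<open>V / U\<close> (\<open>nn_integral_gauss_abs_product\<close>). The covariances involve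
  \<open>sqrt (1 - x\<^sup>2) - 1 + x arcsin x\<close> at the correlation \<open>x\<close>. All its Taylor coefficients are
  nonnegative, and it is enclosed between polynomials in \<open>x\<^sup>2\<close> by comparing second derivatives.
  Since the squared correlation is \<open>1 / ((2 ^ l - 1) (2 ^ k - 1))\<close>, every power of it has a sum over
  pairs that is half of the difference of a squared sum and a sum of squares, so that twelve indices
  and a geometric tail decide the numerical value of the variance.\<close>

section \<open>The standard normal law is invariant under rotations\<close>

text \<open>The product measures below are taken over one fixed measure on the Borel sets, so that laws of
  different families can be compared as equal measures.\<close>

definition gauss :: "real measure" where
  "gauss = density lborel (\<lambda>x. ennreal (std_normal_density x))"

lemma sets_gauss [measurable_cong, simp]: "sets gauss = sets borel"
  by (simp add: gauss_def)

lemma space_gauss [simp]: "space gauss = UNIV"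
  by (simp add: gauss_def)

lemma prob_space_gauss: "prob_space gauss"
  unfolding gauss_def using prob_space_normal_density[of 1 0] by simp

interpretation gauss: prob_space gauss
  by (rule prob_space_gauss)

abbreviation gauss_power :: "'i set \<Rightarrow> ('i \<Rightarrow> real) measure" where
  "gauss_power I \<equiv> PiM I (\<lambda>_. gauss)"

interpretation gauss_prod: product_prob_space "\<lambda>_. gauss" I for I
  by unfold_locales

lemma nn_integral_gauss:
  assumes [measurable]: "f \<in> borel_measurable borel"
  shows "(\<integral>\<^sup>+x. f x \<partial>gauss) = (\<integral>\<^sup>+x. ennreal (std_normal_density x) * f x \<partial>lborel)"
  unfolding gauss_def by (subst nn_integral_density) auto

lemma std_normal_density_rotate:
  assumes "c\<^sup>2 + s\<^sup>2 = (1::real)"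
  shows "std_normal_density (c * x + s * y) * std_normal_density (- s * x + c * y) =
    std_normal_density x * std_normal_density y"
proof -
  have "(c * x + s * y)\<^sup>2 + (- s * x + c * y)\<^sup>2 = (c\<^sup>2 + s\<^sup>2) * (x\<^sup>2 + y\<^sup>2)"
    by (simp add: power2_eq_square algebra_simps)
  then have *: "- (c * x + s * y)\<^sup>2 / 2 + - (- s * x + c * y)\<^sup>2 / 2 = - x\<^sup>2 / 2 + - y\<^sup>2 / 2"
    using assms by simp
  have "exp (- (c * x + s * y)\<^sup>2 / 2) * exp (- (- s * x + c * y)\<^sup>2 / 2) =
      exp (- x\<^sup>2 / 2) * exp (- y\<^sup>2 / 2)"
    unfolding exp_add[symmetric] using * by simp
  then show ?thesis
    by (simp add: std_normal_density_def)
qed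

text \<open>For a rotation with nonzero sine, two affine substitutions suffice: at fixed \<open>x\<close>
  one replaces \<open>y\<close> by the first rotated coordinate \<open>u\<close>, which costs a
  factor \<open>s\<close>; after exchanging the integrals, at fixed \<open>u\<close> one replaces
  \<open>x\<close> by the second coordinate, which gives the factor \<open>s\<close> back.\<close>

lemma nn_integral_lborel_rotate:
  fixes g :: "real \<Rightarrow> real \<Rightarrow> ennreal"
  assumes [measurable]: "case_prod g \<in> borel_measurable (borel \<Otimes>\<^sub>M borel)"
    and cs: "c\<^sup>2 + s\<^sup>2 = 1" and s: "s \<noteq> 0"
  shows "(\<integral>\<^sup>+x. \<integral>\<^sup>+y. g (c * x + s * y) (- s * x + c * y) \<partial>lborel \<partial>lborel) =
    (\<integral>\<^sup>+u. \<integral>\<^sup>+v. g u v \<partial>lborel \<partial>lborel)"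
proof -
  have [measurable]: "(\<lambda>z. g (f z) (h z)) \<in> borel_measurable M"
    if [measurable]: "f \<in> borel_measurable M" "h \<in> borel_measurable M" for f h and M :: "'x measure"
    using measurable_compose[OF measurable_Pair[OF that] assms(1)] by simp
  have inner: "(\<integral>\<^sup>+u. g u ((c * u - x) / s) \<partial>lborel) =
      ennreal \<bar>s\<bar> * (\<integral>\<^sup>+y. g (c * x + s * y) (- s * x + c * y) \<partial>lborel)" for x
  proof -
    have "(c * (c * x + s * y) - x) / s = - s * x + c * y" for y
    proof -
      have "c * (c * x + s * y) - x = (c\<^sup>2 - 1) * x + c * s * y"
        by (simp add: power2_eq_square algebra_simps)
      also have "c\<^sup>2 - 1 = - s\<^sup>2"
        using cs by simp
      finally show ?thesis
        using s by (simp add: power2_eq_square field_simps)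
    qed
    then show ?thesis
      by (subst nn_integral_real_affine[where t = "c * x" and c = s]) (use s in auto)
  qed
  have outer: "(\<integral>\<^sup>+v. g u v \<partial>lborel) =
      ennreal \<bar>1 / s\<bar> * (\<integral>\<^sup>+x. g u ((c * u - x) / s) \<partial>lborel)" for u
    by (subst nn_integral_real_affine[where t = "c * u / s" and c = "- 1 / s"])
       (use s in \<open>auto simp: diff_divide_distrib\<close>)
  have "ennreal \<bar>s\<bar> * (\<integral>\<^sup>+x. \<integral>\<^sup>+y. g (c * x + s * y) (- s * x + c * y) \<partial>lborel \<partial>lborel) =
      (\<integral>\<^sup>+x. \<integral>\<^sup>+u. g u ((c * u - x) / s) \<partial>lborel \<partial>lborel)"
    by (simp add: inner nn_integral_cmult)
  also have "\<dots> = (\<integral>\<^sup>+u. \<integral>\<^sup>+x. g u ((c * u - x) / s) \<partial>lborel \<partial>lborel)"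
    by (rule lborel_pair.Fubini') simp
  also have "ennreal \<bar>1 / s\<bar> * \<dots> = (\<integral>\<^sup>+u. \<integral>\<^sup>+v. g u v \<partial>lborel \<partial>lborel)"
    by (simp add: outer nn_integral_cmult)
  finally have "ennreal \<bar>1 / s\<bar> * (ennreal \<bar>s\<bar> *
      (\<integral>\<^sup>+x. \<integral>\<^sup>+y. g (c * x + s * y) (- s * x + c * y) \<partial>lborel \<partial>lborel)) =
      (\<integral>\<^sup>+u. \<integral>\<^sup>+v. g u v \<partial>lborel \<partial>lborel)"
    by simp
  then show ?thesis
    using s by (simp flip: mult.assoc ennreal_mult add: abs_mult[symmetric])
qed

text \<open>The joint density depends only on the radius, so rotation invariance is inherited from Lebesgue
  measure.\<close>

lemma nn_integral_gauss_rotate: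
  fixes f :: "real \<Rightarrow> real \<Rightarrow> ennreal"
  assumes [measurable]: "case_prod f \<in> borel_measurable (borel \<Otimes>\<^sub>M borel)"
    and cs: "c\<^sup>2 + s\<^sup>2 = 1" and s: "s \<noteq> 0"
  shows "(\<integral>\<^sup>+x. \<integral>\<^sup>+y. f (c * x + s * y) (- s * x + c * y) \<partial>gauss \<partial>gauss) =
    (\<integral>\<^sup>+u. \<integral>\<^sup>+v. f u v \<partial>gauss \<partial>gauss)"
proof -
  let ?d = std_normal_density
  have [measurable]: "(\<lambda>z. f (k z) (h z)) \<in> borel_measurable M"
    if [measurable]: "k \<in> borel_measurable M" "h \<in> borel_measurable M" for k h and M :: "'x measure"
    using measurable_compose[OF measurable_Pair[OF that] assms(1)] by simp
  define g where "g u v = ennreal (?d u * ?d v) * f u v" for u v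
  have [measurable]: "case_prod g \<in> borel_measurable (borel \<Otimes>\<^sub>M borel)"
    unfolding g_def by measurable
  have "(\<integral>\<^sup>+x. \<integral>\<^sup>+y. f (c * x + s * y) (- s * x + c * y) \<partial>gauss \<partial>gauss) =
      (\<integral>\<^sup>+x. \<integral>\<^sup>+y. ennreal (?d x * ?d y) * f (c * x + s * y) (- s * x + c * y) \<partial>lborel \<partial>lborel)"
    by (simp add: nn_integral_gauss nn_integral_cmult[symmetric] ennreal_mult mult.assoc)
  also have "\<dots> = (\<integral>\<^sup>+x. \<integral>\<^sup>+y. g (c * x + s * y) (- s * x + c * y) \<partial>lborel \<partial>lborel)"
    unfolding g_def std_normal_density_rotate[OF cs] ..
  also have "\<dots> = (\<integral>\<^sup>+u. \<integral>\<^sup>+v. g u v \<partial>lborel \<partial>lborel)"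
    by (rule nn_integral_lborel_rotate) (use cs s in auto)
  also have "\<dots> = (\<integral>\<^sup>+u. \<integral>\<^sup>+v. f u v \<partial>gauss \<partial>gauss)"
    by (simp add: nn_integral_gauss nn_integral_cmult[symmetric] ennreal_mult mult.assoc g_def)
  finally show ?thesis .
qed

lemma gauss_rotation_measurable:
  assumes "i \<in> I" "j \<in> I"
  shows "(\<lambda>x. x(i := c * x i + s * x j, j := - s * x i + c * x j)) \<in>
    gauss_power I \<rightarrow>\<^sub>M gauss_power I" (is "?T \<in> _")
proof (rule measurable_PiM_single')
  fix k assume k: "k \<in> I"
  have [measurable]: "(\<lambda>x. x i) \<in> gauss_power I \<rightarrow>\<^sub>M borel" "(\<lambda>x. x j) \<in> gauss_power I \<rightarrow>\<^sub>M borel"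
      "(\<lambda>x. x k) \<in> gauss_power I \<rightarrow>\<^sub>M borel"
    using assms k by (simp_all add: measurable_component_singleton flip: measurable_cong_sets[OF refl sets_gauss])
  show "(\<lambda>x. ?T x k) \<in> gauss_power I \<rightarrow>\<^sub>M gauss"
    by (cases "k = j"; cases "k = i") (use k in \<open>auto intro!: measurable_component_singleton\<close>)
qed (use assms in \<open>auto simp: space_PiM PiE_iff extensional_def\<close>)

text \<open>Both sides are compared on boxes. After integrating out the other coordinates, only a
  two-dimensional integral over the coordinates \<open>i\<close> and \<open>j\<close> depends on
  the rotation.\<close>

lemma distr_PiM_gauss_rotate:
  assumes I: "finite I" "i \<in> I" "j \<in> I" "i \<noteq> j"
    and cs: "c\<^sup>2 + s\<^sup>2 = (1::real)" and s: "s \<noteq> 0"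
  shows "distr (gauss_power I) (gauss_power I)
      (\<lambda>x. x(i := c * x i + s * x j, j := - s * x i + c * x j)) = gauss_power I"
    (is "distr _ _ ?T = _")
proof (rule gauss_prod.PiM_eqI)
  define J where "J = I - {i, j}"
  have J: "finite J" "i \<notin> insert j J" "j \<notin> J" "I = insert i (insert j J)"
    using I by (auto simp: J_def)
  have T: "?T \<in> gauss_power I \<rightarrow>\<^sub>M gauss_power I"
    by (rule gauss_rotation_measurable) fact+
  fix A :: "'a \<Rightarrow> real set" assume A: "\<And>k. k \<in> I \<Longrightarrow> A k \<in> sets gauss"
  have [measurable]: "A k \<in> sets borel" if "k \<in> I" for k
    using A that by simp
  have [measurable]: "A i \<in> sets borel" "A j \<in> sets borel"
    using I by auto
  have PA [measurable]: "Pi\<^sub>E I A \<in> sets (gauss_power I)"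
    using I by (intro sets_PiM_I_finite A)
  have m: "(\<lambda>x. indicator (A k) (x k) :: ennreal) \<in> borel_measurable (gauss_power K)" if "k \<in> J" "J \<subseteq> K" for k K
  proof -
    have "indicator (A k) \<in> borel_measurable gauss"
      using that J by simp
    moreover have "(\<lambda>x. x k) \<in> gauss_power K \<rightarrow>\<^sub>M gauss"
      using that by (intro measurable_component_singleton) auto
    ultimately show ?thesis
      by (rule measurable_compose[rotated])
  qed
  have "emeasure (distr (gauss_power I) (gauss_power I) ?T) (Pi\<^sub>E I A) =
      (\<integral>\<^sup>+x. indicator (Pi\<^sub>E I A) x \<partial>distr (gauss_power I) (gauss_power I) ?T)"
    by simp
  also have "\<dots> = (\<integral>\<^sup>+x. indicator (Pi\<^sub>E I A) (?T x) \<partial>gauss_power I)"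
    by (rule nn_integral_distr[OF T]) simp
  also have "\<dots> = (\<integral>\<^sup>+x. indicator (A i) (c * x i + s * x j) * indicator (A j) (- s * x i + c * x j) *
      (\<Prod>k\<in>J. indicator (A k) (x k)) \<partial>gauss_power I)"
  proof (rule nn_integral_cong)
    fix x assume x: "x \<in> space (gauss_power I)"
    have "(?T x \<in> Pi\<^sub>E I A) \<longleftrightarrow> (c * x i + s * x j \<in> A i \<and> - s * x i + c * x j \<in> A j \<and> (\<forall>k\<in>J. x k \<in> A k))"
      using x I J by (auto simp: space_PiM PiE_iff extensional_def)
    moreover have "(\<Prod>k\<in>J. indicator (A k) (x k)) = (of_bool (\<forall>k\<in>J. x k \<in> A k) :: ennreal)"
      using J(1) by (induction J rule: finite_induct) (auto simp: indicator_def)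
    ultimately show "indicator (Pi\<^sub>E I A) (?T x) = indicator (A i) (c * x i + s * x j) *
        indicator (A j) (- s * x i + c * x j) * (\<Prod>k\<in>J. indicator (A k) (x k) :: ennreal)"
      by (simp add: indicator_def)
  qed
  also have "\<dots> = (\<integral>\<^sup>+x. (\<integral>\<^sup>+b. (\<integral>\<^sup>+a. indicator (A i) (c * a + s * b) * indicator (A j) (- s * a + c * b) *
      (\<Prod>k\<in>J. indicator (A k) (x k)) \<partial>gauss) \<partial>gauss) \<partial>gauss_power J)"
  proof -
    have [simp]: "(\<Prod>k\<in>J. indicator (A k) (if k = i then a else x k)) = (\<Prod>k\<in>J. indicator (A k) (x k) :: ennreal)"
      "(\<Prod>k\<in>J. indicator (A k) (if k = j then a else x k)) = (\<Prod>k\<in>J. indicator (A k) (x k) :: ennreal)" for a x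
      using J by (auto intro!: prod.cong)
    show ?thesis
      unfolding J(4)
      apply (subst gauss_prod.product_nn_integral_insert)
      subgoal using J by simp
      subgoal using J by simp
      subgoal
        using J by (intro borel_measurable_times_ennreal borel_measurable_prod_ennreal m) (measurable, blast+)
      apply (subst gauss_prod.product_nn_integral_insert)
      subgoal using J by simp
      subgoal using J by simp
      subgoal
        using J by (intro gauss.borel_measurable_nn_integral) 
          (auto simp: split_beta' intro!: borel_measurable_times_ennreal borel_measurable_prod_ennreal measurable_compose[OF _ m])
      using I J by simp
  qed
  also have "\<dots> = (\<integral>\<^sup>+x. (\<Prod>k\<in>J. indicator (A k) (x k)) * (\<integral>\<^sup>+b. (\<integral>\<^sup>+a. indicator (A i) (c * a + s * b) * indicator (A j) (- s * a + c * b)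
       \<partial>gauss) \<partial>gauss) \<partial>gauss_power J)"
    by (simp add: nn_integral_cmult mult.commute)
  also have "(\<integral>\<^sup>+b. (\<integral>\<^sup>+a. indicator (A i) (c * a + s * b) * indicator (A j) (- s * a + c * b) \<partial>gauss) \<partial>gauss) =
      (\<integral>\<^sup>+a. (\<integral>\<^sup>+b. indicator (A i) (c * a + s * b) * indicator (A j) (- s * a + c * b) \<partial>gauss) \<partial>gauss)"
    by (rule pair_sigma_finite.Fubini') (unfold_locales, measurable)
  also have "\<dots> = (\<integral>\<^sup>+u. (\<integral>\<^sup>+v. indicator (A i) u * indicator (A j) v \<partial>gauss) \<partial>gauss)"
    by (rule nn_integral_gauss_rotate[where f = "\<lambda>u v. indicator (A i) u * indicator (A j) v"])
       (use cs s in auto)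
  also have "\<dots> = emeasure gauss (A i) * emeasure gauss (A j)"
    by (simp add: nn_integral_cmult nn_integral_multc)
  also have "(\<integral>\<^sup>+x. (\<Prod>k\<in>J. indicator (A k) (x k)) * (emeasure gauss (A i) * emeasure gauss (A j)) \<partial>gauss_power J) =
     (\<Prod>k\<in>J. emeasure gauss (A k)) * (emeasure gauss (A i) * emeasure gauss (A j))"
  proof -
    have [measurable]: "indicator (A k) \<in> borel_measurable gauss" if "k \<in> J" for k
      using that J by simp
    have "(\<integral>\<^sup>+x. (\<Prod>k\<in>J. indicator (A k) (x k)) \<partial>gauss_power J) = (\<Prod>k\<in>J. emeasure gauss (A k))"
      using J by (subst gauss_prod.product_nn_integral_prod) auto
    moreover have "(\<lambda>x. \<Prod>k\<in>J. indicator (A k) (x k) :: ennreal) \<in> borel_measurable (gauss_power J)"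
      by (intro borel_measurable_prod_ennreal m) auto
    ultimately show ?thesis
      by (simp add: nn_integral_multc)
  qed
  also have "\<dots> = (\<Prod>k\<in>I. emeasure gauss (A k))"
    unfolding J(4) using J(1-3) by (simp add: mult_ac)
  finally show "emeasure (distr (gauss_power I) (gauss_power I) ?T) (Pi\<^sub>E I A) = (\<Prod>k\<in>I. emeasure gauss (A k))" .
qed (use I in auto)

section \<open>Families of independent standard normal variables\<close>

text \<open>The family is independent and standard normal, expressed as a single equation between joint
  laws. In this form it also makes sense for an empty index set, passes to subfamilies and can be
  pushed forward along measurable maps.\<close>

definition gauss_family :: "'a measure \<Rightarrow> ('i \<Rightarrow> 'a \<Rightarrow> real) \<Rightarrow> 'i set \<Rightarrow> bool" where
  "gauss_family P Y I \<longleftrightarrow> (\<forall>i\<in>I. Y i \<in> borel_measurable P) \<and>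
     distr P (gauss_power I) (\<lambda>\<omega>. \<lambda>i\<in>I. Y i \<omega>) = gauss_power I"

lemma gauss_family_measurable:
  assumes "gauss_family P Y I"
  shows "i \<in> I \<Longrightarrow> Y i \<in> borel_measurable P"
    and "(\<lambda>\<omega>. \<lambda>i\<in>I. Y i \<omega>) \<in> P \<rightarrow>\<^sub>M gauss_power I"
proof -
  show *: "i \<in> I \<Longrightarrow> Y i \<in> borel_measurable P" for i
    using assms by (simp add: gauss_family_def)
  show "(\<lambda>\<omega>. \<lambda>i\<in>I. Y i \<omega>) \<in> P \<rightarrow>\<^sub>M gauss_power I"
    by (intro measurable_restrict) (simp add: measurable_cong_sets[OF refl sets_gauss] *)
qed

lemma gauss_family_cong:
  assumes "\<And>i. i \<in> I \<Longrightarrow> Y i = Y' i"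
  shows "gauss_family P Y I \<longleftrightarrow> gauss_family P Y' I"
  using assms unfolding gauss_family_def by (auto cong: restrict_cong)

lemma gauss_family_coordinates:
  "gauss_family (gauss_power I) (\<lambda>i \<omega>. \<omega> i) I"
proof -
  have "distr (gauss_power I) (gauss_power I) (\<lambda>\<omega>. restrict \<omega> I) =
      distr (gauss_power I) (gauss_power I) (\<lambda>\<omega>. \<omega>)"
    by (rule distr_cong) (auto simp: space_PiM)
  moreover have "(\<lambda>\<omega>. \<omega> i) \<in> borel_measurable (gauss_power I)" if "i \<in> I" for i
    using measurable_component_singleton[OF that, of "\<lambda>_. gauss"]
    by (simp add: measurable_cong_sets[OF refl sets_gauss])
  ultimately show ?thesis
    by (simp add: gauss_family_def)
qed

lemma gauss_family_reindex:
  assumes fam: "gauss_family P Y I" and f: "inj_on f J" "f ` J \<subseteq> I"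
  shows "gauss_family P (\<lambda>j. Y (f j)) J"
proof -
  have m: "(\<lambda>\<omega>. \<lambda>j\<in>J. \<omega> (f j)) \<in> gauss_power I \<rightarrow>\<^sub>M gauss_power J"
    using f by (intro measurable_restrict measurable_component_singleton) auto
  have "distr P (gauss_power J) (\<lambda>\<omega>. \<lambda>j\<in>J. Y (f j) \<omega>) =
      distr P (gauss_power J) ((\<lambda>\<omega>. \<lambda>j\<in>J. \<omega> (f j)) \<circ> (\<lambda>\<omega>. \<lambda>i\<in>I. Y i \<omega>))"
    using f by (intro distr_cong) (auto simp: fun_eq_iff)
  also have "\<dots> = distr (distr P (gauss_power I) (\<lambda>\<omega>. \<lambda>i\<in>I. Y i \<omega>))
      (gauss_power J) (\<lambda>\<omega>. \<lambda>j\<in>J. \<omega> (f j))"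
    by (rule distr_distr[symmetric, OF m gauss_family_measurable(2)[OF fam]])
  also have "\<dots> = distr (gauss_power I) (gauss_power J) (\<lambda>\<omega>. \<lambda>j\<in>J. \<omega> (f j))"
    using fam by (simp add: gauss_family_def)
  also have "\<dots> = gauss_power J"
    by (rule distr_PiM_reindex[where M = "\<lambda>_. gauss"]) (use f prob_space_gauss in auto)
  finally show ?thesis
    using f gauss_family_measurable(1)[OF fam] by (auto simp: gauss_family_def)
qed

lemma gauss_family_subset:
  assumes "gauss_family P Y I" "J \<subseteq> I"
  shows "gauss_family P Y J"
  using gauss_family_reindex[OF assms(1), of "\<lambda>i. i" J] assms(2) by simp

lemma gauss_family_distr:
  assumes fam: "gauss_family P Y I" and i: "i \<in> I"
  shows "distr P borel (Y i) = gauss"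
proof -
  have "distr P borel (Y i) = distr P gauss ((\<lambda>\<omega>. \<omega> i) \<circ> (\<lambda>\<omega>. \<lambda>i\<in>I. Y i \<omega>))"
    using i by (intro distr_cong) auto
  also have "\<dots> = distr (distr P (gauss_power I) (\<lambda>\<omega>. \<lambda>i\<in>I. Y i \<omega>)) gauss (\<lambda>\<omega>. \<omega> i)"
    by (rule distr_distr[symmetric, OF measurable_component_singleton[OF i] gauss_family_measurable(2)[OF fam]])
  also have "\<dots> = gauss"
    using fam distr_PiM_component[of I "\<lambda>_. gauss" i] i prob_space_gauss by (simp add: gauss_family_def)
  finally show ?thesis .
qed

lemma gauss_family_distributed:
  assumes fam: "gauss_family P Y I" and i: "i \<in> I"
  shows "distributed P lborel (Y i) std_normal_density"
proof -
  have "distr P lborel (Y i) = distr P borel (Y i)"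
    by (rule distr_cong) auto
  then show ?thesis
    using gauss_family_distr[OF assms] gauss_family_measurable(1)[OF assms]
    by (simp add: distributed_def gauss_def)
qed

lemma gauss_family_iff_indep:
  assumes "prob_space P" "I \<noteq> {}"
  shows "gauss_family P Y I \<longleftrightarrow> prob_space.indep_vars P (\<lambda>_. borel) Y I \<and>
    (\<forall>i\<in>I. distributed P lborel (Y i) std_normal_density)" (is "?L \<longleftrightarrow> ?R")
proof -
  interpret prob_space P by fact
  have tgt: "distr P (PiM I (\<lambda>_. borel)) X = distr P (gauss_power I) X" for X
    by (rule distr_cong) (auto cong: sets_PiM_cong)
  have d: "distr P borel (Y i) = gauss" if "distributed P lborel (Y i) std_normal_density" for i
  proof -
    have "distr P lborel (Y i) = distr P borel (Y i)"
      by (rule distr_cong) auto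
    then show ?thesis
      using that by (simp add: distributed_def gauss_def)
  qed
  show ?thesis
  proof
    assume L: ?L
    have "indep_vars (\<lambda>_. borel) Y I"
      using L gauss_family_distr[OF L] gauss_family_measurable(1)[OF L] assms(2)
      by (subst indep_vars_iff_distr_eq_PiM') (auto simp: tgt gauss_family_def cong: PiM_cong)
    then show ?R
      using gauss_family_distributed[OF L] by auto
  next
    assume R: ?R
    then have rv: "\<And>i. i \<in> I \<Longrightarrow> Y i \<in> borel_measurable P"
      by (auto simp: distributed_def)
    then show ?L
      using R d assms(2) indep_vars_iff_distr_eq_PiM'[OF assms(2), where M' = "\<lambda>_. borel" and X = Y]
      by (auto simp: tgt gauss_family_def cong: PiM_cong)
  qed
qed

lemma gauss_family_same_law:
  assumes "gauss_family P Y I" "gauss_family P' Y' I"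
    and f: "f \<in> gauss_power I \<rightarrow>\<^sub>M M"
  shows "distr P M (\<lambda>\<omega>. f (\<lambda>i\<in>I. Y i \<omega>)) = distr P' M (\<lambda>\<omega>. f (\<lambda>i\<in>I. Y' i \<omega>))"
proof -
  have "distr P M (\<lambda>\<omega>. f (\<lambda>i\<in>I. Y i \<omega>)) = distr (gauss_power I) M f"
    if "gauss_family P Y I" for P :: "'z measure" and Y
    using distr_distr[OF f gauss_family_measurable(2)[OF that]] that
    by (simp add: comp_def gauss_family_def)
  from this[OF assms(1)] show ?thesis
    using distr_distr[OF f gauss_family_measurable(2)[OF assms(2)]] assms(2)
    by (simp add: comp_def gauss_family_def)
qed

text \<open>A Givens rotation of two members, the only transformation of families that is used: both the
  bisection of a normal variable and the reduction of linear forms are sequences of such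
  rotations.\<close>

lemma gauss_family_rotate:
  fixes Y :: "'i \<Rightarrow> 'a \<Rightarrow> real"
  assumes fam: "gauss_family P Y I"
    and I: "finite I" "i \<in> I" "j \<in> I" "i \<noteq> j"
    and cs: "c\<^sup>2 + s\<^sup>2 = (1::real)" "s \<noteq> 0"
  shows "gauss_family P
    (Y(i := \<lambda>\<omega>. c * Y i \<omega> + s * Y j \<omega>, j := \<lambda>\<omega>. - s * Y i \<omega> + c * Y j \<omega>)) I"
    (is "gauss_family P ?Y I")
proof -
  let ?T = "\<lambda>x::'i \<Rightarrow> real. x(i := c * x i + s * x j, j := - s * x i + c * x j)"
  have Ym: "Y k \<in> borel_measurable P" if "k \<in> I" for k
    using gauss_family_measurable(1)[OF fam that] .
  have [measurable]: "Y i \<in> borel_measurable P" "Y j \<in> borel_measurable P"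
    using Ym I by auto
  have Y'm: "?Y k \<in> borel_measurable P" if "k \<in> I" for k
    using Ym[OF that] by (cases "k = j"; cases "k = i") simp_all
  have T: "?T \<in> gauss_power I \<rightarrow>\<^sub>M gauss_power I"
    by (rule gauss_rotation_measurable) fact+
  have "distr P (gauss_power I) (\<lambda>\<omega>. \<lambda>k\<in>I. ?Y k \<omega>) =
      distr P (gauss_power I) (?T \<circ> (\<lambda>\<omega>. \<lambda>k\<in>I. Y k \<omega>))"
    using I by (intro distr_cong) (auto simp: fun_eq_iff)
  also have "\<dots> = distr (distr P (gauss_power I) (\<lambda>\<omega>. \<lambda>k\<in>I. Y k \<omega>)) (gauss_power I) ?T"
    by (rule distr_distr[symmetric, OF T gauss_family_measurable(2)[OF fam]])
  also have "\<dots> = gauss_power I"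
    using fam distr_PiM_gauss_rotate[OF I cs] by (simp add: gauss_family_def)
  finally show ?thesis
    using Y'm by (simp add: gauss_family_def)
qed

text \<open>Givens elimination: rotating the coordinates of \<open>J\<close> into coordinate
  \<open>i\<close> one after the other concentrates a linear form on a single member of a new
  family. The last conclusion keeps every other linear form expressible in the new family, so that
  a second form can be treated afterwards.\<close>

lemma gauss_family_collapse:
  fixes Y :: "'i \<Rightarrow> 'a \<Rightarrow> real"
  assumes fam: "gauss_family P Y I" and fin: "finite I" and i: "i \<in> I" and J: "J \<subseteq> I - {i}"
  shows "\<exists>t Y'. gauss_family P Y' I \<and> (\<forall>k\<in>I - insert i J. Y' k = Y k) \<and>
    (\<forall>\<omega>. (\<Sum>k\<in>insert i J. a k * Y k \<omega>) = t * Y' i \<omega>) \<and>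
    (\<forall>b. \<exists>b'. \<forall>\<omega>. (\<Sum>k\<in>insert i J. b k * Y k \<omega>) = (\<Sum>k\<in>insert i J. b' k * Y' k \<omega>))"
proof -
  from J fin have "finite J"
    by (auto intro: finite_subset)
  then show ?thesis
    using J
  proof (induction J rule: finite_induct)
    case empty
    show ?case
      by (rule exI[of _ "a i"], rule exI[of _ Y]) (use fam in auto)
  next
    case (insert j J)
    then obtain t Y' where Y': "gauss_family P Y' I" "\<forall>k\<in>I - insert i J. Y' k = Y k"
      and sum: "\<And>\<omega>. (\<Sum>k\<in>insert i J. a k * Y k \<omega>) = t * Y' i \<omega>"
      and ex: "\<And>b. \<exists>b'. \<forall>\<omega>. (\<Sum>k\<in>insert i J. b k * Y k \<omega>) = (\<Sum>k\<in>insert i J. b' k * Y' k \<omega>)"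
      by auto
    have j: "j \<in> I" "j \<noteq> i" "j \<notin> J" "i \<notin> J"
      using insert by auto
    have Yj: "Y' j = Y j"
      using Y'(2) j by auto
    have split: "(\<Sum>k\<in>insert i (insert j J). f k) = f j + (\<Sum>k\<in>insert i J. f k)" for f :: "'i \<Rightarrow> real"
      using insert.hyps j by (subst insert_commute) simp
    show ?case
    proof (cases "a j = 0")
      case True
      have "\<exists>b'. \<forall>\<omega>. (\<Sum>k\<in>insert i (insert j J). b k * Y k \<omega>) = (\<Sum>k\<in>insert i (insert j J). b' k * Y' k \<omega>)" for b
      proof -
        obtain b' where b': "\<forall>\<omega>. (\<Sum>k\<in>insert i J. b k * Y k \<omega>) = (\<Sum>k\<in>insert i J. b' k * Y' k \<omega>)"
          using ex by blast
        have "(\<Sum>k\<in>insert i J. b' k * Y' k \<omega>) = (\<Sum>k\<in>insert i J. (b'(j := b j)) k * Y' k \<omega>)" for \<omega>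
          using j by (intro sum.cong) auto
        then show ?thesis
          by (intro exI[of _ "b'(j := b j)"]) (simp only: split b' Yj, simp)
      qed
      then show ?thesis
        using Y' sum True unfolding split by (intro exI[of _ t] exI[of _ Y']) auto
    next
      case False
      define r where "r = sqrt (t\<^sup>2 + (a j)\<^sup>2)"
      have r: "r > 0" "r\<^sup>2 = t\<^sup>2 + (a j)\<^sup>2"
        using False by (auto simp: r_def sum_power2_gt_zero_iff)
      define c s where "c = t / r" and "s = a j / r"
      have cs: "c\<^sup>2 + s\<^sup>2 = 1" "s \<noteq> 0"
        using r False by (auto simp: c_def s_def power_divide add_divide_distrib[symmetric])
      define Y2 where "Y2 = Y'(i := \<lambda>\<omega>. c * Y' i \<omega> + s * Y' j \<omega>, j := \<lambda>\<omega>. - s * Y' i \<omega> + c * Y' j \<omega>)"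
      have Y2: "gauss_family P Y2 I"
        unfolding Y2_def by (rule gauss_family_rotate) (use Y' fin i j cs in auto)
      have Y2i: "Y2 i \<omega> = c * Y' i \<omega> + s * Y' j \<omega>" and Y2j: "Y2 j \<omega> = - s * Y' i \<omega> + c * Y' j \<omega>" for \<omega>
        using j by (auto simp: Y2_def)
      have Y2k: "Y2 k = Y' k" if "k \<noteq> i" "k \<noteq> j" for k
        using that by (simp add: Y2_def)
      have "(\<Sum>k\<in>insert i (insert j J). a k * Y k \<omega>) = r * Y2 i \<omega>" for \<omega>
        using r(1) unfolding split sum Y2i c_def s_def Yj by (simp add: distrib_left)
      moreover have "\<exists>b'. \<forall>\<omega>. (\<Sum>k\<in>insert i (insert j J). b k * Y k \<omega>) = (\<Sum>k\<in>insert i (insert j J). b' k * Y2 k \<omega>)" for b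
      proof -
        obtain b' where b': "\<forall>\<omega>. (\<Sum>k\<in>insert i J. b k * Y k \<omega>) = (\<Sum>k\<in>insert i J. b' k * Y' k \<omega>)"
          using ex by blast
        \<comment> \<open>The coefficients transform by the same rotation as the variables.\<close>
        define b2 where "b2 = b'(i := c * b' i + s * b j, j := - s * b' i + c * b j)"
        have b2: "b2 i = c * b' i + s * b j" "b2 j = - s * b' i + c * b j"
          using j by (auto simp: b2_def)
        have J2: "(\<Sum>k\<in>J. b2 k * Y2 k \<omega>) = (\<Sum>k\<in>J. b' k * Y' k \<omega>)" for \<omega>
          using j by (intro sum.cong) (auto simp: b2_def Y2_def)
        have "b j * Y j \<omega> + b' i * Y' i \<omega> = b2 j * Y2 j \<omega> + b2 i * Y2 i \<omega>" for \<omega>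
        proof -
          have "b2 j * Y2 j \<omega> + b2 i * Y2 i \<omega> = (c\<^sup>2 + s\<^sup>2) * (b j * Y' j \<omega> + b' i * Y' i \<omega>)"
            unfolding b2 Y2i Y2j by (simp add: algebra_simps power2_eq_square)
          then show ?thesis
            by (simp add: cs Yj)
        qed
        then have "(\<Sum>k\<in>insert i (insert j J). b k * Y k \<omega>) = (\<Sum>k\<in>insert i (insert j J). b2 k * Y2 k \<omega>)" for \<omega>
          unfolding split b'[rule_format] using insert.hyps j by (simp add: J2)
        then show ?thesis
          by blast
      qed
      ultimately show ?thesis
        using Y2 Y'(2) Y2k by (intro exI[of _ r] exI[of _ Y2]) auto
    qed
  qed
qed

text \<open>A QR decomposition of two coefficient vectors: the first form is collapsed to one coordinate,
  and then the part of the second form that lives on the remaining coordinates is collapsed to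
  another one. This replaces a theory of multivariate normal laws.\<close>

lemma gauss_family_two_forms:
  fixes Z :: "'i \<Rightarrow> 'a \<Rightarrow> real"
  assumes fam: "gauss_family P Z I" and fin: "finite I" and ij: "i \<in> I" "j \<in> I" "i \<noteq> j"
  obtains t \<beta> \<gamma> Y where "gauss_family P Y I"
    "\<And>\<omega>. (\<Sum>k\<in>I. a k * Z k \<omega>) = t * Y i \<omega>"
    "\<And>\<omega>. (\<Sum>k\<in>I. b k * Z k \<omega>) = \<beta> * Y i \<omega> + \<gamma> * Y j \<omega>"
proof -
  have I: "insert i (I - {i}) = I" "insert j (I - {i, j}) = I - {i}"
    using ij by auto
  obtain t Y1 where Y1: "gauss_family P Y1 I"
      and a: "\<And>\<omega>. (\<Sum>k\<in>I. a k * Z k \<omega>) = t * Y1 i \<omega>"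
      and ex: "\<And>b. \<exists>b'. \<forall>\<omega>. (\<Sum>k\<in>I. b k * Z k \<omega>) = (\<Sum>k\<in>I. b' k * Y1 k \<omega>)"
    using gauss_family_collapse[OF fam fin ij(1), of "I - {i}" a] unfolding I by auto
  obtain b' where b': "\<And>\<omega>. (\<Sum>k\<in>I. b k * Z k \<omega>) = (\<Sum>k\<in>I. b' k * Y1 k \<omega>)"
    using ex by metis
  have sub: "I - {i, j} \<subseteq> I - {j}"
    by auto
  obtain \<gamma> Y2 where Y2: "gauss_family P Y2 I" "\<forall>k\<in>I - (I - {i}). Y2 k = Y1 k"
      and b2: "\<And>\<omega>. (\<Sum>k\<in>I - {i}. b' k * Y1 k \<omega>) = \<gamma> * Y2 j \<omega>"
    using gauss_family_collapse[OF Y1 fin ij(2) sub, of b'] unfolding I by auto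
  have "Y2 i = Y1 i"
    using Y2(2) ij by auto
  show ?thesis
  proof (rule that[OF Y2(1)])
    show "(\<Sum>k\<in>I. a k * Z k \<omega>) = t * Y2 i \<omega>" for \<omega>
      using a \<open>Y2 i = Y1 i\<close> by simp
    show "(\<Sum>k\<in>I. b k * Z k \<omega>) = b' i * Y2 i \<omega> + \<gamma> * Y2 j \<omega>" for \<omega>
      unfolding b' b2[symmetric] \<open>Y2 i = Y1 i\<close> using fin ij by (simp add: sum.remove)
  qed
qed

section \<open>Absolute moments of a pair of correlated normal variables\<close>

text \<open>The integrand has an elementary primitive, a combination of \<open>t / (1 + t\<^sup>2)\<close>,
  \<open>arctan t\<close> and \<open>1 / (1 + t\<^sup>2)\<close>. The integral over the half line
  where \<open>\<beta> + \<gamma> t\<close> is nonnegative is evaluated between the zero of that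
  factor and infinity.\<close>

lemma nn_integral_abs_linear_cauchy_half:
  fixes \<beta> \<gamma> :: real
  assumes \<gamma>: "\<gamma> > 0" and unit: "\<beta>\<^sup>2 + \<gamma>\<^sup>2 = 1"
  defines "K \<equiv> \<beta> * pi / 4 + (\<gamma> + \<beta> * arctan (\<beta> / \<gamma>)) / 2"
  shows "(\<integral>\<^sup>+t. ennreal ((\<beta> + \<gamma> * t) / (1 + t\<^sup>2)\<^sup>2) * indicator {- \<beta> / \<gamma>..} t \<partial>lborel) = ennreal K"
    and "K \<ge> 0"
proof -
  define F where "F t = \<beta> / 2 * (t / (1 + t\<^sup>2) + arctan t) - \<gamma> / (2 * (1 + t\<^sup>2))" for t :: real
  let ?a = "- \<beta> / \<gamma>"
  have D: "DERIV F t :> (\<beta> + \<gamma> * t) / (1 + t\<^sup>2)\<^sup>2" for t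
  proof -
    have pos: "1 + t\<^sup>2 > 0"
      by (simp add: add_pos_nonneg)
    have 1: "DERIV (\<lambda>t. t / (1 + t\<^sup>2)) t :> (1 - t\<^sup>2) / (1 + t\<^sup>2)\<^sup>2"
      using pos by (auto intro!: derivative_eq_intros simp: power2_eq_square)
    have 2: "DERIV (\<lambda>t. 1 / (1 + t\<^sup>2)) t :> - (2 * t) / (1 + t\<^sup>2)\<^sup>2"
      using pos by (auto intro!: derivative_eq_intros simp: power2_eq_square)
    have "DERIV (\<lambda>t. \<beta> / 2 * (t / (1 + t\<^sup>2) + arctan t) - \<gamma> / 2 * (1 / (1 + t\<^sup>2))) t :>
        \<beta> / 2 * ((1 - t\<^sup>2) / (1 + t\<^sup>2)\<^sup>2 + inverse (1 + t\<^sup>2)) - \<gamma> / 2 * (- (2 * t) / (1 + t\<^sup>2)\<^sup>2)"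
      by (intro DERIV_diff DERIV_cmult DERIV_add 1 2 DERIV_arctan)
    moreover have "inverse (1 + t\<^sup>2) = (1 + t\<^sup>2) / (1 + t\<^sup>2)\<^sup>2"
      using pos by (simp add: power2_eq_square inverse_eq_divide)
    then have "\<beta> / 2 * ((1 - t\<^sup>2) / (1 + t\<^sup>2)\<^sup>2 + inverse (1 + t\<^sup>2)) - \<gamma> / 2 * (- (2 * t) / (1 + t\<^sup>2)\<^sup>2) =
        (\<beta> + \<gamma> * t) / (1 + t\<^sup>2)\<^sup>2"
      by (simp add: add_divide_distrib[symmetric])
    moreover have "F = (\<lambda>t. \<beta> / 2 * (t / (1 + t\<^sup>2) + arctan t) - \<gamma> / 2 * (1 / (1 + t\<^sup>2)))"
      by (simp add: F_def[abs_def])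
    ultimately show ?thesis
      by simp
  qed
  have lim: "(F \<longlongrightarrow> \<beta> * pi / 4) at_top"
  proof -
    have "((\<lambda>t. \<beta> / 2 * (t / (1 + t\<^sup>2) + arctan t) - \<gamma> / (2 * (1 + t\<^sup>2))) \<longlongrightarrow>
        \<beta> / 2 * (0 + pi / 2) - 0) at_top"
    proof (intro tendsto_intros tendsto_arctan_at_top)
      show "((\<lambda>t::real. t / (1 + t\<^sup>2)) \<longlongrightarrow> 0) at_top"
        by real_asymp
      show "((\<lambda>t::real. \<gamma> / (2 * (1 + t\<^sup>2))) \<longlongrightarrow> 0) at_top"
        by real_asymp
    qed
    then show ?thesis
      by (simp add: F_def[abs_def])
  qed
  have nonneg: "0 \<le> (\<beta> + \<gamma> * t) / (1 + t\<^sup>2)\<^sup>2" if "?a \<le> t" for t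
    using that \<gamma> by (auto simp: field_simps)
  have Fa: "F ?a = - (\<gamma> + \<beta> * arctan (\<beta> / \<gamma>)) / 2"
  proof -
    \<comment> \<open>The lower limit is the slope at which the linear factor vanishes; there the Cauchy
      denominator simplifies because the coefficients form a unit vector.\<close>
    have 1: "1 + ?a\<^sup>2 = 1 / \<gamma>\<^sup>2"
      using \<gamma> unit by (simp add: field_simps)
    have "F ?a = - (\<gamma> * (\<beta>\<^sup>2 + \<gamma>\<^sup>2) + \<beta> * arctan (\<beta> / \<gamma>)) / 2"
      unfolding F_def 1 using \<gamma> by (simp add: arctan_minus field_simps power2_eq_square)
    then show ?thesis
      by (simp add: unit)
  qed
  show "(\<integral>\<^sup>+t. ennreal ((\<beta> + \<gamma> * t) / (1 + t\<^sup>2)\<^sup>2) * indicator {?a..} t \<partial>lborel) = ennreal K"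
  proof -
    have "\<beta> * pi / 4 - F ?a = K"
      unfolding K_def Fa by linarith
    then show ?thesis
      by (subst nn_integral_FTC_atLeast[OF _ D nonneg lim]) auto
  qed
  have "F ?a \<le> F t" if "?a \<le> t" for t
    by (rule DERIV_nonneg_imp_nondecreasing[OF that]) (use D nonneg in blast)
  then have "F ?a \<le> \<beta> * pi / 4"
    by (intro tendsto_lowerbound[OF lim]) (auto simp: eventually_at_top_linorder)
  then show "K \<ge> 0"
    unfolding K_def using Fa by linarith
qed

text \<open>Reflection at 0 turns the negative part of the integrand into the positive part for \<open>-
  \<beta>\<close>. In the sum of the two half-line integrals the terms with \<open>pi / 4\<close>
  cancel.\<close>

lemma nn_integral_abs_linear_cauchy:
  fixes \<beta> \<gamma> :: real
  assumes \<gamma>: "\<gamma> \<noteq> 0" and unit: "\<beta>\<^sup>2 + \<gamma>\<^sup>2 = 1"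
  shows "(\<integral>\<^sup>+t. ennreal (\<bar>\<beta> + \<gamma> * t\<bar> / (1 + t\<^sup>2)\<^sup>2) \<partial>lborel) = ennreal (\<bar>\<gamma>\<bar> + \<beta> * arcsin \<beta>)"
proof -
  have pos: "(\<integral>\<^sup>+t. ennreal (\<bar>\<beta> + \<gamma> * t\<bar> / (1 + t\<^sup>2)\<^sup>2) \<partial>lborel) = ennreal (\<gamma> + \<beta> * arcsin \<beta>)"
    if \<gamma>: "\<gamma> > 0" and unit: "\<beta>\<^sup>2 + \<gamma>\<^sup>2 = 1" for \<gamma> :: real
  proof -
    have "\<beta>\<^sup>2 < 1"
      using unit \<gamma> zero_less_power[OF \<gamma>, of 2] by linarith
    then have "\<bar>\<beta>\<bar> < 1"
      by (simp add: abs_square_less_1)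
    moreover have "sqrt (1 - \<beta>\<^sup>2) = \<gamma>"
      using unit \<gamma> by (intro real_sqrt_unique) auto
    ultimately have arc: "arcsin \<beta> = arctan (\<beta> / \<gamma>)"
      using arcsin_arctan[of \<beta>] by auto
    let ?g = "\<lambda>\<beta> t. ennreal ((\<beta> + \<gamma> * t) / (1 + t\<^sup>2)\<^sup>2) * indicator {- \<beta> / \<gamma>..} t"
    note half = nn_integral_abs_linear_cauchy_half[OF \<gamma> unit]
    have unit': "(- \<beta>)\<^sup>2 + \<gamma>\<^sup>2 = 1"
      using unit by simp
    note half' = nn_integral_abs_linear_cauchy_half[OF \<gamma> unit']
    have "(\<integral>\<^sup>+t. ennreal (\<bar>\<beta> + \<gamma> * t\<bar> / (1 + t\<^sup>2)\<^sup>2) \<partial>lborel) =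
        (\<integral>\<^sup>+t. ?g \<beta> t + ?g (- \<beta>) (- t) \<partial>lborel)"
    proof (rule nn_integral_cong)
      fix t :: real
      show "ennreal (\<bar>\<beta> + \<gamma> * t\<bar> / (1 + t\<^sup>2)\<^sup>2) = ?g \<beta> t + ?g (- \<beta>) (- t)"
        using \<gamma> by (cases "\<beta> + \<gamma> * t" "0 :: real" rule: linorder_cases)
          (auto simp: indicator_def field_simps abs_if)
    qed
    also have "\<dots> = (\<integral>\<^sup>+t. ?g \<beta> t \<partial>lborel) + (\<integral>\<^sup>+t. ?g (- \<beta>) (- t) \<partial>lborel)"
      by (rule nn_integral_add) auto
    also have "(\<integral>\<^sup>+t. ?g (- \<beta>) (- t) \<partial>lborel) = (\<integral>\<^sup>+t. ?g (- \<beta>) t \<partial>lborel)"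
      by (subst (2) nn_integral_real_affine[where c = "-1" and t = 0]) auto
    also have "(\<integral>\<^sup>+t. ?g \<beta> t \<partial>lborel) + (\<integral>\<^sup>+t. ?g (- \<beta>) t \<partial>lborel) = ennreal (\<gamma> + \<beta> * arctan (\<beta> / \<gamma>))"
      unfolding half(1) half'(1)
    proof (subst ennreal_plus[symmetric, OF half(2) half'(2)], rule arg_cong[where f = ennreal])
      have "arctan (- \<beta> / \<gamma>) = - arctan (\<beta> / \<gamma>)"
        using arctan_minus[of "\<beta> / \<gamma>"] by simp
      then show "\<beta> * pi / 4 + (\<gamma> + \<beta> * arctan (\<beta> / \<gamma>)) / 2 + (- \<beta> * pi / 4 + (\<gamma> + - \<beta> * arctan (- \<beta> / \<gamma>)) / 2) =
          \<gamma> + \<beta> * arctan (\<beta> / \<gamma>)"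
        by (simp only:) (simp add: field_simps)
    qed
    finally show ?thesis
      by (simp add: arc)
  qed
  show ?thesis
  proof (cases "\<gamma> > 0")
    case True
    then show ?thesis
      using pos[OF _ unit] by simp
  next
    case False
    have "(\<integral>\<^sup>+t. ennreal (\<bar>\<beta> + \<gamma> * t\<bar> / (1 + t\<^sup>2)\<^sup>2) \<partial>lborel) =
       (\<integral>\<^sup>+t. ennreal (\<bar>\<beta> + (- \<gamma>) * t\<bar> / (1 + t\<^sup>2)\<^sup>2) \<partial>lborel)"
      by (subst nn_integral_real_affine[where c = "-1" and t = 0]) auto
    then show ?thesis
      using pos[of "- \<gamma>"] False \<gamma> unit by simp
  qed
qed

lemma nn_integral_std_normal_cubic_scaled:
  fixes r :: real
  assumes r: "r > 0"
  shows "(\<integral>\<^sup>+x. ennreal (std_normal_density (r * x) * \<bar>x\<bar> ^ 3) \<partial>lborel) = ennreal (2 * sqrt (2 / pi) / r ^ 4)"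
proof -
  have "(\<integral>\<^sup>+x. ennreal (std_normal_density x * \<bar>x\<bar> ^ 3) \<partial>lborel) = ennreal (2 * sqrt (2 / pi))"
    using std_normal_moment_abs_odd[of 1]
    by (subst nn_integral_eq_integral) (auto simp: has_bochner_integral_iff mult_ac)
  then have "ennreal (2 * sqrt (2 / pi)) =
      ennreal \<bar>r\<bar> * (\<integral>\<^sup>+x. ennreal (std_normal_density (r * x) * \<bar>r * x\<bar> ^ 3) \<partial>lborel)"
    using r by (subst (asm) nn_integral_real_affine[where c = r and t = 0]) auto
  also have "\<dots> = (\<integral>\<^sup>+x. ennreal (r ^ 4) * ennreal (std_normal_density (r * x) * \<bar>x\<bar> ^ 3) \<partial>lborel)"
  proof (subst nn_integral_cmult[symmetric])
    have "\<bar>r\<bar> * (std_normal_density (r * x) * \<bar>r * x\<bar> ^ 3) = r ^ 4 * (std_normal_density (r * x) * \<bar>x\<bar> ^ 3)" for x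
      using r by (simp add: abs_mult power_mult_distrib eval_nat_numeral)
    then have "ennreal \<bar>r\<bar> * ennreal (std_normal_density (r * x) * \<bar>r * x\<bar> ^ 3) =
        ennreal (r ^ 4) * ennreal (std_normal_density (r * x) * \<bar>x\<bar> ^ 3)" for x
      using r by (metis ennreal_mult' abs_ge_zero zero_le_power less_imp_le)
    then show "(\<integral>\<^sup>+x. ennreal \<bar>r\<bar> * ennreal (std_normal_density (r * x) * \<bar>r * x\<bar> ^ 3) \<partial>lborel) =
        (\<integral>\<^sup>+x. ennreal (r ^ 4) * ennreal (std_normal_density (r * x) * \<bar>x\<bar> ^ 3) \<partial>lborel)"
      by simp
  qed simp
  also have "\<dots> = ennreal (r ^ 4) * (\<integral>\<^sup>+x. ennreal (std_normal_density (r * x) * \<bar>x\<bar> ^ 3) \<partial>lborel)"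
    by (rule nn_integral_cmult) auto
  finally have "ennreal (1 / r ^ 4) * ennreal (2 * sqrt (2 / pi)) =
      ennreal (1 / r ^ 4) * (ennreal (r ^ 4) * (\<integral>\<^sup>+x. ennreal (std_normal_density (r * x) * \<bar>x\<bar> ^ 3) \<partial>lborel))"
    by simp
  then show ?thesis
    using r by (simp flip: mult.assoc ennreal_mult)
qed

text \<open>Substituting \<open>y = x t\<close> separates the radius from the slope \<open>t\<close>: the
  integral over \<open>x\<close> is a third absolute moment and leaves the weight \<open>1 / (1 +
  t\<^sup>2)\<^sup>2\<close> on the slope. This plays the role of polar coordinates.\<close>

lemma nn_integral_gauss_abs_product:
  fixes \<beta> \<gamma> :: real
  assumes \<gamma>: "\<gamma> \<noteq> 0" and unit: "\<beta>\<^sup>2 + \<gamma>\<^sup>2 = 1"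
  shows "(\<integral>\<^sup>+x. \<integral>\<^sup>+y. ennreal (\<bar>x\<bar> * \<bar>\<beta> * x + \<gamma> * y\<bar>) \<partial>gauss \<partial>gauss) =
    ennreal (2 / pi * (\<bar>\<gamma>\<bar> + \<beta> * arcsin \<beta>))"
proof -
  let ?d = std_normal_density
  have slope: "(\<integral>\<^sup>+y. ennreal (?d x * ?d y * (\<bar>x\<bar> * \<bar>\<beta> * x + \<gamma> * y\<bar>)) \<partial>lborel) =
      (\<integral>\<^sup>+t. ennreal (\<bar>\<beta> + \<gamma> * t\<bar>) * ennreal (?d x * ?d (t * x) * \<bar>x\<bar> ^ 3) \<partial>lborel)" for x
  proof (cases "x = 0")
    case False
    have "\<bar>x\<bar> * \<bar>\<beta> * x + \<gamma> * (x * t)\<bar> * \<bar>x\<bar> = \<bar>\<beta> + \<gamma> * t\<bar> * \<bar>x\<bar> ^ 3" for t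
    proof -
      have "\<beta> * x + \<gamma> * (x * t) = x * (\<beta> + \<gamma> * t)"
        by (simp add: algebra_simps)
      then show ?thesis
        by (simp add: abs_mult eval_nat_numeral)
    qed
    note * = this
    have "ennreal \<bar>x\<bar> * ennreal (?d x * ?d (x * t) * (\<bar>x\<bar> * \<bar>\<beta> * x + \<gamma> * (x * t)\<bar>)) =
      ennreal (\<bar>\<beta> + \<gamma> * t\<bar>) * ennreal (?d x * ?d (t * x) * \<bar>x\<bar> ^ 3)" for t
      using *[of t] by (simp add: ennreal_mult[symmetric] mult_ac)
    then show ?thesis
      using False
      by (subst nn_integral_real_affine[where c = x and t = 0]) (auto simp: nn_integral_cmult[symmetric])
  qed simp
  have prod: "?d x * ?d (t * x) = 1 / sqrt (2 * pi) * ?d (sqrt (1 + t\<^sup>2) * x)" for x t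
  proof -
    have "- x\<^sup>2 / 2 + - (t * x)\<^sup>2 / 2 = - (sqrt (1 + t\<^sup>2) * x)\<^sup>2 / 2"
      by (simp add: power_mult_distrib field_simps)
    then have "exp (- x\<^sup>2 / 2) * exp (- (t * x)\<^sup>2 / 2) = exp (- (sqrt (1 + t\<^sup>2) * x)\<^sup>2 / 2)"
      by (simp only: exp_add[symmetric])
    then show ?thesis
      by (simp add: std_normal_density_def)
  qed
  have radial: "(\<integral>\<^sup>+x. ennreal (?d x * ?d (t * x) * \<bar>x\<bar> ^ 3) \<partial>lborel) = ennreal (2 / pi / (1 + t\<^sup>2)\<^sup>2)" for t
  proof -
    have pos: "0 < sqrt (1 + t\<^sup>2)"
      by (simp add: add_pos_nonneg)
    have "(\<integral>\<^sup>+x. ennreal (?d x * ?d (t * x) * \<bar>x\<bar> ^ 3) \<partial>lborel) =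
        (\<integral>\<^sup>+x. ennreal (1 / sqrt (2 * pi)) * ennreal (?d (sqrt (1 + t\<^sup>2) * x) * \<bar>x\<bar> ^ 3) \<partial>lborel)"
      unfolding prod by (simp add: ennreal_mult[symmetric] mult.assoc)
    also have "\<dots> = ennreal (1 / sqrt (2 * pi)) * ennreal (2 * sqrt (2 / pi) / sqrt (1 + t\<^sup>2) ^ 4)"
      by (subst nn_integral_cmult) (auto simp: nn_integral_std_normal_cubic_scaled[OF pos])
    also have "\<dots> = ennreal (1 / sqrt (2 * pi) * (2 * sqrt (2 / pi) / sqrt (1 + t\<^sup>2) ^ 4))"
      by (subst ennreal_mult[symmetric]) auto
    also have "sqrt (1 + t\<^sup>2) ^ 4 = (1 + t\<^sup>2)\<^sup>2"
      using power_mult[of "sqrt (1 + t\<^sup>2)" 2 2] by (simp add: add_nonneg_nonneg)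
    also have "1 / sqrt (2 * pi) * (2 * sqrt (2 / pi) / (1 + t\<^sup>2)\<^sup>2) = 2 / pi / (1 + t\<^sup>2)\<^sup>2"
      by (simp add: real_sqrt_mult real_sqrt_divide)
    finally show ?thesis .
  qed
  have "(\<integral>\<^sup>+x. \<integral>\<^sup>+y. ennreal (\<bar>x\<bar> * \<bar>\<beta> * x + \<gamma> * y\<bar>) \<partial>gauss \<partial>gauss) =
      (\<integral>\<^sup>+x. \<integral>\<^sup>+y. ennreal (?d x * ?d y * (\<bar>x\<bar> * \<bar>\<beta> * x + \<gamma> * y\<bar>)) \<partial>lborel \<partial>lborel)"
    by (simp add: nn_integral_gauss nn_integral_cmult[symmetric] ennreal_mult[symmetric] mult.assoc)
  also have "\<dots> = (\<integral>\<^sup>+x. \<integral>\<^sup>+t. ennreal (\<bar>\<beta> + \<gamma> * t\<bar>) * ennreal (?d x * ?d (t * x) * \<bar>x\<bar> ^ 3) \<partial>lborel \<partial>lborel)"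
    by (simp only: slope)
  also have "\<dots> = (\<integral>\<^sup>+t. \<integral>\<^sup>+x. ennreal (\<bar>\<beta> + \<gamma> * t\<bar>) * ennreal (?d x * ?d (t * x) * \<bar>x\<bar> ^ 3) \<partial>lborel \<partial>lborel)"
    by (rule lborel_pair.Fubini') simp
  also have "\<dots> = (\<integral>\<^sup>+t. ennreal (2 / pi) * ennreal (\<bar>\<beta> + \<gamma> * t\<bar> / (1 + t\<^sup>2)\<^sup>2) \<partial>lborel)"
  proof (intro nn_integral_cong)
    fix t
    show "(\<integral>\<^sup>+x. ennreal (\<bar>\<beta> + \<gamma> * t\<bar>) * ennreal (?d x * ?d (t * x) * \<bar>x\<bar> ^ 3) \<partial>lborel) =
        ennreal (2 / pi) * ennreal (\<bar>\<beta> + \<gamma> * t\<bar> / (1 + t\<^sup>2)\<^sup>2)"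
      by (subst nn_integral_cmult) (auto simp: radial ennreal_mult[symmetric])
  qed
  also have "\<dots> = ennreal (2 / pi) * ennreal (\<bar>\<gamma>\<bar> + \<beta> * arcsin \<beta>)"
    by (subst nn_integral_cmult) (auto simp: nn_integral_abs_linear_cauchy[OF \<gamma> unit])
  also have "\<dots> = ennreal (2 / pi * (\<bar>\<gamma>\<bar> + \<beta> * arcsin \<beta>))"
    by (rule ennreal_mult'[symmetric]) simp
  finally show ?thesis .
qed


lemma gauss_family_abs_moments:
  assumes fam: "gauss_family P Y I" and i: "i \<in> I"
  shows "integrable P (\<lambda>\<omega>. \<bar>Y i \<omega>\<bar> ^ k)"
    and "integrable P (\<lambda>\<omega>. Y i \<omega> ^ k)"
    and "(\<integral>\<omega>. \<bar>Y i \<omega>\<bar> \<partial>P) = sqrt (2 / pi)"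
    and "(\<integral>\<omega>. Y i \<omega> \<partial>P) = 0"
    and "(\<integral>\<omega>. (Y i \<omega>)\<^sup>2 \<partial>P) = 1"
proof -
  note D = gauss_family_distributed[OF assms]
  show "integrable P (\<lambda>\<omega>. \<bar>Y i \<omega>\<bar> ^ k)"
    using distributed_integrable[OF D, of "\<lambda>x. \<bar>x\<bar> ^ k"] integrable_std_normal_moment_abs[of k] by simp
  show "integrable P (\<lambda>\<omega>. Y i \<omega> ^ k)"
    using distributed_integrable[OF D, of "\<lambda>x. x ^ k"] integrable_std_normal_moment[of k] by simp
  show "(\<integral>\<omega>. \<bar>Y i \<omega>\<bar> \<partial>P) = sqrt (2 / pi)"
    using distributed_integral[OF D, of "\<lambda>x. \<bar>x\<bar>"] integral_std_normal_moment_abs_odd[of 0] by simp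
  show "(\<integral>\<omega>. Y i \<omega> \<partial>P) = 0"
    using distributed_integral[OF D, of "\<lambda>x. x"] integral_std_normal_moment_odd[of 0] by simp
  show "(\<integral>\<omega>. (Y i \<omega>)\<^sup>2 \<partial>P) = 1"
    using distributed_integral[OF D, of "\<lambda>x. x\<^sup>2"] integral_std_normal_moment_even[of 1] by simp
qed

lemma gauss_family_pair:
  fixes Y :: "'i \<Rightarrow> 'a \<Rightarrow> real"
  assumes fam: "gauss_family P Y I" and ij: "i \<in> I" "j \<in> I" "i \<noteq> j"
    and [measurable]: "case_prod f \<in> borel_measurable (borel \<Otimes>\<^sub>M borel)"
  shows "(\<integral>\<^sup>+\<omega>. f (Y i \<omega>) (Y j \<omega>) \<partial>P) = (\<integral>\<^sup>+x. \<integral>\<^sup>+y. f x y \<partial>gauss \<partial>gauss)"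
proof -
  interpret pg: pair_sigma_finite gauss gauss
    by unfold_locales
  have fg [measurable]: "case_prod f \<in> borel_measurable (gauss \<Otimes>\<^sub>M gauss)"
    using assms(5) by (simp add: measurable_cong_sets[OF sets_pair_measure_cong[OF sets_gauss sets_gauss] refl])
  have fam2: "gauss_family P Y {i, j}"
    by (rule gauss_family_subset[OF fam]) (use ij in auto)
  have m: "(\<lambda>x. f (x i) (x j)) \<in> borel_measurable (gauss_power {i, j})"
    using measurable_compose[OF measurable_Pair[OF measurable_component_singleton[of i "{i, j}" "\<lambda>_. gauss"]
      measurable_component_singleton[of j "{i, j}" "\<lambda>_. gauss"]] fg] by simp
  have "(\<integral>\<^sup>+\<omega>. f (Y i \<omega>) (Y j \<omega>) \<partial>P) = (\<integral>\<^sup>+x. f (x i) (x j) \<partial>distr P (gauss_power {i, j}) (\<lambda>\<omega>. \<lambda>k\<in>{i, j}. Y k \<omega>))"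
    using m by (subst nn_integral_distr[OF gauss_family_measurable(2)[OF fam2]]) simp_all
  also have "\<dots> = (\<integral>\<^sup>+x. f (x i) (x j) \<partial>gauss_power {i, j})"
    using fam2 by (simp add: gauss_family_def)
  also have "\<dots> = (\<integral>\<^sup>+z. f (fst z) (snd z) \<partial>(gauss \<Otimes>\<^sub>M gauss))"
    by (rule gauss_prod.product_nn_integral_pair) (use ij in auto)
  also have "\<dots> = (\<integral>\<^sup>+x. \<integral>\<^sup>+y. f x y \<partial>gauss \<partial>gauss)"
    by (subst gauss.nn_integral_fst[symmetric]) (auto simp: split_beta')
  finally show ?thesis .
qed

lemma gauss_family_product:
  assumes P: "prob_space P" and fam: "gauss_family P Y I" and ij: "i \<in> I" "j \<in> I"
  shows "integrable P (\<lambda>\<omega>. Y i \<omega> * Y j \<omega>)"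
    and "(\<integral>\<omega>. Y i \<omega> * Y j \<omega> \<partial>P) = of_bool (i = j)"
proof -
  interpret prob_space P by fact
  have I: "I \<noteq> {}"
    using ij by auto
  have "integrable P (\<lambda>\<omega>. Y i \<omega> * Y j \<omega>) \<and> (\<integral>\<omega>. Y i \<omega> * Y j \<omega> \<partial>P) = of_bool (i = j)"
  proof (cases "i = j")
    case True
    then show ?thesis
      using gauss_family_abs_moments(2)[OF fam ij(1), of 2] gauss_family_abs_moments(5)[OF fam ij(1)]
      by (simp add: power2_eq_square)
  next
    case False
    have ind: "indep_vars (\<lambda>_. borel) Y {i, j}"
      by (rule indep_vars_subset[of _ _ I]) (use fam ij gauss_family_iff_indep[OF P I] in auto)
    have int: "integrable P (Y k)" if "k \<in> {i, j}" for k
      using that ij gauss_family_abs_moments(2)[OF fam, of _ 1] by auto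
    show ?thesis
      using indep_vars_integrable[OF _ ind int] indep_vars_lebesgue_integral[OF _ ind int] False
        gauss_family_abs_moments(4)[OF fam ij(1)] by simp
  qed
  then show "integrable P (\<lambda>\<omega>. Y i \<omega> * Y j \<omega>)" "(\<integral>\<omega>. Y i \<omega> * Y j \<omega> \<partial>P) = of_bool (i = j)"
    by auto
qed

lemma gauss_family_covariance:
  assumes P: "prob_space P" and fam: "gauss_family P Y I" and fin: "finite I"
  shows "integrable P (\<lambda>\<omega>. (\<Sum>i\<in>I. a i * Y i \<omega>) * (\<Sum>i\<in>I. b i * Y i \<omega>))"
    and "(\<integral>\<omega>. (\<Sum>i\<in>I. a i * Y i \<omega>) * (\<Sum>i\<in>I. b i * Y i \<omega>) \<partial>P) = (\<Sum>i\<in>I. a i * b i)"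
proof -
  have eq: "(\<Sum>i\<in>I. a i * Y i \<omega>) * (\<Sum>i\<in>I. b i * Y i \<omega>) = (\<Sum>i\<in>I. \<Sum>j\<in>I. (a i * b j) * (Y i \<omega> * Y j \<omega>))" for \<omega>
    by (simp add: sum_product mult_ac)
  show "integrable P (\<lambda>\<omega>. (\<Sum>i\<in>I. a i * Y i \<omega>) * (\<Sum>i\<in>I. b i * Y i \<omega>))"
    unfolding eq by (intro Bochner_Integration.integrable_sum integrable_mult_right gauss_family_product(1)[OF P fam])
  have "(\<integral>\<omega>. (\<Sum>i\<in>I. a i * Y i \<omega>) * (\<Sum>i\<in>I. b i * Y i \<omega>) \<partial>P) = (\<Sum>i\<in>I. \<Sum>j\<in>I. (a i * b j) * of_bool (i = j))"
    unfolding eq using gauss_family_product[OF P fam]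
    by (subst Bochner_Integration.integral_sum) (auto intro!: sum.cong simp: Bochner_Integration.integral_sum)
  also have "\<dots> = (\<Sum>i\<in>I. a i * b i)"
    using fin by (simp add: of_bool_def if_distrib[of "\<lambda>x. _ * x"] sum.delta' cong: if_cong)
  finally show "(\<integral>\<omega>. (\<Sum>i\<in>I. a i * Y i \<omega>) * (\<Sum>i\<in>I. b i * Y i \<omega>) \<partial>P) = (\<Sum>i\<in>I. a i * b i)" .
qed

lemma gauss_family_abs_form:
  assumes P: "prob_space P" and fam: "gauss_family P Z I" and fin: "finite I" and "I \<noteq> {}"
  shows "integrable P (\<lambda>\<omega>. \<bar>\<Sum>i\<in>I. a i * Z i \<omega>\<bar>)"
    and "(\<integral>\<omega>. \<bar>\<Sum>i\<in>I. a i * Z i \<omega>\<bar> \<partial>P) = sqrt (2 / pi) * sqrt (\<Sum>i\<in>I. (a i)\<^sup>2)"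
proof -
  obtain i where i: "i \<in> I"
    using assms by auto
  have I: "insert i (I - {i}) = I"
    using i by auto
  obtain t Y where Y: "gauss_family P Y I" and t: "\<And>\<omega>. (\<Sum>i\<in>I. a i * Z i \<omega>) = t * Y i \<omega>"
    using gauss_family_collapse[OF fam fin i, of "I - {i}" a] unfolding I by auto
  note m = gauss_family_abs_moments[OF Y i]
  show "integrable P (\<lambda>\<omega>. \<bar>\<Sum>i\<in>I. a i * Z i \<omega>\<bar>)"
    unfolding t abs_mult using m(1)[of 1] by simp
  have "(\<Sum>i\<in>I. (a i)\<^sup>2) = (\<integral>\<omega>. t\<^sup>2 * (Y i \<omega>)\<^sup>2 \<partial>P)"
    using gauss_family_covariance(2)[OF P fam fin, of a a] unfolding t
    by (simp add: power2_eq_square mult_ac)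
  also have "\<dots> = t\<^sup>2"
    using m(5) by simp
  finally have "sqrt (\<Sum>i\<in>I. (a i)\<^sup>2) = \<bar>t\<bar>"
    by simp
  then show "(\<integral>\<omega>. \<bar>\<Sum>i\<in>I. a i * Z i \<omega>\<bar> \<partial>P) = sqrt (2 / pi) * sqrt (\<Sum>i\<in>I. (a i)\<^sup>2)"
    unfolding t abs_mult using m(3) by simp
qed

text \<open>In the coordinates of the two-form reduction, the coefficients \<open>c, \<beta>,
  \<gamma>\<close> are identified from the second moments, and the integral of the absolute
  product becomes the two-dimensional one computed above.\<close>

lemma gauss_family_abs_product:
  fixes Z :: "'i \<Rightarrow> 'a \<Rightarrow> real" and a b :: "'i \<Rightarrow> real"
  assumes P: "prob_space P" and fam: "gauss_family P Z I" and fin: "finite I"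
    and ij: "i \<in> I" "j \<in> I" "i \<noteq> j"
  defines "s \<equiv> sqrt (\<Sum>k\<in>I. (a k)\<^sup>2)" and "t \<equiv> sqrt (\<Sum>k\<in>I. (b k)\<^sup>2)"
  defines "r \<equiv> (\<Sum>k\<in>I. a k * b k) / (s * t)"
  assumes pos: "s > 0" "t > 0" and r: "\<bar>r\<bar> < 1"
  shows "integrable P (\<lambda>\<omega>. \<bar>\<Sum>k\<in>I. a k * Z k \<omega>\<bar> * \<bar>\<Sum>k\<in>I. b k * Z k \<omega>\<bar>)"
    and "(\<integral>\<omega>. \<bar>\<Sum>k\<in>I. a k * Z k \<omega>\<bar> * \<bar>\<Sum>k\<in>I. b k * Z k \<omega>\<bar> \<partial>P) =
      2 / pi * (s * t) * (sqrt (1 - r\<^sup>2) + r * arcsin r)"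
proof -
  obtain c \<beta> \<gamma> Y where Y: "gauss_family P Y I"
    and a: "\<And>\<omega>. (\<Sum>k\<in>I. a k * Z k \<omega>) = c * Y i \<omega>"
    and b: "\<And>\<omega>. (\<Sum>k\<in>I. b k * Z k \<omega>) = \<beta> * Y i \<omega> + \<gamma> * Y j \<omega>"
    by (rule gauss_family_two_forms[OF fam fin ij, where a = a and b = b]) (rule that)
  have [measurable]: "Y i \<in> borel_measurable P" "Y j \<in> borel_measurable P"
    using gauss_family_measurable(1)[OF Y] ij by auto
  have ii: "integrable P (\<lambda>\<omega>. Y i \<omega> * Y i \<omega>)" "(\<integral>\<omega>. Y i \<omega> * Y i \<omega> \<partial>P) = 1"
    and jj: "integrable P (\<lambda>\<omega>. Y j \<omega> * Y j \<omega>)" "(\<integral>\<omega>. Y j \<omega> * Y j \<omega> \<partial>P) = 1"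
    and ij': "integrable P (\<lambda>\<omega>. Y i \<omega> * Y j \<omega>)" "(\<integral>\<omega>. Y i \<omega> * Y j \<omega> \<partial>P) = 0"
    using gauss_family_product[OF P Y] ij by auto
  have "(\<Sum>k\<in>I. (a k)\<^sup>2) = (\<integral>\<omega>. c\<^sup>2 * (Y i \<omega> * Y i \<omega>) \<partial>P)"
    using gauss_family_covariance(2)[OF P fam fin, of a a] unfolding a by (simp add: power2_eq_square mult_ac)
  then have s: "s = \<bar>c\<bar>"
    by (simp add: s_def ii)
  have "(\<Sum>k\<in>I. (b k)\<^sup>2) = (\<integral>\<omega>. \<beta>\<^sup>2 * (Y i \<omega> * Y i \<omega>) + (2 * \<beta> * \<gamma>) * (Y i \<omega> * Y j \<omega>) + \<gamma>\<^sup>2 * (Y j \<omega> * Y j \<omega>) \<partial>P)"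
    using gauss_family_covariance(2)[OF P fam fin, of b b] unfolding b
    by (simp add: power2_eq_square algebra_simps)
  then have t: "t\<^sup>2 = \<beta>\<^sup>2 + \<gamma>\<^sup>2"
    using ii jj ij' by (simp add: t_def)
  have "(\<Sum>k\<in>I. a k * b k) = (\<integral>\<omega>. (c * \<beta>) * (Y i \<omega> * Y i \<omega>) + (c * \<gamma>) * (Y i \<omega> * Y j \<omega>) \<partial>P)"
    using gauss_family_covariance(2)[OF P fam fin, of a b] unfolding a b
    by (simp add: algebra_simps)
  then have ab: "(\<Sum>k\<in>I. a k * b k) = c * \<beta>"
    using ii ij' by simp
  have c: "c \<noteq> 0"
    using pos s by simp
  define \<sigma> where "\<sigma> = sgn c"
  have \<sigma>: "\<sigma>\<^sup>2 = 1" "\<bar>\<sigma>\<bar> = 1"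
    using c by (auto simp: \<sigma>_def sgn_if)
  have r_eq: "r = \<sigma> * (\<beta> / t)"
    using c unfolding r_def ab s \<sigma>_def by (auto simp: sgn_if abs_if field_simps)
  have unit: "(\<beta> / t)\<^sup>2 + (\<gamma> / t)\<^sup>2 = 1"
    unfolding power_divide add_divide_distrib[symmetric] t[symmetric] using pos by simp
  have r2: "r\<^sup>2 = (\<beta> / t)\<^sup>2"
    unfolding r_eq power_mult_distrib[of \<sigma>] \<sigma> by simp
  have "r\<^sup>2 < 1"
    using r by (simp add: abs_square_less_1)
  then have \<gamma>: "\<gamma> / t \<noteq> 0"
    using unit r2 by auto
  have sq: "\<bar>\<gamma> / t\<bar> = sqrt (1 - r\<^sup>2)"
  proof (rule real_sqrt_unique[symmetric])
    show "\<bar>\<gamma> / t\<bar>\<^sup>2 = 1 - r\<^sup>2"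
      using unit r2 unfolding power2_abs by linarith
  qed simp
  have odd: "\<beta> / t * arcsin (\<beta> / t) = r * arcsin r"
  proof (cases "c > 0")
    case True
    then show ?thesis by (simp add: r_eq \<sigma>_def)
  next
    case False
    then have "r = - (\<beta> / t)"
      using c by (simp add: r_eq \<sigma>_def sgn_if)
    moreover from this have "\<bar>\<beta> / t\<bar> < 1"
      using r by simp
    then have "arcsin (- (\<beta> / t)) = - arcsin (\<beta> / t)"
      by (intro arcsin_minus) linarith+
    ultimately show ?thesis
      by simp
  qed
  have eq: "\<bar>\<Sum>k\<in>I. a k * Z k \<omega>\<bar> * \<bar>\<Sum>k\<in>I. b k * Z k \<omega>\<bar> =
      (s * t) * (\<bar>Y i \<omega>\<bar> * \<bar>\<beta> / t * Y i \<omega> + \<gamma> / t * Y j \<omega>\<bar>)" for \<omega>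
  proof -
    have "\<beta> * Y i \<omega> + \<gamma> * Y j \<omega> = t * (\<beta> / t * Y i \<omega> + \<gamma> / t * Y j \<omega>)"
      using pos by (simp add: distrib_left)
    then show ?thesis
      unfolding a b s using pos by (simp add: abs_mult)
  qed
  have nn: "(\<integral>\<^sup>+\<omega>. ennreal (\<bar>Y i \<omega>\<bar> * \<bar>\<beta> / t * Y i \<omega> + \<gamma> / t * Y j \<omega>\<bar>) \<partial>P) =
      ennreal (2 / pi * (sqrt (1 - r\<^sup>2) + r * arcsin r))"
  proof -
    have "(\<integral>\<^sup>+\<omega>. ennreal (\<bar>Y i \<omega>\<bar> * \<bar>\<beta> / t * Y i \<omega> + \<gamma> / t * Y j \<omega>\<bar>) \<partial>P) =
        (\<integral>\<^sup>+x. \<integral>\<^sup>+y. ennreal (\<bar>x\<bar> * \<bar>\<beta> / t * x + \<gamma> / t * y\<bar>) \<partial>gauss \<partial>gauss)"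
      by (rule gauss_family_pair[OF Y ij]) simp
    also have "\<dots> = ennreal (2 / pi * (\<bar>\<gamma> / t\<bar> + \<beta> / t * arcsin (\<beta> / t)))"
      by (rule nn_integral_gauss_abs_product[OF \<gamma> unit])
    finally show ?thesis
      unfolding sq odd .
  qed
  have "0 \<le> r * arcsin r"
    using r arcsin_le_arcsin[of r 0] arcsin_le_arcsin[of 0 r]
    by (cases "r \<ge> 0") (auto simp: zero_le_mult_iff)
  then have nonneg: "0 \<le> 2 / pi * (sqrt (1 - r\<^sup>2) + r * arcsin r)"
    using \<open>r\<^sup>2 < 1\<close> by (intro mult_nonneg_nonneg[of "2 / pi"] add_nonneg_nonneg) auto
  have "has_bochner_integral P (\<lambda>\<omega>. \<bar>Y i \<omega>\<bar> * \<bar>\<beta> / t * Y i \<omega> + \<gamma> / t * Y j \<omega>\<bar>) (2 / pi * (sqrt (1 - r\<^sup>2) + r * arcsin r))"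
    by (rule has_bochner_integral_nn_integral[OF _ _ nonneg nn]) auto
  then have "has_bochner_integral P (\<lambda>\<omega>. \<bar>\<Sum>k\<in>I. a k * Z k \<omega>\<bar> * \<bar>\<Sum>k\<in>I. b k * Z k \<omega>\<bar>)
      ((s * t) * (2 / pi * (sqrt (1 - r\<^sup>2) + r * arcsin r)))"
    unfolding eq by (rule has_bochner_integral_mult_right)
  then show "integrable P (\<lambda>\<omega>. \<bar>\<Sum>k\<in>I. a k * Z k \<omega>\<bar> * \<bar>\<Sum>k\<in>I. b k * Z k \<omega>\<bar>)"
    "(\<integral>\<omega>. \<bar>\<Sum>k\<in>I. a k * Z k \<omega>\<bar> * \<bar>\<Sum>k\<in>I. b k * Z k \<omega>\<bar> \<partial>P) =
      2 / pi * (s * t) * (sqrt (1 - r\<^sup>2) + r * arcsin r)"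
    by (auto simp: has_bochner_integral_iff mult_ac)
qed

section \<open>The non-linearity as a function of independent blocks\<close>

text \<open>The digits of \<open>k\<close> select an arbitrary subset. Since the \<open>D m\<close> sum to
  0, the selector 0/1 may be replaced by plus or minus one half, which gives the upper bound; it
  is attained by selecting the positive \<open>D m\<close>.\<close>

lemma max_abs_digit_sum:
  fixes D :: "nat \<Rightarrow> real"
  assumes zero: "(\<Sum>m=1..N. D m) = 0"
  shows "Max ((\<lambda>k. \<bar>\<Sum>m=1..N. bin_digit k m * D m\<bar>) ` {0..num_sources N}) = (\<Sum>m=1..N. \<bar>D m\<bar>) / 2"
proof (rule Max_eqI)
  fix y assume "y \<in> (\<lambda>k. \<bar>\<Sum>m=1..N. bin_digit k m * D m\<bar>) ` {0..num_sources N}"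
  then obtain k where y: "y = \<bar>\<Sum>m=1..N. bin_digit k m * D m\<bar>"
    by auto
  have "(\<Sum>m=1..N. bin_digit k m * D m) = (\<Sum>m=1..N. bin_digit k m * D m) - (\<Sum>m=1..N. D m) / 2"
    using zero by simp
  also have "\<dots> = (\<Sum>m=1..N. (bin_digit k m - 1 / 2) * D m)"
    by (simp add: sum_divide_distrib sum_subtractf[symmetric] left_diff_distrib)
  finally have "y = \<bar>\<Sum>m=1..N. (bin_digit k m - 1 / 2) * D m\<bar>"
    using y by simp
  also have "\<dots> \<le> (\<Sum>m=1..N. \<bar>(bin_digit k m - 1 / 2) * D m\<bar>)"
    by (rule sum_abs)
  also have "\<dots> = (\<Sum>m=1..N. \<bar>D m\<bar> / 2)"
    by (intro sum.cong) (auto simp: bin_digit_def abs_mult)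
  finally show "y \<le> (\<Sum>m=1..N. \<bar>D m\<bar>) / 2"
    by (simp add: sum_divide_distrib)
next
  \<comment> \<open>The code whose digits are the signs of the \<open>D m\<close>.\<close>
  define bs where "bs = map (\<lambda>i. D (Suc i) > 0) [0..<N]"
  define k :: nat where "k = horner_sum of_bool 2 bs"
  have "k < 2 ^ N"
  proof -
    have "(horner_sum of_bool 2 bs :: nat) < 2 ^ length bs" for bs
      by (induction bs) (auto simp: of_bool_def)
    from this[of bs] show ?thesis
      by (simp add: k_def bs_def)
  qed
  then have k: "k \<in> {0..num_sources N}"
    by simp
  have digit: "bin_digit k m = of_bool (D m > 0)" if "m \<in> {1..N}" for m
    using that by (auto simp: bin_digit_def k_def bit_horner_sum_bit_iff bs_def)
  have "(\<Sum>m=1..N. bin_digit k m * D m) = (\<Sum>m=1..N. (\<bar>D m\<bar> + D m) / 2)"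
    by (intro sum.cong) (auto simp: digit)
  also have "\<dots> = (\<Sum>m=1..N. \<bar>D m\<bar>) / 2"
    using zero by (simp add: sum_divide_distrib[symmetric] sum.distrib)
  finally have "\<bar>\<Sum>m=1..N. bin_digit k m * D m\<bar> = (\<Sum>m=1..N. \<bar>D m\<bar>) / 2"
  proof -
    assume *: "(\<Sum>m=1..N. bin_digit k m * D m) = (\<Sum>m=1..N. \<bar>D m\<bar>) / 2"
    have "0 \<le> (\<Sum>m=1..N. \<bar>D m\<bar>)"
      by (rule sum_nonneg) simp
    with * show ?thesis
      by linarith
  qed
  then show "(\<Sum>m=1..N. \<bar>D m\<bar>) / 2 \<in> (\<lambda>k. \<bar>\<Sum>m=1..N. bin_digit k m * D m\<bar>) ` {0..num_sources N}"
    using k by (intro image_eqI[of _ _ k]) auto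
qed simp

definition block_sum :: "(nat \<Rightarrow> 'a \<Rightarrow> real) \<Rightarrow> nat \<Rightarrow> 'a \<Rightarrow> real" where
  "block_sum Iu m \<omega> = (\<Sum>j=2^(m-1)..2^m-1. Iu j \<omega>)"

lemma sum_block_sum: "(\<Sum>m=1..N. block_sum Iu m \<omega>) = (\<Sum>j=1..num_sources N. Iu j \<omega>)"
proof (induction N)
  case (Suc N)
  \<comment> \<open>The last block is exactly the set of sources added when passing from \<open>N\<close> to
    \<open>Suc N\<close>.\<close>
  have "{1..num_sources (Suc N)} = {1..num_sources N} \<union> {2 ^ N..2 ^ Suc N - 1}"
  proof -
    have "Suc 0 \<le> x" if "2 ^ N \<le> x" for x :: nat
      using order_trans[OF _ that, of "Suc 0"] by simp
    then show ?thesis by auto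
  qed
  moreover have "{1..num_sources N} \<inter> {2 ^ N..2 ^ Suc N - 1} = {}"
    by (auto simp: Suc_le_eq not_le less_diff_conv)
  ultimately have "(\<Sum>j=1..num_sources (Suc N). Iu j \<omega>) =
      (\<Sum>j=1..num_sources N. Iu j \<omega>) + (\<Sum>j=2 ^ N..2 ^ Suc N - 1. Iu j \<omega>)"
    by (simp only: sum.union_disjoint finite_atLeastAtMost)
  then show ?case
    using Suc by (simp add: block_sum_def)
qed simp

lemma sum_two_powers: "(\<Sum>m=1..N. 2 ^ (m - 1)) = (2 ^ N - 1 :: real)"
  by (induction N) auto

lemma real_num_sources: "real (num_sources N) = 2 ^ N - 1"
  by (simp add: of_nat_diff)

text \<open>On the event where \<open>I_lsb\<close> vanishes both sides are 0, by the conventions for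
  division by zero and for the sign of zero.\<close>

lemma normalized_INL_max_block_sum:
  assumes "N \<ge> 1" and "\<sigma> > 0"
  shows "normalized_INL_max \<sigma> Iu N \<omega> = sgn (I_lsb Iu N \<omega>) *
    (\<Sum>m=1..N. \<bar>block_sum Iu m \<omega> - 2 ^ (m - 1) * I_lsb Iu N \<omega>\<bar>) / (2 * \<sigma> * sqrt (2 ^ N - 1))"
proof -
  define a where "a = I_lsb Iu N \<omega>"
  define D where "D m = block_sum Iu m \<omega> - 2 ^ (m - 1) * a" for m
  have n: "(2::real) ^ N - 1 > 0"
    using assms by (simp add: one_less_power)
  have "(\<Sum>m=1..N. D m) = (\<Sum>j=1..num_sources N. Iu j \<omega>) - (2 ^ N - 1) * a"
    by (simp add: D_def sum_subtractf sum_block_sum sum_distrib_right[symmetric] sum_two_powers del: One_nat_def)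
  also have "\<dots> = 0"
    using n unfolding a_def I_lsb_def real_num_sources by simp
  finally have zero: "(\<Sum>m=1..N. D m) = 0" .
  have diff: "I_out Iu N k \<omega> - real k * a = (\<Sum>m=1..N. bin_digit k m * D m)" if "k \<in> {0..num_sources N}" for k
  proof -
    have "k \<le> num_sources N"
      using that by simp
    from bin_digit_expansion[OF this] show ?thesis
      by (simp add: I_out_def D_def block_sum_def right_diff_distrib sum_subtractf sum_distrib_left sum_distrib_right mult_ac
          del: One_nat_def)
  qed
  have "INL_max Iu N \<omega> = Max ((\<lambda>x. x / \<bar>a\<bar>) ` ((\<lambda>k. \<bar>\<Sum>m=1..N. bin_digit k m * D m\<bar>) ` {0..num_sources N}))"
    unfolding INL_max_def INL_def a_def[symmetric] image_image
    by (intro arg_cong[of _ _ Max] image_cong refl) (simp only: diff abs_divide)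
  also have "\<dots> = (\<Sum>m=1..N. \<bar>D m\<bar>) / 2 / \<bar>a\<bar>"
    unfolding max_abs_digit_sum[OF zero, symmetric]
    by (rule mono_Max_commute[symmetric]) (auto simp: mono_def divide_right_mono)
  finally have "normalized_INL_max \<sigma> Iu N \<omega> = a / \<bar>a\<bar> * (\<Sum>m=1..N. \<bar>D m\<bar>) / (2 * \<sigma> * sqrt (2 ^ N - 1))"
    unfolding normalized_INL_max_def real_num_sources a_def[symmetric] by simp
  also have "a / \<bar>a\<bar> = sgn a"
    by (simp add: sgn_if abs_if)
  finally show ?thesis
    by (simp add: a_def D_def)
qed

text \<open>The normalised non-linearity as a function of the rescaled block fluctuations \<open>s
  l\<close>, where \<open>l = 1\<close> is the largest block. Numbering the blocks from the top
  makes the scale of the \<open>l\<close>-th fluctuation \<open>2 powr (- l / 2)\<close>,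
  independently of \<open>N\<close>.\<close>

definition INL_stat :: "real \<Rightarrow> real \<Rightarrow> nat \<Rightarrow> (nat \<Rightarrow> real) \<Rightarrow> real" where
  "INL_stat Ibar \<sigma> N s =
     sgn (Ibar + \<sigma> * sqrt (2 ^ N) / (2 ^ N - 1) * (\<Sum>k=1..N. s k)) *
     (sqrt (2 ^ N / (2 ^ N - 1)) / 2) *
     (\<Sum>l=1..N. \<bar>s l - 2 ^ N / (2 ^ N - 1) * (\<Sum>k=1..N. s k) / 2 ^ l\<bar>)"

lemma normalized_INL_max_eq_INL_stat:
  fixes Iu :: "nat \<Rightarrow> 'a \<Rightarrow> real" and Ibar \<sigma> :: real
  assumes N: "N \<ge> 1" and \<sigma>: "\<sigma> > 0"
    and s_def: "s = (\<lambda>l. (block_sum Iu (N + 1 - l) \<omega> - 2 ^ (N - l) * Ibar) / (\<sigma> * sqrt (2 ^ N)))"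
  shows "normalized_INL_max \<sigma> Iu N \<omega> = INL_stat Ibar \<sigma> N s"
proof -
  define V where "V = (\<Sum>k=1..N. s k)"
  have n: "(2::real) ^ N - 1 > 0"
    using N by (simp add: one_less_power)
  have rev: "(\<Sum>m=1..N. f m) = (\<Sum>l=1..N. f (N + 1 - l))" for f :: "nat \<Rightarrow> real"
    by (rule sum.reindex_bij_witness[of _ "\<lambda>m. N + 1 - m" "\<lambda>m. N + 1 - m"]) auto
  have S: "block_sum Iu (N + 1 - l) \<omega> = 2 ^ (N - l) * Ibar + \<sigma> * sqrt (2 ^ N) * s l" for l
    using \<sigma> by (simp add: s_def)
  have "(\<Sum>j=1..num_sources N. Iu j \<omega>) = (\<Sum>l=1..N. block_sum Iu (N + 1 - l) \<omega>)"
    by (subst sum_block_sum[symmetric], rule rev)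
  also have "\<dots> = (\<Sum>l=1..N. 2 ^ (N - l)) * Ibar + \<sigma> * sqrt (2 ^ N) * V"
    by (simp add: S sum.distrib V_def sum_distrib_left sum_distrib_right del: One_nat_def)
  also have "(\<Sum>l=1..N. 2 ^ (N - l)) = (2 ^ N - 1 :: real)"
    using rev[of "\<lambda>m. 2 ^ (m - 1)"] sum_two_powers[of N] by simp
  finally have lsb: "I_lsb Iu N \<omega> = Ibar + \<sigma> * sqrt (2 ^ N) / (2 ^ N - 1) * V"
    using n unfolding I_lsb_def real_num_sources by (simp add: field_simps)
  have D: "\<bar>block_sum Iu (N + 1 - l) \<omega> - 2 ^ (N + 1 - l - 1) * I_lsb Iu N \<omega>\<bar> =
      (\<sigma> * sqrt (2 ^ N)) * \<bar>s l - 2 ^ N / (2 ^ N - 1) * V / 2 ^ l\<bar>" if l: "l \<in> {1..N}" for l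
  proof -
    have p: "(2::real) ^ (N - l) = 2 ^ N / 2 ^ l"
      using l by (simp add: power_diff)
    have "block_sum Iu (N + 1 - l) \<omega> - 2 ^ (N + 1 - l - 1) * I_lsb Iu N \<omega> =
        (\<sigma> * sqrt (2 ^ N)) * (s l - 2 ^ N / (2 ^ N - 1) * V / 2 ^ l)"
      unfolding S lsb by (simp add: p algebra_simps)
    then show ?thesis
      using \<sigma> by (simp add: abs_mult)
  qed
  have "(\<Sum>m=1..N. \<bar>block_sum Iu m \<omega> - 2 ^ (m - 1) * I_lsb Iu N \<omega>\<bar>) =
      (\<sigma> * sqrt (2 ^ N)) * (\<Sum>l=1..N. \<bar>s l - 2 ^ N / (2 ^ N - 1) * V / 2 ^ l\<bar>)"
    unfolding sum_distrib_left by (subst rev, intro sum.cong refl D)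
  then show ?thesis
    unfolding normalized_INL_max_block_sum[OF N \<sigma>] INL_stat_def V_def[symmetric] lsb
    using \<sigma> by (simp add: real_sqrt_divide)
qed

text \<open>The blocks are disjoint, so their sums are independent, and block \<open>m\<close> is a sum of
  \<open>2 ^ (m - 1)\<close> independent normal variables.\<close>

lemma block_sums_std_gauss:
  assumes P: "prob_space P" and iid: "iid_normal P Iu Ibar \<sigma>" and \<sigma>: "\<sigma> > 0"
  shows "gauss_family P (\<lambda>m \<omega>. (block_sum Iu m \<omega> - 2 ^ (m - 1) * Ibar) / (\<sigma> * sqrt (2 ^ (m - 1)))) {1..}"
proof -
  interpret prob_space P by fact
  let ?K = "\<lambda>m::nat. {2 ^ (m - 1)..2 ^ m - 1 :: nat}"
  let ?X = "\<lambda>m \<omega>. (block_sum Iu m \<omega> - 2 ^ (m - 1) * Ibar) / (\<sigma> * sqrt (2 ^ (m - 1)))"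
  have ind: "indep_vars (\<lambda>_. borel) Iu {1..}" and normal: "\<And>j. j \<ge> 1 \<Longrightarrow> distributed P lborel (Iu j) (normal_density Ibar \<sigma>)"
    using iid by (auto simp: iid_normal_def)
  have K: "?K m \<subseteq> {1..}" for m
  proof -
    have "(1::nat) \<le> 2 ^ (m - 1)" by simp
    then show ?thesis by auto
  qed
  have disj: "disjoint_family_on ?K {1..}"
    unfolding disjoint_family_on_def
  proof (intro ballI impI)
    have *: "?K m \<inter> ?K m' = {}" if "m < m'" for m m'
    proof -
      have "(2::nat) ^ m \<le> 2 ^ (m' - 1)"
        using that by (intro power_increasing) auto
      moreover have "(0::nat) < 2 ^ m"
        by simp
      ultimately have *: "(2::nat) ^ m - 1 < 2 ^ (m' - 1)"
        by linarith
      show ?thesis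
      proof (rule equals0I)
        fix x assume "x \<in> ?K m \<inter> ?K m'"
        then have "x \<le> 2 ^ m - 1" "2 ^ (m' - 1) \<le> x"
          by (simp_all del: One_nat_def)
        then show False
          using * by linarith
      qed
    qed
    show "?K m \<inter> ?K m' = {}" if "m \<noteq> m'" for m m'
      using *[of m m'] *[of m' m] that by (cases m m' rule: linorder_cases) auto
  qed
  have "indep_vars (\<lambda>m. PiM (?K m) (\<lambda>_. borel)) (\<lambda>m \<omega>. \<lambda>i\<in>?K m. Iu i \<omega>) {1..}"
    by (rule indep_vars_restrict[OF ind K disj])
  then have "indep_vars (\<lambda>_. borel) (\<lambda>m \<omega>. ((\<Sum>j\<in>?K m. (\<lambda>i\<in>?K m. Iu i \<omega>) j) - 2 ^ (m - 1) * Ibar) / (\<sigma> * sqrt (2 ^ (m - 1)))) {1..}"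
    by (rule indep_vars_compose2[where Y = "\<lambda>m x. ((\<Sum>j\<in>?K m. x j) - 2 ^ (m - 1) * Ibar) / (\<sigma> * sqrt (2 ^ (m - 1)))"]) measurable
  then have ind': "indep_vars (\<lambda>_. borel) ?X {1..}"
    by (simp add: block_sum_def)
  have "distributed P lborel (?X m) std_normal_density" if m: "m \<ge> 1" for m
  proof -
    have ne: "?K m \<noteq> {}"
      using m by (cases m) auto
    have card: "card (?K m) = 2 ^ (m - 1)"
      using m by (cases m) auto
    have D: "distributed P lborel (\<lambda>\<omega>. \<Sum>j\<in>?K m. Iu j \<omega>)
        (normal_density (\<Sum>j\<in>?K m. Ibar) (sqrt (\<Sum>j\<in>?K m. \<sigma>\<^sup>2)))"
    proof (rule sum_indep_normal)
      show "indep_vars (\<lambda>_. borel) Iu (?K m)"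
        by (rule indep_vars_subset[OF ind K])
      show "distributed P lborel (Iu j) (normal_density Ibar \<sigma>)" if "j \<in> ?K m" for j
        using subsetD[OF K that] by (intro normal) simp
    qed (use ne \<sigma> in auto)
    have mean: "(\<Sum>j\<in>?K m. Ibar) = 2 ^ (m - 1) * Ibar"
      unfolding sum_constant card by simp
    have sd: "sqrt (\<Sum>j\<in>?K m. \<sigma>\<^sup>2) = \<sigma> * sqrt (2 ^ (m - 1))"
      unfolding sum_constant card using \<sigma> by (simp add: real_sqrt_mult)
    have "distributed P lborel (block_sum Iu m) (normal_density (2 ^ (m - 1) * Ibar) (\<sigma> * sqrt (2 ^ (m - 1))))"
      using D unfolding mean sd block_sum_def[abs_def] .
    then show ?thesis
      using \<sigma> by (subst (asm) normal_standard_normal_convert) auto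
  qed
  then show ?thesis
    using ind' by (subst gauss_family_iff_indep[OF P]) auto
qed

lemma INL_stat_measurable:
  assumes "{1..N} \<subseteq> I"
  shows "INL_stat Ibar \<sigma> N \<circ> (\<lambda>x l. x l / sqrt (2 ^ l)) \<in> borel_measurable (gauss_power I)"
proof -
  have [measurable]: "(\<lambda>x. x l) \<in> borel_measurable (gauss_power I)" if "l \<in> {1..N}" for l
    using measurable_component_singleton[of l I "\<lambda>_. gauss"] that assms
    by (auto simp: measurable_cong_sets[OF refl sets_gauss])
  show ?thesis
    unfolding INL_stat_def comp_def by measurable
qed

lemma normalized_INL_max_law:
  assumes P: "prob_space P" and iid: "iid_normal P Iu Ibar \<sigma>" and \<sigma>: "\<sigma> > 0" and N: "N \<ge> 1"
    and fam: "gauss_family R x {1..N}"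
  shows "distr R borel (\<lambda>\<omega>. INL_stat Ibar \<sigma> N (\<lambda>l. x l \<omega> / sqrt (2 ^ l))) = distr P borel (normalized_INL_max \<sigma> Iu N)"
proof -
  let ?X = "\<lambda>m \<omega>. (block_sum Iu m \<omega> - 2 ^ (m - 1) * Ibar) / (\<sigma> * sqrt (2 ^ (m - 1)))"
  have famP: "gauss_family P (\<lambda>l. ?X (N + 1 - l)) {1..N}"
    by (rule gauss_family_reindex[OF block_sums_std_gauss[OF P iid \<sigma>], where f = "\<lambda>l. N + 1 - l"])
      (auto simp: inj_on_def)
  have cong: "INL_stat Ibar \<sigma> N s = INL_stat Ibar \<sigma> N s'" if "\<And>l. l \<in> {1..N} \<Longrightarrow> s l = s' l" for s s'
  proof -
    have V: "(\<Sum>k=1..N. s k) = (\<Sum>k=1..N. s' k)"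
      using that by (intro sum.cong) auto
    show ?thesis
      unfolding INL_stat_def V using that by (intro arg_cong2[of _ _ _ _ "(*)"] sum.cong refl) simp
  qed
  have "distr R borel (\<lambda>\<omega>. (INL_stat Ibar \<sigma> N \<circ> (\<lambda>x l. x l / sqrt (2 ^ l))) (\<lambda>l\<in>{1..N}. x l \<omega>)) =
      distr P borel (\<lambda>\<omega>. (INL_stat Ibar \<sigma> N \<circ> (\<lambda>x l. x l / sqrt (2 ^ l))) (\<lambda>l\<in>{1..N}. ?X (N + 1 - l) \<omega>))"
    by (rule gauss_family_same_law[OF fam famP INL_stat_measurable]) simp
  moreover have "(INL_stat Ibar \<sigma> N \<circ> (\<lambda>x l. x l / sqrt (2 ^ l))) (\<lambda>l\<in>{1..N}. x l \<omega>) =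
      INL_stat Ibar \<sigma> N (\<lambda>l. x l \<omega> / sqrt (2 ^ l))" for \<omega>
    by (auto intro!: cong)
  moreover have "(INL_stat Ibar \<sigma> N \<circ> (\<lambda>x l. x l / sqrt (2 ^ l))) (\<lambda>l\<in>{1..N}. ?X (N + 1 - l) \<omega>) =
      normalized_INL_max \<sigma> Iu N \<omega>" for \<omega>
  proof -
    have "?X (N + 1 - l) \<omega> / sqrt (2 ^ l) = (block_sum Iu (N + 1 - l) \<omega> - 2 ^ (N - l) * Ibar) / (\<sigma> * sqrt (2 ^ N))"
      if "l \<in> {1..N}" for l
    proof -
      have "sqrt (2 ^ (N + 1 - l - 1)) * sqrt (2 ^ l) = sqrt (2 ^ N)"
        using that by (simp flip: real_sqrt_mult power_add)
      then show ?thesis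
        by (simp add: mult.assoc)
    qed
    then show ?thesis
      unfolding normalized_INL_max_eq_INL_stat[OF N \<sigma> refl, of Iu \<omega> Ibar] comp_def by (intro cong) auto
  qed
  ultimately show ?thesis
    by simp
qed

section \<open>Bisection of a normal variable\<close>

text \<open>The block structure is rebuilt from the top: \<open>z 0\<close> is the total fluctuation, and in
  each step the remaining fluctuation splits into two halves of equal variance, the largest
  remaining block \<open>bisect_piece\<close> and everything below it, which differ by an
  independent fluctuation proportional to \<open>z (Suc l)\<close>. The same sequence
  \<open>z\<close> serves all \<open>N\<close> simultaneously.\<close>

primrec bisect_rest :: "(nat \<Rightarrow> real) \<Rightarrow> nat \<Rightarrow> real" where
  "bisect_rest z 0 = z 0"
| "bisect_rest z (Suc l) = bisect_rest z l / 2 - z (Suc l) / sqrt 2 ^ (l + 2)"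

definition bisect_piece :: "(nat \<Rightarrow> real) \<Rightarrow> nat \<Rightarrow> real" where
  "bisect_piece z l = bisect_rest z (l - 1) / 2 + z l / sqrt 2 ^ (l + 1)"

text \<open>After rescaling, one bisection step is the rotation by 45 degrees of the remaining fluctuation
  and a fresh normal variable. Coordinate 0 always carries the rescaled remainder.\<close>

lemma gauss_family_bisect_step:
  fixes Y :: "nat \<Rightarrow> 'a \<Rightarrow> real"
  assumes fam: "gauss_family P Y {0..N}" and "L \<le> N"
  shows "gauss_family P (\<lambda>i \<omega>. if i = 0 then sqrt 2 ^ L * bisect_rest (\<lambda>j. Y j \<omega>) L
    else if i \<le> L then sqrt 2 ^ i * bisect_piece (\<lambda>j. Y j \<omega>) i else Y i \<omega>) {0..N}"
    (is "gauss_family P (?F L) _")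
  using assms(2)
proof (induction L)
  case 0
  have "?F 0 = Y"
    by (auto simp: fun_eq_iff)
  then show ?case
    using fam by simp
next
  case (Suc L)
  let ?c = "1 / sqrt 2 :: real"
  let ?F' = "(?F L)(Suc L := \<lambda>\<omega>. ?c * ?F L (Suc L) \<omega> + ?c * ?F L 0 \<omega>, 0 := \<lambda>\<omega>. - ?c * ?F L (Suc L) \<omega> + ?c * ?F L 0 \<omega>)"
  have "gauss_family P ?F' {0..N}"
    by (rule gauss_family_rotate) (use Suc in \<open>auto simp: power_divide\<close>)
  moreover have "?F' = ?F (Suc L)"
  proof (intro ext)
    fix i \<omega>
    have half: "1 / sqrt 2 = sqrt 2 / (2 :: real)" and next_pow: "sqrt 2 ^ (L + 2) = 2 * (sqrt 2 ^ L :: real)"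
      by (simp_all add: real_div_sqrt power_add)
    have scale: "sqrt 2 ^ Suc L * (x / 2 + y / sqrt 2 ^ (L + 2)) = ?c * y + ?c * (sqrt 2 ^ L * x)" for x y :: real
      unfolding half next_pow by (simp add: field_simps)
    show "?F' i \<omega> = ?F (Suc L) i \<omega>"
    proof -
      consider "i = 0" | "i = Suc L" | "i \<noteq> 0" "i \<noteq> Suc L"
        by blast
      then show ?thesis
      proof cases
        case 1
        then show ?thesis
          using scale[of "bisect_rest (\<lambda>j. Y j \<omega>) L" "- Y (Suc L) \<omega>"] by simp
      next
        case 2
        then show ?thesis
          using scale[of "bisect_rest (\<lambda>j. Y j \<omega>) L" "Y (Suc L) \<omega>"] by (simp add: bisect_piece_def)
      qed auto
    qed
  qed
  ultimately show ?case
    by simp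
qed

lemma gauss_family_bisect_piece:
  assumes "gauss_family P Y {0..N}"
  shows "gauss_family P (\<lambda>l \<omega>. sqrt 2 ^ l * bisect_piece (\<lambda>j. Y j \<omega>) l) {1..N}"
proof -
  have "gauss_family P (\<lambda>i \<omega>. if i = 0 then sqrt 2 ^ N * bisect_rest (\<lambda>j. Y j \<omega>) N
    else if i \<le> N then sqrt 2 ^ i * bisect_piece (\<lambda>j. Y j \<omega>) i else Y i \<omega>) {1..N}"
    by (rule gauss_family_subset[OF gauss_family_bisect_step[OF assms order_refl]]) auto
  then show ?thesis
    by (rule gauss_family_cong[THEN iffD1, rotated]) (auto simp: fun_eq_iff)
qed

lemma two_powr_neg_half: "2 powr (- real k / 2) = 1 / sqrt 2 ^ k"
proof -
  have "2 powr (- real k / 2) = (2 powr (1 / 2)) powr (- real k)"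
    by (simp add: powr_powr)
  also have "\<dots> = 1 / sqrt 2 ^ k"
    by (simp add: powr_half_sqrt powr_minus powr_realpow inverse_eq_divide)
  finally show ?thesis .
qed

lemma bisect_rest_eq:
  "bisect_rest z l = z 0 / 2 ^ l - (\<Sum>j=1..l. z j / (2 ^ (l - j) * sqrt 2 ^ (j + 1)))"
proof (induction l)
  case (Suc l)
  have "(\<Sum>j=1..l. z j / (2 ^ (Suc l - j) * sqrt 2 ^ (j + 1))) = (\<Sum>j=1..l. z j / (2 ^ (l - j) * sqrt 2 ^ (j + 1))) / 2"
    unfolding sum_divide_distrib by (intro sum.cong) (auto simp: Suc_diff_le)
  then show ?case
    by (simp add: Suc diff_divide_distrib)
qed simp

text \<open>Centring a piece by its share \<open>z 0 / 2 ^ l\<close> of the total removes \<open>z 0\<close>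
  and leaves, up to sign, exactly the combination of \<open>z 1, z 2, \<dots>\<close> in the
  series for \<open>M\<close>. So the limit of the coupled statistics is this series evaluated at
  the same sequence.\<close>

lemma M_term_bisect:
  "M_term (\<lambda>j \<omega>. \<omega> j) (Suc l) z = \<bar>bisect_piece z (Suc l) - z 0 / 2 ^ Suc l\<bar>"
proof -
  have t: "(\<Sum>j=1..l. z j / (2 ^ (l - j) * sqrt 2 ^ (j + 1))) / 2 =
      (\<Sum>j=1..<Suc l. 2 powr (- (real (Suc l) - real j) / 2) * z j) / sqrt 2 ^ (l + 2)"
    unfolding sum_divide_distrib atLeastLessThanSuc_atLeastAtMost
  proof (rule sum.cong)
    fix j assume j: "j \<in> {1..l}"
    then have "real (Suc l) - real j = real (Suc l - j)"
      by (simp add: of_nat_diff)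
    then have p: "2 powr (- (real (Suc l) - real j) / 2) = 1 / sqrt 2 ^ (Suc l - j)"
      by (simp only: two_powr_neg_half)
    have "(2::real) * 2 ^ (l - j) = sqrt 2 ^ (2 * (Suc l - j))"
      using j by (simp add: power_mult Suc_diff_le)
    then have "2 * (2 ^ (l - j) * sqrt 2 ^ (j + 1)) = sqrt 2 ^ (2 * (Suc l - j)) * sqrt 2 ^ (j + 1)"
      by simp
    also have "\<dots> = sqrt 2 ^ (Suc l - j) * sqrt 2 ^ (l + 2)"
      unfolding power_add[symmetric] using j by (intro arg_cong2[of _ _ _ _ power]) auto
    finally have "2 * (2 ^ (l - j) * sqrt 2 ^ (j + 1)) = sqrt 2 ^ (Suc l - j) * sqrt 2 ^ (l + 2)" .
    then show "z j / (2 ^ (l - j) * sqrt 2 ^ (j + 1)) / 2 = 2 powr (- (real (Suc l) - real j) / 2) * z j / sqrt 2 ^ (l + 2)"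
      unfolding p by (simp only: divide_divide_eq_left mult.commute[of _ 2] times_divide_eq_left mult_1_left)
  qed simp
  have front: "2 powr (- (real (Suc l) + 1) / 2) = 1 / sqrt 2 ^ (l + 2)"
    using two_powr_neg_half[of "l + 2"] by (simp add: add.commute)
  have "bisect_piece z (Suc l) - z 0 / 2 ^ Suc l =
      z (Suc l) / sqrt 2 ^ (l + 2) - (\<Sum>j=1..l. z j / (2 ^ (l - j) * sqrt 2 ^ (j + 1))) / 2"
    by (simp add: bisect_piece_def bisect_rest_eq diff_divide_distrib)
  also have "\<dots> = - (2 powr (- (real (Suc l) + 1) / 2) *
      ((\<Sum>j=1..<Suc l. 2 powr (- (real (Suc l) - real j) / 2) * z j) - z (Suc l)))"
    unfolding t front by (simp add: diff_divide_distrib)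
  finally show ?thesis
    unfolding M_term_def by (simp add: abs_mult)
qed

text \<open>Six times this square integrable random variable dominates all coupled statistics.\<close>

definition envelope :: "(nat \<Rightarrow> real) \<Rightarrow> real" where
  "envelope z = (\<Sum>l. \<bar>z l\<bar> / sqrt 2 ^ l)"

context
  fixes z :: "nat \<Rightarrow> real"
  assumes env: "summable (\<lambda>l. \<bar>z l\<bar> / sqrt 2 ^ l)"
begin

lemma envelope_nonneg: "0 \<le> envelope z"
  unfolding envelope_def by (rule suminf_nonneg[OF env]) simp

lemma sum_le_envelope: "(\<Sum>l\<le>n. \<bar>z l\<bar> / sqrt 2 ^ l) \<le> envelope z"
  unfolding envelope_def by (rule sum_le_suminf[OF env]) auto

lemma sum_increment_le:
  "\<bar>z 0\<bar> + (\<Sum>l<n. \<bar>z (Suc l)\<bar> / sqrt 2 ^ (l + 2)) \<le> envelope z"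
proof -
  have "(\<Sum>l<n. \<bar>z (Suc l)\<bar> / sqrt 2 ^ (l + 2)) \<le> (\<Sum>l<n. \<bar>z (Suc l)\<bar> / sqrt 2 ^ Suc l)"
    by (intro sum_mono divide_left_mono power_increasing mult_pos_pos zero_less_power) auto
  moreover have "(\<Sum>l\<le>n. \<bar>z l\<bar> / sqrt 2 ^ l) = \<bar>z 0\<bar> + (\<Sum>l<n. \<bar>z (Suc l)\<bar> / sqrt 2 ^ Suc l)"
    by (subst sum.atMost_shift) simp
  ultimately show ?thesis
    using sum_le_envelope[of n] by linarith
qed

text \<open>Each remainder is at most half the previous one plus an increment, so summing the recursion
  bounds the sum by half of itself plus the envelope.\<close>

lemma sum_abs_bisect_rest_le: "(\<Sum>l\<le>n. \<bar>bisect_rest z l\<bar>) \<le> 2 * envelope z"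
proof -
  have 1: "(\<Sum>l\<le>n. \<bar>bisect_rest z l\<bar>) = \<bar>z 0\<bar> + (\<Sum>l<n. \<bar>bisect_rest z (Suc l)\<bar>)"
    by (simp add: sum.atMost_shift del: bisect_rest.simps(2))
  have "(\<Sum>l<n. \<bar>bisect_rest z (Suc l)\<bar>) \<le> (\<Sum>l<n. \<bar>bisect_rest z l\<bar> / 2 + \<bar>z (Suc l)\<bar> / sqrt 2 ^ (l + 2))"
  proof (rule sum_mono)
    fix l
    have "\<bar>bisect_rest z l / 2 - z (Suc l) / sqrt 2 ^ (l + 2)\<bar> \<le> \<bar>bisect_rest z l / 2\<bar> + \<bar>z (Suc l) / sqrt 2 ^ (l + 2)\<bar>"
      by (rule abs_triangle_ineq4)
    then show "\<bar>bisect_rest z (Suc l)\<bar> \<le> \<bar>bisect_rest z l\<bar> / 2 + \<bar>z (Suc l)\<bar> / sqrt 2 ^ (l + 2)"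
      by (simp add: abs_divide)
  qed
  also have "\<dots> = (\<Sum>l<n. \<bar>bisect_rest z l\<bar>) / 2 + (\<Sum>l<n. \<bar>z (Suc l)\<bar> / sqrt 2 ^ (l + 2))"
    by (simp add: sum.distrib sum_divide_distrib)
  finally have 2: "(\<Sum>l<n. \<bar>bisect_rest z (Suc l)\<bar>) \<le> (\<Sum>l<n. \<bar>bisect_rest z l\<bar>) / 2 + (\<Sum>l<n. \<bar>z (Suc l)\<bar> / sqrt 2 ^ (l + 2))" .
  have "(\<Sum>l<n. \<bar>bisect_rest z l\<bar>) \<le> (\<Sum>l\<le>n. \<bar>bisect_rest z l\<bar>)"
    by (intro sum_mono2) auto
  then show ?thesis
    using 1 2 sum_increment_le[of n] by linarith
qed

lemma sum_abs_bisect_piece_le: "(\<Sum>l<n. \<bar>bisect_piece z (Suc l)\<bar>) \<le> 2 * envelope z"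
proof -
  have "(\<Sum>l<n. \<bar>bisect_piece z (Suc l)\<bar>) \<le> (\<Sum>l<n. \<bar>bisect_rest z l\<bar> / 2 + \<bar>z (Suc l)\<bar> / sqrt 2 ^ (l + 2))"
  proof (rule sum_mono)
    fix l
    have "\<bar>bisect_rest z l / 2 + z (Suc l) / sqrt 2 ^ (l + 2)\<bar> \<le> \<bar>bisect_rest z l / 2\<bar> + \<bar>z (Suc l) / sqrt 2 ^ (l + 2)\<bar>"
      by (rule abs_triangle_ineq)
    then show "\<bar>bisect_piece z (Suc l)\<bar> \<le> \<bar>bisect_rest z l\<bar> / 2 + \<bar>z (Suc l)\<bar> / sqrt 2 ^ (l + 2)"
      by (simp add: abs_divide bisect_piece_def)
  qed
  also have "\<dots> = (\<Sum>l<n. \<bar>bisect_rest z l\<bar>) / 2 + (\<Sum>l<n. \<bar>z (Suc l)\<bar> / sqrt 2 ^ (l + 2))"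
    by (simp add: sum.distrib sum_divide_distrib)
  finally have "(\<Sum>l<n. \<bar>bisect_piece z (Suc l)\<bar>) \<le> (\<Sum>l<n. \<bar>bisect_rest z l\<bar>) / 2 + (\<Sum>l<n. \<bar>z (Suc l)\<bar> / sqrt 2 ^ (l + 2))" .
  moreover have "(\<Sum>l<n. \<bar>bisect_rest z l\<bar>) \<le> (\<Sum>l\<le>n. \<bar>bisect_rest z l\<bar>)"
    by (intro sum_mono2) auto
  ultimately show ?thesis
    using sum_increment_le[of n] sum_abs_bisect_rest_le[of n] by linarith
qed

lemma summable_abs_bisect_piece: "summable (\<lambda>l. \<bar>bisect_piece z (Suc l)\<bar>)"
  by (rule summableI_nonneg_bounded[OF _ sum_abs_bisect_piece_le]) simp

lemma bisect_rest_tendsto_0: "bisect_rest z \<longlonglongrightarrow> 0"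
proof -
  have "(\<Sum>l<n. \<bar>bisect_rest z l\<bar>) \<le> 2 * envelope z" for n
    by (rule order_trans[OF _ sum_abs_bisect_rest_le[of n]]) (auto intro: sum_mono2)
  then have "summable (\<lambda>l. \<bar>bisect_rest z l\<bar>)"
    by (intro summableI_nonneg_bounded) auto
  then show ?thesis
    by (rule summable_LIMSEQ_zero[OF summable_rabs_cancel])
qed

lemma sum_bisect_piece_tendsto: "(\<lambda>N. \<Sum>k=1..N. bisect_piece z k) \<longlonglongrightarrow> z 0"
proof -
  have "(\<Sum>k=1..N. bisect_piece z k) = z 0 - bisect_rest z N" for N
    by (induction N) (auto simp: bisect_piece_def)
  then show ?thesis
    using tendsto_diff[OF tendsto_const[of "z 0"] bisect_rest_tendsto_0] by simp
qed

lemma sum_half_powers_le: "(\<Sum>l=1..N. 1 / 2 ^ l) \<le> (1::real)"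
proof -
  have "(\<Sum>l=1..N. (1 / 2) ^ l) = 1 - (1 / 2 :: real) ^ N"
    by (induction N) simp_all
  then show ?thesis
    by (simp add: power_divide)
qed

lemma summable_centred_bisect_piece: "summable (\<lambda>l. \<bar>bisect_piece z (Suc l) - z 0 / 2 ^ Suc l\<bar>)"
proof (rule summable_comparison_test')
  show "summable (\<lambda>l. \<bar>bisect_piece z (Suc l)\<bar> + \<bar>z 0\<bar> * (1 / 2) ^ Suc l)"
  proof (rule summable_add[OF summable_abs_bisect_piece])
    have "summable (\<lambda>l. (1 / 2 :: real) ^ l)"
      by (rule summable_geometric) simp
    then have "summable (\<lambda>l. (1 / 2 :: real) ^ Suc l)"
      by (subst summable_Suc_iff)
    then show "summable (\<lambda>l. \<bar>z 0\<bar> * (1 / 2) ^ Suc l)"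
      by (rule summable_mult)
  qed
  show "norm \<bar>bisect_piece z (Suc l) - z 0 / 2 ^ Suc l\<bar> \<le> \<bar>bisect_piece z (Suc l)\<bar> + \<bar>z 0\<bar> * (1 / 2) ^ Suc l" for l
    using abs_triangle_ineq4[of "bisect_piece z (Suc l)" "z 0 / 2 ^ Suc l"] by (simp add: abs_divide power_divide)
qed

text \<open>The mean current dominates, so the sign factor tends to 1, and \<open>2 ^ N / (2 ^ N -
  1)\<close> tends to 1. Replacing the finite-\<open>N\<close> centring by the limiting one
  changes the sum of absolute values by at most the change of the total, because the shares
  \<open>1 / 2 ^ l\<close> sum to at most 1.\<close>

lemma INL_stat_bisect_tendsto:
  assumes "Ibar > 0"
  shows "(\<lambda>N. INL_stat Ibar \<sigma> N (bisect_piece z)) \<longlonglongrightarrow> 1 / 2 * (\<Sum>l. \<bar>bisect_piece z (Suc l) - z 0 / 2 ^ Suc l\<bar>)"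
proof -
  let ?s = "bisect_piece z"
  define c :: "nat \<Rightarrow> real" where "c N = 2 ^ N / (2 ^ N - 1)" for N
  define V where "V N = (\<Sum>k=1..N. ?s k)" for N
  have V: "V \<longlonglongrightarrow> z 0"
    unfolding V_def[abs_def] by (rule sum_bisect_piece_tendsto)
  have c: "c \<longlonglongrightarrow> 1"
    unfolding c_def[abs_def] by real_asymp
  have "(\<lambda>N. sqrt (2 ^ N) / (2 ^ N - 1) :: real) \<longlonglongrightarrow> 0"
    by real_asymp
  then have "(\<lambda>N. Ibar + \<sigma> * (sqrt (2 ^ N) / (2 ^ N - 1)) * V N) \<longlonglongrightarrow> Ibar + \<sigma> * 0 * z 0"
    by (intro tendsto_intros V)
  then have sgn: "(\<lambda>N. sgn (Ibar + \<sigma> * sqrt (2 ^ N) / (2 ^ N - 1) * V N)) \<longlonglongrightarrow> 1"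
    using tendsto_sgn[of _ Ibar sequentially] assms by simp
  have root: "(\<lambda>N. sqrt (c N) / 2) \<longlonglongrightarrow> 1 / 2"
    using tendsto_divide[OF tendsto_real_sqrt[OF c] tendsto_const[of 2]] by simp
  have lim: "(\<lambda>N. \<Sum>l=1..N. \<bar>?s l - z 0 / 2 ^ l\<bar>) \<longlonglongrightarrow> (\<Sum>l. \<bar>?s (Suc l) - z 0 / 2 ^ Suc l\<bar>)"
    unfolding One_nat_def sum.atLeast1_atMost_eq by (rule summable_LIMSEQ[OF summable_centred_bisect_piece])
  have diff: "(\<lambda>N. (\<Sum>l=1..N. \<bar>?s l - c N * V N / 2 ^ l\<bar>) - (\<Sum>l=1..N. \<bar>?s l - z 0 / 2 ^ l\<bar>)) \<longlonglongrightarrow> 0"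
  proof (rule Lim_null_comparison)
    show "(\<lambda>N. \<bar>z 0 - c N * V N\<bar>) \<longlonglongrightarrow> 0"
      using tendsto_rabs[OF tendsto_diff[OF tendsto_const[of "z 0"] tendsto_mult[OF c V]]] by simp
    have "norm ((\<Sum>l=1..N. \<bar>?s l - c N * V N / 2 ^ l\<bar>) - (\<Sum>l=1..N. \<bar>?s l - z 0 / 2 ^ l\<bar>)) \<le> \<bar>z 0 - c N * V N\<bar>" for N
    proof -
      have "\<bar>(\<Sum>l=1..N. \<bar>?s l - c N * V N / 2 ^ l\<bar>) - (\<Sum>l=1..N. \<bar>?s l - z 0 / 2 ^ l\<bar>)\<bar> \<le>
          (\<Sum>l=1..N. \<bar>\<bar>?s l - c N * V N / 2 ^ l\<bar> - \<bar>?s l - z 0 / 2 ^ l\<bar>\<bar>)"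
        unfolding sum_subtractf[symmetric] by (rule sum_abs)
      also have "\<dots> \<le> (\<Sum>l=1..N. \<bar>z 0 - c N * V N\<bar> * (1 / 2 ^ l))"
      proof (rule sum_mono)
        fix l
        have "\<bar>\<bar>?s l - c N * V N / 2 ^ l\<bar> - \<bar>?s l - z 0 / 2 ^ l\<bar>\<bar> \<le> \<bar>(z 0 - c N * V N) / 2 ^ l\<bar>"
          using abs_triangle_ineq3[of "?s l - c N * V N / 2 ^ l" "?s l - z 0 / 2 ^ l"] by (simp add: diff_divide_distrib)
        then show "\<bar>\<bar>?s l - c N * V N / 2 ^ l\<bar> - \<bar>?s l - z 0 / 2 ^ l\<bar>\<bar> \<le> \<bar>z 0 - c N * V N\<bar> * (1 / 2 ^ l)"
          by (simp add: abs_divide)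
      qed
      also have "\<dots> = \<bar>z 0 - c N * V N\<bar> * (\<Sum>l=1..N. 1 / 2 ^ l)"
        by (rule sum_distrib_left[symmetric])
      also have "\<dots> \<le> \<bar>z 0 - c N * V N\<bar>"
        using mult_left_mono[OF sum_half_powers_le[of N], of "\<bar>z 0 - c N * V N\<bar>"] by simp
      finally show ?thesis
        by simp
    qed
    then show "\<forall>\<^sub>F N in sequentially. norm ((\<Sum>l=1..N. \<bar>?s l - c N * V N / 2 ^ l\<bar>) - (\<Sum>l=1..N. \<bar>?s l - z 0 / 2 ^ l\<bar>)) \<le> \<bar>z 0 - c N * V N\<bar>"
      by simp
  qed
  have "(\<lambda>N. \<Sum>l=1..N. \<bar>?s l - c N * V N / 2 ^ l\<bar>) \<longlonglongrightarrow> (\<Sum>l. \<bar>?s (Suc l) - z 0 / 2 ^ Suc l\<bar>)"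
    using tendsto_add[OF diff lim] by simp
  from tendsto_mult[OF tendsto_mult[OF sgn root] this] show ?thesis
    unfolding INL_stat_def V_def[symmetric] c_def[symmetric] by simp
qed

lemma abs_INL_stat_bisect_le:
  assumes "N \<ge> 1"
  shows "\<bar>INL_stat Ibar \<sigma> N (bisect_piece z)\<bar> \<le> 6 * envelope z"
proof -
  let ?s = "bisect_piece z"
  define c :: real where "c = 2 ^ N / (2 ^ N - 1)"
  have "(2::real) ^ 1 \<le> 2 ^ N"
    using assms by (intro power_increasing) auto
  then have c: "0 \<le> c" "c \<le> 2"
    by (auto simp: c_def divide_simps)
  have S: "(\<Sum>k=1..N. \<bar>?s k\<bar>) \<le> 2 * envelope z"
    unfolding One_nat_def sum.atLeast1_atMost_eq by (rule sum_abs_bisect_piece_le)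
  have V: "\<bar>\<Sum>k=1..N. ?s k\<bar> \<le> 2 * envelope z"
    by (rule order_trans[OF sum_abs S])
  have "(\<Sum>l=1..N. \<bar>?s l - c * (\<Sum>k=1..N. ?s k) / 2 ^ l\<bar>) \<le> (\<Sum>l=1..N. \<bar>?s l\<bar> + c * \<bar>\<Sum>k=1..N. ?s k\<bar> * (1 / 2 ^ l))"
  proof (rule sum_mono)
    fix l
    show "\<bar>?s l - c * (\<Sum>k=1..N. ?s k) / 2 ^ l\<bar> \<le> \<bar>?s l\<bar> + c * \<bar>\<Sum>k=1..N. ?s k\<bar> * (1 / 2 ^ l)"
      using abs_triangle_ineq4[of "?s l" "c * (\<Sum>k=1..N. ?s k) / 2 ^ l"] c by (simp add: abs_mult abs_divide)
  qed
  also have "\<dots> = (\<Sum>l=1..N. \<bar>?s l\<bar>) + c * \<bar>\<Sum>k=1..N. ?s k\<bar> * (\<Sum>l=1..N. 1 / 2 ^ l)"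
    by (simp only: sum.distrib sum_distrib_left)
  also have "\<dots> \<le> 2 * envelope z + 2 * (2 * envelope z) * 1"
    using envelope_nonneg by (intro add_mono S mult_mono V c sum_half_powers_le sum_nonneg mult_nonneg_nonneg) auto
  finally have F: "(\<Sum>l=1..N. \<bar>?s l - c * (\<Sum>k=1..N. ?s k) / 2 ^ l\<bar>) \<le> 6 * envelope z"
    by simp
  have "sqrt c \<le> sqrt (2 ^ 2)"
    using c by (intro real_sqrt_le_mono) auto
  then have "sqrt c / 2 \<le> 1"
    by simp
  define W where "W = (\<Sum>l=1..N. \<bar>?s l - c * (\<Sum>k=1..N. ?s k) / 2 ^ l\<bar>)"
  have "W \<ge> 0"
    by (auto simp: W_def intro: sum_nonneg)
  have bound: "\<bar>sgn x * (sqrt c / 2) * W\<bar> \<le> 1 * 1 * W" for x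
    unfolding abs_mult using \<open>sqrt c / 2 \<le> 1\<close> \<open>W \<ge> 0\<close> c by (intro mult_mono) (auto simp: abs_sgn_eq)
  then show ?thesis
    unfolding INL_stat_def c_def[symmetric] W_def[symmetric]
    using F[folded W_def] by (intro order_trans[OF bound]) simp
qed

end

text \<open>Cauchy-Schwarz with the weight \<open>1 / sqrt 2 ^ l\<close> split evenly between the two
  factors.\<close>

lemma envelope_le_square_sum:
  assumes "summable (\<lambda>l. (z l)\<^sup>2 / sqrt 2 ^ l)"
  shows "summable (\<lambda>l. \<bar>z l\<bar> / sqrt 2 ^ l)"
    and "(envelope z)\<^sup>2 \<le> (\<Sum>l. 1 / sqrt 2 ^ l) * (\<Sum>l. (z l)\<^sup>2 / sqrt 2 ^ l)"
proof -
  have geo: "summable (\<lambda>l. 1 / sqrt 2 ^ l :: real)"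
    using summable_geometric[of "1 / sqrt 2 :: real"] by (simp add: power_divide)
  show s: "summable (\<lambda>l. \<bar>z l\<bar> / sqrt 2 ^ l)"
  proof (rule summable_comparison_test'[OF summable_add[OF geo assms]])
    show "norm (\<bar>z l\<bar> / sqrt 2 ^ l) \<le> 1 / sqrt 2 ^ l + (z l)\<^sup>2 / sqrt 2 ^ l" for l
    proof -
      have "0 \<le> (\<bar>z l\<bar> - 1 / 2)\<^sup>2"
        by simp
      then have "\<bar>z l\<bar> \<le> 1 + (z l)\<^sup>2"
        by (simp add: power2_diff power_divide)
      then show ?thesis
        by (simp add: add_divide_distrib[symmetric] divide_right_mono)
    qed
  qed
  have "(\<Sum>l<n. \<bar>z l\<bar> / sqrt 2 ^ l)\<^sup>2 \<le> (\<Sum>l. 1 / sqrt 2 ^ l) * (\<Sum>l. (z l)\<^sup>2 / sqrt 2 ^ l)" for n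
  proof -
    have "(\<Sum>l<n. \<bar>z l\<bar> / sqrt 2 ^ l) = (\<Sum>l<n. (1 / sqrt (sqrt 2 ^ l)) * (\<bar>z l\<bar> / sqrt (sqrt 2 ^ l)))"
      by simp
    also have "\<dots>\<^sup>2 \<le> (\<Sum>l<n. (1 / sqrt (sqrt 2 ^ l))\<^sup>2) * (\<Sum>l<n. (\<bar>z l\<bar> / sqrt (sqrt 2 ^ l))\<^sup>2)"
      by (rule Cauchy_Schwarz_ineq_sum)
    also have "\<dots> = (\<Sum>l<n. 1 / sqrt 2 ^ l) * (\<Sum>l<n. (z l)\<^sup>2 / sqrt 2 ^ l)"
      by (simp add: power_divide)
    also have "\<dots> \<le> (\<Sum>l. 1 / sqrt 2 ^ l) * (\<Sum>l. (z l)\<^sup>2 / sqrt 2 ^ l)"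
      using geo assms by (intro mult_mono sum_le_suminf suminf_nonneg sum_nonneg) auto
    finally show ?thesis .
  qed
  moreover have "(\<lambda>n. (\<Sum>l<n. \<bar>z l\<bar> / sqrt 2 ^ l)\<^sup>2) \<longlonglongrightarrow> (envelope z)\<^sup>2"
    unfolding envelope_def by (intro tendsto_power summable_LIMSEQ s)
  ultimately show "(envelope z)\<^sup>2 \<le> (\<Sum>l. 1 / sqrt 2 ^ l) * (\<Sum>l. (z l)\<^sup>2 / sqrt 2 ^ l)"
    by (intro LIMSEQ_le_const2) auto
qed

section \<open>The coupling and its convergence\<close>

lemma AE_summable_of_summable_integrals:
  fixes f :: "nat \<Rightarrow> 'a \<Rightarrow> real"
  assumes int: "\<And>i. integrable M (f i)" and nn: "\<And>i x. 0 \<le> f i x"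
    and sum: "summable (\<lambda>i. \<integral>x. f i x \<partial>M)"
  shows "AE x in M. summable (\<lambda>i. f i x)"
proof -
  have [measurable]: "f i \<in> borel_measurable M" for i
    using int by auto
  have "(\<integral>\<^sup>+x. (\<Sum>i. ennreal (f i x)) \<partial>M) = (\<Sum>i. \<integral>\<^sup>+x. ennreal (f i x) \<partial>M)"
    by (rule nn_integral_suminf) simp
  also have "\<dots> = (\<Sum>i. ennreal (\<integral>x. f i x \<partial>M))"
    using nn by (intro suminf_cong nn_integral_eq_integral int) auto
  also have "\<dots> \<noteq> \<infinity>"
    using nn sum by (simp add: ennreal_suminf_neq_top integral_nonneg_AE)
  finally have "AE x in M. (\<Sum>i. ennreal (f i x)) \<noteq> \<infinity>"
    by (intro nn_integral_PInf_AE) auto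
  then show ?thesis
    by eventually_elim (use nn in \<open>auto intro: summable_suminf_not_top\<close>)
qed

lemma M_limit_measurable:
  assumes "\<And>j. j \<ge> 1 \<Longrightarrow> Z j \<in> borel_measurable Q"
  shows "l \<ge> 1 \<Longrightarrow> M_term Z l \<in> borel_measurable Q"
    and "M_limit Z \<in> borel_measurable Q"
proof -
  have *: "M_term Z l \<in> borel_measurable Q" if "l \<ge> 1" for l
  proof -
    have "Z l \<in> borel_measurable Q" "(\<lambda>\<omega>. \<Sum>j=1..<l. 2 powr (- (real l - real j) / 2) * Z j \<omega>) \<in> borel_measurable Q"
      using assms that by (auto intro!: borel_measurable_sum)
    then show ?thesis
      unfolding M_term_def[abs_def]
      by (intro borel_measurable_times borel_measurable_abs borel_measurable_diff borel_measurable_const)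
  qed
  then show "l \<ge> 1 \<Longrightarrow> M_term Z l \<in> borel_measurable Q" .
  have [measurable]: "M_term Z (Suc l) \<in> borel_measurable Q" for l
    by (rule *) simp
  show "M_limit Z \<in> borel_measurable Q"
    unfolding M_limit_def[abs_def] by measurable
qed

lemma iid_normal_gauss_family:
  assumes "prob_space Q" "iid_normal Q Z 0 1"
  shows "gauss_family Q Z {1..}"
  using assms by (subst gauss_family_iff_indep) (auto simp: iid_normal_def)

text \<open>The series only involves the variables with positive index; this is what makes the law of
  \<open>M\<close> independent of the probability space.\<close>

lemma M_limit_restrict: "M_limit (\<lambda>j \<omega>. \<omega> j) (\<lambda>i\<in>{1..}. Z i \<omega>) = M_limit Z \<omega>"
proof -
  have "M_term (\<lambda>j \<omega>. \<omega> j) (Suc l) (\<lambda>i\<in>{1..}. Z i \<omega>) = M_term Z (Suc l) \<omega>" for l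
    unfolding M_term_def by (intro arg_cong2[of _ _ _ _ "\<lambda>a b. a * \<bar>b\<bar>"] arg_cong2[of _ _ _ _ "(-)"] sum.cong) auto
  then show ?thesis
    unfolding M_limit_def by simp
qed

lemma M_limit_law:
  assumes "gauss_family Q Z {1..}" "gauss_family R Y {1..}"
  shows "distr Q borel (M_limit Z) = distr R borel (M_limit Y)"
proof -
  let ?f = "M_limit (\<lambda>j \<omega>. \<omega> j)"
  have "?f \<in> borel_measurable (gauss_power {1..})"
    using gauss_family_measurable(1)[OF gauss_family_coordinates] by (intro M_limit_measurable(2)) auto
  from gauss_family_same_law[OF assms this]
  have "distr Q borel (\<lambda>\<omega>. ?f (\<lambda>i\<in>{1..}. Z i \<omega>)) = distr R borel (\<lambda>\<omega>. ?f (\<lambda>i\<in>{1..}. Y i \<omega>))" .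
  then show ?thesis
    unfolding M_limit_restrict .
qed

abbreviation gauss_seq :: "(nat \<Rightarrow> real) measure" where
  "gauss_seq \<equiv> gauss_power UNIV"

lemma prob_space_gauss_seq: "prob_space gauss_seq"
  by (rule prob_space_PiM) (rule prob_space_gauss)

lemma gauss_seq_component [measurable]: "(\<lambda>z. z i) \<in> borel_measurable gauss_seq"
  using gauss_family_measurable(1)[OF gauss_family_coordinates, of i UNIV] by simp

lemma bisect_rest_measurable [measurable]: "(\<lambda>z. bisect_rest z l) \<in> borel_measurable gauss_seq"
  by (induction l) simp_all

lemma bisect_piece_measurable [measurable]: "(\<lambda>z. bisect_piece z l) \<in> borel_measurable gauss_seq"
  unfolding bisect_piece_def by measurable

lemma INL_stat_bisect_measurable [measurable]:
  "(\<lambda>z. INL_stat Ibar \<sigma> N (bisect_piece z)) \<in> borel_measurable gauss_seq"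
  unfolding INL_stat_def by measurable

lemma envelope_measurable [measurable]: "envelope \<in> borel_measurable gauss_seq"
  unfolding envelope_def[abs_def] by measurable

lemma gauss_seq_envelope:
  shows "AE z in gauss_seq. summable (\<lambda>l. \<bar>z l\<bar> / sqrt 2 ^ l)"
    and "integrable gauss_seq (\<lambda>z. (envelope z)\<^sup>2)"
    and "integrable gauss_seq envelope"
proof -
  interpret prob_space gauss_seq
    by (rule prob_space_gauss_seq)
  note m = gauss_family_abs_moments[OF gauss_family_coordinates UNIV_I]
  have int: "integrable gauss_seq (\<lambda>z. (z l)\<^sup>2 / sqrt 2 ^ l)" for l
    using m(2)[of l 2] by simp
  have val: "(\<integral>z. (z l)\<^sup>2 / sqrt 2 ^ l \<partial>gauss_seq) = 1 / sqrt 2 ^ l" for l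
    using m(5)[of l] by simp
  have geo: "summable (\<lambda>l. 1 / sqrt 2 ^ l :: real)"
    using summable_geometric[of "1 / sqrt 2 :: real"] by (simp add: power_divide)
  have AE: "AE z in gauss_seq. summable (\<lambda>l. (z l)\<^sup>2 / sqrt 2 ^ l)"
    by (rule AE_summable_of_summable_integrals[OF int]) (simp, simp only: val geo)
  then show "AE z in gauss_seq. summable (\<lambda>l. \<bar>z l\<bar> / sqrt 2 ^ l)"
    by eventually_elim (rule envelope_le_square_sum)
  have "integrable gauss_seq (\<lambda>z. \<Sum>l. (z l)\<^sup>2 / sqrt 2 ^ l)"
  proof (rule integrable_suminf[OF int])
    show "summable (\<lambda>l. \<integral>z. norm ((z l)\<^sup>2 / sqrt 2 ^ l) \<partial>gauss_seq)"
      unfolding real_norm_def by (subst abs_of_nonneg) (simp, simp only: val geo)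
  qed (use AE in simp)
  then have i2: "integrable gauss_seq (\<lambda>z. (\<Sum>l. 1 / sqrt 2 ^ l) * (\<Sum>l. (z l)\<^sup>2 / sqrt 2 ^ l))"
    by (rule integrable_mult_right)
  show 2: "integrable gauss_seq (\<lambda>z. (envelope z)\<^sup>2)"
  proof (rule Bochner_Integration.integrable_bound[OF i2])
    show "AE z in gauss_seq. norm ((envelope z)\<^sup>2) \<le> norm ((\<Sum>l. 1 / sqrt 2 ^ l) * (\<Sum>l. (z l)\<^sup>2 / sqrt 2 ^ l))"
      using AE by eventually_elim (use envelope_le_square_sum(2) in fastforce)
  qed simp
  show "integrable gauss_seq envelope"
  proof (rule Bochner_Integration.integrable_bound)
    show "integrable gauss_seq (\<lambda>z. 1 + (envelope z)\<^sup>2)"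
      using 2 by simp
    have "\<bar>x\<bar> \<le> 1 + x\<^sup>2" for x :: real
    proof -
      have "0 \<le> (\<bar>x\<bar> - 1 / 2)\<^sup>2"
        by simp
      then show ?thesis
        by (simp add: power2_diff power_divide)
    qed
    then show "AE z in gauss_seq. norm (envelope z) \<le> norm (1 + (envelope z)\<^sup>2)"
      by (intro always_eventually allI) (simp add: add_nonneg_nonneg)
  qed simp
qed

lemma INL_stat_bisect_AE:
  assumes "Ibar > 0"
  shows "AE z in gauss_seq. (\<lambda>N. INL_stat Ibar \<sigma> N (bisect_piece z)) \<longlonglongrightarrow> M_limit (\<lambda>j z. z j) z"
    and "AE z in gauss_seq. \<bar>INL_stat Ibar \<sigma> N (bisect_piece z)\<bar> \<le> 6 * envelope z"
    and "AE z in gauss_seq. \<bar>M_limit (\<lambda>j z. z j) z\<bar> \<le> 6 * envelope z"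
proof -
  have M: "M_limit (\<lambda>j z. z j) z = 1 / 2 * (\<Sum>l. \<bar>bisect_piece z (Suc l) - z 0 / 2 ^ Suc l\<bar>)" for z
    unfolding M_limit_def M_term_bisect ..
  have lim: "(\<lambda>N. INL_stat Ibar \<sigma> N (bisect_piece z)) \<longlonglongrightarrow> M_limit (\<lambda>j z. z j) z"
    if "summable (\<lambda>l. \<bar>z l\<bar> / sqrt 2 ^ l)" for z
    unfolding M by (rule INL_stat_bisect_tendsto[OF that assms])
  have bound: "\<bar>INL_stat Ibar \<sigma> N (bisect_piece z)\<bar> \<le> 6 * envelope z"
    if "summable (\<lambda>l. \<bar>z l\<bar> / sqrt 2 ^ l)" for z N
  proof (cases "N = 0")
    case True
    then show ?thesis
      using envelope_nonneg[OF that] by (simp add: INL_stat_def)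
  next
    case False
    then show ?thesis
      by (intro abs_INL_stat_bisect_le that) simp
  qed
  show "AE z in gauss_seq. (\<lambda>N. INL_stat Ibar \<sigma> N (bisect_piece z)) \<longlonglongrightarrow> M_limit (\<lambda>j z. z j) z"
    using gauss_seq_envelope(1) by eventually_elim (rule lim)
  show "AE z in gauss_seq. \<bar>INL_stat Ibar \<sigma> N (bisect_piece z)\<bar> \<le> 6 * envelope z"
    using gauss_seq_envelope(1) by eventually_elim (rule bound)
  show "AE z in gauss_seq. \<bar>M_limit (\<lambda>j z. z j) z\<bar> \<le> 6 * envelope z"
    using gauss_seq_envelope(1)
  proof eventually_elim
    fix z :: "nat \<Rightarrow> real" assume z: "summable (\<lambda>l. \<bar>z l\<bar> / sqrt 2 ^ l)"
    show "\<bar>M_limit (\<lambda>j z. z j) z\<bar> \<le> 6 * envelope z"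
      by (rule LIMSEQ_le_const2[OF tendsto_rabs[OF lim[OF z]]]) (use bound[OF z] in auto)
  qed
qed

lemma conv_Lp_dominated:
  fixes X :: "nat \<Rightarrow> 'a \<Rightarrow> real"
  assumes X [measurable]: "\<And>N. X N \<in> borel_measurable R" and Y [measurable]: "Y \<in> borel_measurable R"
    and lim: "AE x in R. (\<lambda>N. X N x) \<longlonglongrightarrow> Y x"
    and boundX: "\<And>N. AE x in R. \<bar>X N x\<bar> \<le> w x" and boundY: "AE x in R. \<bar>Y x\<bar> \<le> w x"
    and w: "integrable R (\<lambda>x. w x ^ p)" and p: "p > 0"
  shows "conv_Lp R p X Y"
proof -
  have Lp: "in_Lp R p U" if [measurable]: "U \<in> borel_measurable R" and "AE x in R. \<bar>U x\<bar> \<le> w x" for U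
    unfolding in_Lp_def
  proof (intro conjI)
    show "integrable R (\<lambda>x. \<bar>U x\<bar> ^ p)"
    proof (rule Bochner_Integration.integrable_bound[OF w])
      show "AE x in R. norm (\<bar>U x\<bar> ^ p) \<le> norm (w x ^ p)"
        using that(2)
      proof eventually_elim
        case (elim x)
        have "\<bar>U x\<bar> ^ p \<le> w x ^ p"
          by (rule power_mono[OF elim]) simp
        then show ?case
          by (auto intro: order_trans[OF _ abs_ge_self])
      qed
    qed simp
  qed fact
  have "(\<lambda>N. \<integral>x. \<bar>X N x - Y x\<bar> ^ p \<partial>R) \<longlonglongrightarrow> (\<integral>x. 0 \<partial>R)"
  proof (rule integral_dominated_convergence[where w = "\<lambda>x. 2 ^ p * w x ^ p"])
    show "AE x in R. (\<lambda>N. \<bar>X N x - Y x\<bar> ^ p) \<longlonglongrightarrow> 0"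
      using lim
    proof eventually_elim
      case (elim x)
      from tendsto_power[OF tendsto_rabs[OF tendsto_diff[OF elim tendsto_const[of "Y x"]]], of p]
      show ?case
        using p by (simp add: zero_power)
    qed
    show "AE x in R. norm (\<bar>X N x - Y x\<bar> ^ p) \<le> 2 ^ p * w x ^ p" for N
      using boundX[of N] boundY
    proof eventually_elim
      case (elim x)
      have "\<bar>X N x - Y x\<bar> \<le> 2 * w x"
        using elim by linarith
      then have "\<bar>X N x - Y x\<bar> ^ p \<le> (2 * w x) ^ p"
        by (intro power_mono) auto
      then show ?case
        by (simp add: power_mult_distrib)
    qed
  qed (use w in auto)
  then show ?thesis
    using Lp[OF X boundX] Lp[OF Y boundY] by (simp add: conv_Lp_def)
qed

lemma INL_stat_bisect_conv_Lp:
  assumes "Ibar > 0"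
  shows "conv_Lp gauss_seq 1 (\<lambda>N z. INL_stat Ibar \<sigma> N (bisect_piece z)) (M_limit (\<lambda>j z. z j))"
    and "conv_Lp gauss_seq 2 (\<lambda>N z. INL_stat Ibar \<sigma> N (bisect_piece z)) (M_limit (\<lambda>j z. z j))"
proof -
  have M: "M_limit (\<lambda>j z. z j) \<in> borel_measurable gauss_seq"
    by (rule M_limit_measurable(2)) simp
  have "conv_Lp gauss_seq p (\<lambda>N z. INL_stat Ibar \<sigma> N (bisect_piece z)) (M_limit (\<lambda>j z. z j))"
    if "p > 0" "integrable gauss_seq (\<lambda>z. envelope z ^ p)" for p
    by (rule conv_Lp_dominated[OF _ M INL_stat_bisect_AE(1)[OF assms] INL_stat_bisect_AE(2,3)[OF assms] _ that(1)])
      (use that(2) in \<open>auto simp: power_mult_distrib\<close>)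
  then show "conv_Lp gauss_seq 1 (\<lambda>N z. INL_stat Ibar \<sigma> N (bisect_piece z)) (M_limit (\<lambda>j z. z j))"
    "conv_Lp gauss_seq 2 (\<lambda>N z. INL_stat Ibar \<sigma> N (bisect_piece z)) (M_limit (\<lambda>j z. z j))"
    using gauss_seq_envelope(2,3) by simp_all
qed

text \<open>The rescaled pieces are independent standard normal, as are the rescaled block sums, and the
  non-linearity is the same function of both.\<close>

lemma INL_stat_bisect_law:
  assumes "prob_space P" "iid_normal P Iu Ibar \<sigma>" "\<sigma> > 0" "N \<ge> 1"
  shows "distr gauss_seq borel (\<lambda>z. INL_stat Ibar \<sigma> N (bisect_piece z)) = distr P borel (normalized_INL_max \<sigma> Iu N)"
proof -
  have "gauss_family gauss_seq (\<lambda>l z. sqrt 2 ^ l * bisect_piece (\<lambda>j. z j) l) {1..N}"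
    by (rule gauss_family_bisect_piece, rule gauss_family_subset[OF gauss_family_coordinates]) simp
  from normalized_INL_max_law[OF assms this] show ?thesis
    by (simp add: real_sqrt_power)
qed

lemma normalized_INL_max_measurable:
  assumes "\<sigma> > 0" and Iu: "\<And>j. j \<ge> 1 \<Longrightarrow> Iu j \<in> borel_measurable P"
  shows "normalized_INL_max \<sigma> Iu N \<in> borel_measurable P"
proof (cases "N = 0")
  case True
  then have "normalized_INL_max \<sigma> Iu N = (\<lambda>\<omega>. 0)"
    by (simp add: fun_eq_iff normalized_INL_max_def)
  then show ?thesis
    by simp
next
  case False
  have [measurable]: "block_sum Iu m \<in> borel_measurable P" for m
  proof -
    have "Iu j \<in> borel_measurable P" if "j \<in> {2 ^ (m - 1)..2 ^ m - 1}" for j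
      by (rule Iu, rule order_trans[of _ "2 ^ (m - 1)"]) (use that in auto)
    then show ?thesis
      unfolding block_sum_def[abs_def] by (intro borel_measurable_sum) auto
  qed
  have "normalized_INL_max \<sigma> Iu N =
      (\<lambda>\<omega>. INL_stat 0 \<sigma> N (\<lambda>l. (block_sum Iu (N + 1 - l) \<omega> - 2 ^ (N - l) * 0) / (\<sigma> * sqrt (2 ^ N))))"
    using False assms(1) by (intro ext normalized_INL_max_eq_INL_stat[OF _ _ refl]) auto
  also have "\<dots> \<in> borel_measurable P"
    unfolding INL_stat_def by measurable
  finally show ?thesis .
qed

lemma normalized_INL_max_weak_conv:
  assumes P: "prob_space P" and iid: "iid_normal P Iu Ibar \<sigma>" and \<sigma>: "\<sigma> > 0" and I: "Ibar > 0"
  shows "weak_conv_m (\<lambda>N. distr P borel (normalized_INL_max \<sigma> Iu N)) (distr gauss_seq borel (M_limit (\<lambda>j z. z j)))"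
proof (rule integral_cts_step_conv_imp_weak_conv)
  interpret P: prob_space P by fact
  have m: "normalized_INL_max \<sigma> Iu N \<in> borel_measurable P" for N
    by (rule normalized_INL_max_measurable[OF \<sigma>]) (use iid in \<open>auto simp: iid_normal_def distributed_def\<close>)
  have M [measurable]: "M_limit (\<lambda>j z. z j) \<in> borel_measurable gauss_seq"
    by (rule M_limit_measurable(2)) simp
  show "real_distribution (distr P borel (normalized_INL_max \<sigma> Iu N))" for N
    by (rule P.real_distribution_distr[OF m])
  show "real_distribution (distr gauss_seq borel (M_limit (\<lambda>j z. z j)))"
    by (rule prob_space.real_distribution_distr[OF prob_space_gauss_seq M])
  fix x y :: real assume xy: "x < y"
  have cont: "continuous_on UNIV (cts_step x y)"
    using cts_step_uniformly_continuous[OF xy] by (rule uniformly_continuous_imp_continuous)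
  then have [measurable]: "cts_step x y \<in> borel_measurable borel"
    by (rule borel_measurable_continuous_onI)
  have "(\<lambda>N. \<integral>z. cts_step x y (INL_stat Ibar \<sigma> N (bisect_piece z)) \<partial>gauss_seq) \<longlonglongrightarrow>
      (\<integral>z. cts_step x y (M_limit (\<lambda>j z. z j) z) \<partial>gauss_seq)"
  proof (rule integral_dominated_convergence[where w = "\<lambda>_. 1"])
    show "AE z in gauss_seq. (\<lambda>N. cts_step x y (INL_stat Ibar \<sigma> N (bisect_piece z))) \<longlonglongrightarrow> cts_step x y (M_limit (\<lambda>j z. z j) z)"
      using INL_stat_bisect_AE(1)[OF I]
      by eventually_elim (rule continuous_on_tendsto_compose[OF cont], auto)
    show "AE z in gauss_seq. norm (cts_step x y (INL_stat Ibar \<sigma> N (bisect_piece z))) \<le> 1" for N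
      using xy by (auto simp: cts_step_def)
  qed auto
  then have "(\<lambda>N. integral\<^sup>L (distr gauss_seq borel (\<lambda>z. INL_stat Ibar \<sigma> N (bisect_piece z))) (cts_step x y)) \<longlonglongrightarrow>
      integral\<^sup>L (distr gauss_seq borel (M_limit (\<lambda>j z. z j))) (cts_step x y)"
    by (simp add: integral_distr)
  then show "(\<lambda>N. integral\<^sup>L (distr P borel (normalized_INL_max \<sigma> Iu N)) (cts_step x y)) \<longlonglongrightarrow>
      integral\<^sup>L (distr gauss_seq borel (M_limit (\<lambda>j z. z j))) (cts_step x y)"
    by (rule Lim_transform_eventually)
      (auto simp: eventually_sequentially INL_stat_bisect_law[OF P iid \<sigma>] intro!: exI[of _ 1])
qed

section \<open>Bounds for the primitive of the arcsine and for the covariances\<close>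

text \<open>This is the antiderivative of the arcsine that vanishes at 0. Evaluated at the correlation, it
  is the covariance of the absolute values of two standard normal variables, up to the factor
  \<open>2 / pi\<close>.\<close>

definition arcsin_primitive :: "real \<Rightarrow> real" where
  "arcsin_primitive x = sqrt (1 - x\<^sup>2) - 1 + x * arcsin x"

lemma arcsin_primitive_0 [simp]: "arcsin_primitive 0 = 0"
  by (simp add: arcsin_primitive_def)

lemma DERIV_arcsin_primitive:
  assumes "-1 < x" "x < 1"
  shows "DERIV arcsin_primitive x :> arcsin x"
proof -
  have "x\<^sup>2 < 1"
    using assms by (simp add: abs_square_less_1 abs_less_iff)
  then have pos: "1 - x\<^sup>2 > 0"
    by simp
  have "DERIV (\<lambda>x. sqrt (1 - x\<^sup>2) - 1 + x * arcsin x) x :> - x * inverse (sqrt (1 - x\<^sup>2)) + (arcsin x + x * inverse (sqrt (1 - x\<^sup>2)))"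
    using pos assms by (auto intro!: derivative_eq_intros simp: field_simps)
  then show ?thesis
    by (simp add: arcsin_primitive_def[abs_def])
qed

lemma DERIV_chain_mono:
  fixes f g f' g' :: "real \<Rightarrow> real"
  assumes "f 0 \<le> g 0" "0 \<le> x"
    and "\<And>t. 0 \<le> t \<Longrightarrow> t \<le> x \<Longrightarrow> DERIV f t :> f' t"
    and "\<And>t. 0 \<le> t \<Longrightarrow> t \<le> x \<Longrightarrow> DERIV g t :> g' t"
    and "\<And>t. 0 \<le> t \<Longrightarrow> t \<le> x \<Longrightarrow> f' t \<le> g' t"
  shows "f x \<le> g x"
proof -
  have "(\<lambda>t. g t - f t) 0 \<le> (\<lambda>t. g t - f t) x"
    by (rule DERIV_nonneg_imp_nondecreasing[OF assms(2)])
      (use assms in \<open>auto intro!: exI derivative_eq_intros\<close>)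
  then show ?thesis
    using assms(1) by simp
qed

text \<open>The second derivative is \<open>(1 - x\<^sup>2) powr (- 1 / 2)\<close>, so polynomial bounds for
  the latter may be integrated twice.\<close>

lemma arcsin_primitive_compare:
  fixes P P1 P2 :: "real \<Rightarrow> real"
  assumes x: "0 \<le> x" "x < 1"
    and P: "P 0 = 0" "P1 0 = 0" "\<And>t. DERIV P t :> P1 t" "\<And>t. DERIV P1 t :> P2 t"
  shows "(\<And>t. 0 \<le> t \<Longrightarrow> t \<le> x \<Longrightarrow> P2 t \<le> inverse (sqrt (1 - t\<^sup>2))) \<Longrightarrow> P x \<le> arcsin_primitive x"
    and "(\<And>t. 0 \<le> t \<Longrightarrow> t \<le> x \<Longrightarrow> inverse (sqrt (1 - t\<^sup>2)) \<le> P2 t) \<Longrightarrow> arcsin_primitive x \<le> P x"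
proof -
  have arc: "DERIV arcsin t :> inverse (sqrt (1 - t\<^sup>2))" if "0 \<le> t" "t \<le> x" for t
    using that x by (intro DERIV_arcsin) auto
  have prim: "DERIV arcsin_primitive t :> arcsin t" if "0 \<le> t" "t \<le> x" for t
    using that x by (intro DERIV_arcsin_primitive) auto
  assume le: "\<And>t. 0 \<le> t \<Longrightarrow> t \<le> x \<Longrightarrow> P2 t \<le> inverse (sqrt (1 - t\<^sup>2))"
  have P1: "P1 t \<le> arcsin t" if "0 \<le> t" "t \<le> x" for t
    by (rule DERIV_chain_mono[where f' = P2 and g' = "\<lambda>t. inverse (sqrt (1 - t\<^sup>2))"]) (use that P arc le in auto)
  show "P x \<le> arcsin_primitive x"
    by (rule DERIV_chain_mono[where f' = P1 and g' = arcsin]) (use x P prim P1 in auto)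
next
  have arc: "DERIV arcsin t :> inverse (sqrt (1 - t\<^sup>2))" if "0 \<le> t" "t \<le> x" for t
    using that x by (intro DERIV_arcsin) auto
  have prim: "DERIV arcsin_primitive t :> arcsin t" if "0 \<le> t" "t \<le> x" for t
    using that x by (intro DERIV_arcsin_primitive) auto
  assume le: "\<And>t. 0 \<le> t \<Longrightarrow> t \<le> x \<Longrightarrow> inverse (sqrt (1 - t\<^sup>2)) \<le> P2 t"
  have P1: "arcsin t \<le> P1 t" if "0 \<le> t" "t \<le> x" for t
    by (rule DERIV_chain_mono[where g' = P2 and f' = "\<lambda>t. inverse (sqrt (1 - t\<^sup>2))"]) (use that P arc le in auto)
  show "arcsin_primitive x \<le> P x"
    by (rule DERIV_chain_mono[where g' = P1 and f' = arcsin]) (use x P prim P1 in auto)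
qed

text \<open>The left-hand side is a truncation of the binomial series. Squared and multiplied by \<open>1 -
  y\<close> it agrees with 1 through order 4, and the remaining terms are all negative.\<close>

lemma inverse_sqrt_ge_poly:
  fixes y :: real
  assumes "0 \<le> y" "y < 1"
  shows "1 + y / 2 + 3 / 8 * y ^ 2 + 5 / 16 * y ^ 3 + 35 / 128 * y ^ 4 \<le> inverse (sqrt (1 - y))"
proof -
  define p where "p = 1 + y / 2 + 3 / 8 * y ^ 2 + 5 / 16 * y ^ 3 + 35 / 128 * y ^ 4"
  have p: "p > 0"
    using assms unfolding p_def by (intro add_pos_nonneg) auto
  define q where "q = 128 + 64 * y + 48 * y ^ 2 + 40 * y ^ 3 + 35 * y ^ 4"
  have pq: "p = q / 128"
    by (simp add: p_def q_def)
  have "16384 - q ^ 2 * (1 - y) = y ^ 5 * (8064 + 3360 * y + 2160 * y ^ 2 + 1575 * y ^ 3 + 1225 * y ^ 4)"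
    unfolding q_def by algebra
  also have "\<dots> \<ge> 0"
    using assms by (intro mult_nonneg_nonneg add_nonneg_nonneg) auto
  finally have "p\<^sup>2 * (1 - y) \<le> 1"
    by (simp add: pq power_divide)
  then have "p\<^sup>2 \<le> inverse (1 - y)"
    using assms by (simp add: field_simps)
  then have "sqrt (p\<^sup>2) \<le> sqrt (inverse (1 - y))"
    by (rule real_sqrt_le_mono)
  then show ?thesis
    using p by (simp add: real_sqrt_inverse p_def)
qed

text \<open>The cubic coefficient \<open>9 / 20\<close> exceeds the coefficient \<open>5 / 16\<close> of the
  binomial series just enough to absorb the tail of the series at the largest argument \<open>1 /
  3\<close>, which is attained by the squared correlation of the first two terms.\<close>

lemma inverse_sqrt_le_poly:
  fixes y :: real
  assumes "0 \<le> y" "y \<le> 1 / 3"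
  shows "inverse (sqrt (1 - y)) \<le> 1 + y / 2 + 3 / 8 * y ^ 2 + 9 / 20 * y ^ 3"
proof -
  define p where "p = 1 + y / 2 + 3 / 8 * y ^ 2 + 9 / 20 * y ^ 3"
  have p: "p > 0"
    using assms unfolding p_def by (intro add_pos_nonneg) auto
  define q where "q = 40 + 20 * y + 15 * y ^ 2 + 18 * y ^ 3"
  have pq: "p = q / 40"
    by (simp add: p_def q_def)
  \<comment> \<open>Positivity of the factor in parentheses is where \<open>y \<le> 1 / 3\<close> enters.\<close>
  have "q ^ 2 * (1 - y) - 1600 = y ^ 3 * (440 - 1095 * y - 405 * y ^ 2 - 216 * y ^ 3 - 324 * y ^ 4)"
    unfolding q_def by algebra
  also have "\<dots> \<ge> 0"
  proof (rule mult_nonneg_nonneg)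
    have "y ^ 2 \<le> (1 / 3) ^ 2" "y ^ 3 \<le> (1 / 3) ^ 3" "y ^ 4 \<le> (1 / 3) ^ 4"
      using assms by (intro power_mono; simp)+
    then have "y ^ 2 \<le> 1 / 9" "y ^ 3 \<le> 1 / 27" "y ^ 4 \<le> 1 / 81"
      by (simp_all add: power_divide)
    then show "0 \<le> 440 - 1095 * y - 405 * y ^ 2 - 216 * y ^ 3 - 324 * y ^ 4"
      using assms(2) by linarith
  qed (use assms in simp)
  finally have "1 \<le> p\<^sup>2 * (1 - y)"
    by (simp add: pq power_divide)
  then have "inverse (1 - y) \<le> p\<^sup>2"
    using assms by (simp add: field_simps)
  then have "sqrt (inverse (1 - y)) \<le> sqrt (p\<^sup>2)"
    by (rule real_sqrt_le_mono)
  then show ?thesis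
    using p by (simp add: real_sqrt_inverse p_def)
qed

lemma arcsin_primitive_even: "\<bar>x\<bar> \<le> 1 \<Longrightarrow> arcsin_primitive \<bar>x\<bar> = arcsin_primitive x"
  by (auto simp: arcsin_primitive_def abs_if arcsin_minus)

lemma arcsin_primitive_lower:
  assumes "\<bar>x\<bar> < 1"
  shows "x\<^sup>2 / 2 + (x\<^sup>2) ^ 2 / 24 + (x\<^sup>2) ^ 3 / 80 + 5 / 896 * (x\<^sup>2) ^ 4 + 7 / 2304 * (x\<^sup>2) ^ 5 \<le> arcsin_primitive x"
proof -
  define P where "P x = x ^ 2 / 2 + x ^ 4 / 24 + x ^ 6 / 80 + 5 / 896 * x ^ 8 + 7 / 2304 * x ^ 10" for x :: real
  define P1 where "P1 x = x + x ^ 3 / 6 + 3 / 40 * x ^ 5 + 5 / 112 * x ^ 7 + 35 / 1152 * x ^ 9" for x :: real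
  define P2 where "P2 x = 1 + x ^ 2 / 2 + 3 / 8 * x ^ 4 + 5 / 16 * x ^ 6 + 35 / 128 * x ^ 8" for x :: real
  have D: "DERIV P t :> P1 t" "DERIV P1 t :> P2 t" for t
    unfolding P_def P1_def P2_def by (auto intro!: derivative_eq_intros)
  have le: "P2 t \<le> inverse (sqrt (1 - t\<^sup>2))" if "0 \<le> t" "t \<le> \<bar>x\<bar>" for t
  proof -
    have "t\<^sup>2 < 1"
      using that assms by (simp add: abs_square_less_1)
    then show ?thesis
      using inverse_sqrt_ge_poly[of "t\<^sup>2"] by (simp add: P2_def flip: power_mult)
  qed
  have "P \<bar>x\<bar> \<le> arcsin_primitive \<bar>x\<bar>"
    by (rule arcsin_primitive_compare(1)[OF _ assms _ _ D le]) (auto simp: P_def P1_def)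
  moreover have "P \<bar>x\<bar> = x\<^sup>2 / 2 + (x\<^sup>2) ^ 2 / 24 + (x\<^sup>2) ^ 3 / 80 + 5 / 896 * (x\<^sup>2) ^ 4 + 7 / 2304 * (x\<^sup>2) ^ 5"
    by (simp add: P_def flip: power_mult)
  ultimately show ?thesis
    using assms by (simp add: arcsin_primitive_even)
qed

lemma arcsin_primitive_upper:
  assumes "x\<^sup>2 \<le> 1 / 3"
  shows "arcsin_primitive x \<le> x\<^sup>2 / 2 + (x\<^sup>2) ^ 2 / 24 + (x\<^sup>2) ^ 3 / 80 + 9 / 1120 * (x\<^sup>2) ^ 4"
proof -
  have "x\<^sup>2 < 1"
    using assms by simp
  then have x: "\<bar>x\<bar> < 1"
    by (simp add: abs_square_less_1)
  define P where "P x = x ^ 2 / 2 + x ^ 4 / 24 + x ^ 6 / 80 + 9 / 1120 * x ^ 8" for x :: real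
  define P1 where "P1 x = x + x ^ 3 / 6 + 3 / 40 * x ^ 5 + 9 / 140 * x ^ 7" for x :: real
  define P2 where "P2 x = 1 + x ^ 2 / 2 + 3 / 8 * x ^ 4 + 9 / 20 * x ^ 6" for x :: real
  have D: "DERIV P t :> P1 t" "DERIV P1 t :> P2 t" for t
    unfolding P_def P1_def P2_def by (auto intro!: derivative_eq_intros)
  have le: "inverse (sqrt (1 - t\<^sup>2)) \<le> P2 t" if "0 \<le> t" "t \<le> \<bar>x\<bar>" for t
  proof -
    have "t\<^sup>2 \<le> \<bar>x\<bar>\<^sup>2"
      using that by (intro power_mono) auto
    then have "t\<^sup>2 \<le> 1 / 3"
      using assms by simp
    then show ?thesis
      using inverse_sqrt_le_poly[of "t\<^sup>2"] by (simp add: P2_def flip: power_mult)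
  qed
  have "arcsin_primitive \<bar>x\<bar> \<le> P \<bar>x\<bar>"
    by (rule arcsin_primitive_compare(2)[OF _ x _ _ D le]) (auto simp: P_def P1_def)
  moreover have "P \<bar>x\<bar> = x\<^sup>2 / 2 + (x\<^sup>2) ^ 2 / 24 + (x\<^sup>2) ^ 3 / 80 + 9 / 1120 * (x\<^sup>2) ^ 4"
    by (simp add: P_def flip: power_mult)
  ultimately show ?thesis
    using x by (simp add: arcsin_primitive_even)
qed

lemma two_powr_minus_nat: "2 powr (- real l) = 1 / 2 ^ l"
  by (simp add: powr_minus powr_realpow inverse_eq_divide)

lemma sd_coeff_eq: "sd_coeff l = sqrt (2 ^ l - 1) / 2 ^ l"
proof -
  have "2 powr (- 2 * real l) = 1 / 2 ^ (l * 2)"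
    using two_powr_minus_nat[of "l * 2"] by (simp add: mult.commute)
  then have "2 powr (- real l) - 2 powr (- 2 * real l) = 1 / 2 ^ l - 1 / (2 ^ l) ^ 2"
    by (simp only: two_powr_minus_nat power_mult)
  also have "\<dots> = (2 ^ l - 1) / (2 ^ l) ^ 2"
    by (simp add: diff_divide_distrib power2_eq_square)
  finally show ?thesis
    by (simp add: sd_coeff_def real_sqrt_divide)
qed

lemma sd_coeff_pos: "l \<ge> 1 \<Longrightarrow> sd_coeff l > 0"
  by (simp add: sd_coeff_eq one_less_power)

lemma sd_coeff_squared: "(sd_coeff l)\<^sup>2 = 1 / 2 ^ l - 1 / 4 ^ l"
proof -
  have "(4::real) ^ l = 2 ^ l * 2 ^ l"
    by (simp flip: power_mult_distrib)
  then show ?thesis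
    using one_le_power[of "2::real" l] by (simp add: sd_coeff_eq power_divide power2_eq_square diff_divide_distrib)
qed

lemma rho_eq: "rho l k = - 1 / (sqrt (2 ^ l - 1) * sqrt (2 ^ k - 1))"
proof -
  have "2 powr (- (real l + real k)) = 1 / (2 ^ l * 2 ^ k)"
    using two_powr_minus_nat[of "l + k"] by (simp add: power_add)
  then show ?thesis
    by (simp add: rho_def sd_coeff_eq)
qed

text \<open>The squared correlation factorises over the two indices. Hence each power of it, summed over
  pairs, reduces to single sums.\<close>

lemma rho_squared: "l \<ge> 1 \<Longrightarrow> k \<ge> 1 \<Longrightarrow> (rho l k)\<^sup>2 = 1 / ((2 ^ l - 1) * (2 ^ k - 1))"
  using one_le_power[of "2::real" l] one_le_power[of "2::real" k]
  by (simp add: rho_eq power_divide power_mult_distrib)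

lemma rho_squared_le: "1 \<le> l \<Longrightarrow> l < k \<Longrightarrow> (rho l k)\<^sup>2 \<le> 1 / 3"
proof -
  assume lk: "1 \<le> l" "l < k"
  have "(2::real) ^ 1 \<le> 2 ^ l" "(2::real) ^ 2 \<le> 2 ^ k"
    using lk by (intro power_increasing; simp)+
  then have "1 * 3 \<le> (2 ^ l - 1) * (2 ^ k - 1 :: real)"
    by (intro mult_mono) auto
  then show ?thesis
    using lk by (simp add: rho_squared divide_simps)
qed

lemma var_term_eq: "var_term l k = sd_coeff l * sd_coeff k * arcsin_primitive (rho l k)"
  by (simp add: var_term_def arcsin_primitive_def)

lemma rho_less_1: "1 \<le> l \<Longrightarrow> l < k \<Longrightarrow> \<bar>rho l k\<bar> < 1"
  using rho_squared_le[of l k] by (simp flip: abs_square_less_1)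

lemma var_term_nonneg: "1 \<le> l \<Longrightarrow> l < k \<Longrightarrow> 0 \<le> var_term l k"
  unfolding var_term_eq
  by (intro mult_nonneg_nonneg order_trans[OF _ arcsin_primitive_lower[OF rho_less_1]])
    (auto simp: less_imp_le[OF sd_coeff_pos])

text \<open>The factor of one index in \<open>sd_coeff l * sd_coeff k * (rho l k) ^ (2 * (m + 1))\<close>.\<close>

definition ecoeff :: "nat \<Rightarrow> nat \<Rightarrow> real" where
  "ecoeff m l = sd_coeff l / (2 ^ l - 1) ^ Suc m"

lemma sd_coeff_rho_power:
  assumes "l \<ge> 1" "k \<ge> 1"
  shows "sd_coeff l * sd_coeff k * ((rho l k)\<^sup>2) ^ Suc m = ecoeff m l * ecoeff m k"
  using assms by (simp add: ecoeff_def rho_squared power_divide power_mult_distrib mult_ac)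

lemma var_term_lower:
  assumes "1 \<le> l" "l < k"
  shows "ecoeff 0 l * ecoeff 0 k / 2 + ecoeff 1 l * ecoeff 1 k / 24 + ecoeff 2 l * ecoeff 2 k / 80 +
    5 / 896 * (ecoeff 3 l * ecoeff 3 k) + 7 / 2304 * (ecoeff 4 l * ecoeff 4 k) \<le> var_term l k"
proof -
  let ?c = "sd_coeff l * sd_coeff k" and ?y = "(rho l k)\<^sup>2"
  have e: "ecoeff m l * ecoeff m k = ?c * ?y ^ Suc m" for m
    using assms sd_coeff_rho_power[of l k m] by simp
  have "?c * (?y / 2 + ?y ^ 2 / 24 + ?y ^ 3 / 80 + 5 / 896 * ?y ^ 4 + 7 / 2304 * ?y ^ 5) \<le> ?c * arcsin_primitive (rho l k)"
    using assms by (intro mult_left_mono arcsin_primitive_lower rho_less_1 mult_nonneg_nonneg less_imp_le[OF sd_coeff_pos]) auto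
  then show ?thesis
    unfolding e var_term_eq by (simp add: distrib_left eval_nat_numeral mult_ac)
qed

lemma var_term_upper:
  assumes "1 \<le> l" "l < k"
  shows "var_term l k \<le> ecoeff 0 l * ecoeff 0 k / 2 + ecoeff 1 l * ecoeff 1 k / 24 + ecoeff 2 l * ecoeff 2 k / 80 +
    9 / 1120 * (ecoeff 3 l * ecoeff 3 k)"
proof -
  let ?c = "sd_coeff l * sd_coeff k" and ?y = "(rho l k)\<^sup>2"
  have e: "ecoeff m l * ecoeff m k = ?c * ?y ^ Suc m" for m
    using assms sd_coeff_rho_power[of l k m] by simp
  have "?c * arcsin_primitive (rho l k) \<le> ?c * (?y / 2 + ?y ^ 2 / 24 + ?y ^ 3 / 80 + 9 / 1120 * ?y ^ 4)"
    using assms by (intro mult_left_mono arcsin_primitive_upper rho_squared_le mult_nonneg_nonneg less_imp_le[OF sd_coeff_pos]) auto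
  then show ?thesis
    unfolding e var_term_eq by (simp add: distrib_left eval_nat_numeral mult_ac)
qed

lemma sum_square_symmetric:
  fixes g :: "nat \<Rightarrow> nat \<Rightarrow> real"
  assumes "\<And>i j. g i j = g j i"
  shows "(\<Sum>i=1..n. \<Sum>j=1..n. g i j) = (\<Sum>i=1..n. g i i) + 2 * (\<Sum>k=1..n. \<Sum>l=1..<k. g l k)"
proof (induction n)
  case (Suc n)
  have "(\<Sum>i=1..Suc n. \<Sum>j=1..Suc n. g i j) =
      (\<Sum>i=1..n. \<Sum>j=1..n. g i j) + (\<Sum>i=1..n. g i (Suc n)) + (\<Sum>j=1..n. g (Suc n) j) + g (Suc n) (Suc n)"
    by (simp add: sum.distrib)
  also have "(\<Sum>j=1..n. g (Suc n) j) = (\<Sum>i=1..n. g i (Suc n))"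
    by (intro sum.cong assms refl)
  finally show ?case
    unfolding Suc.IH by (simp add: atLeastLessThanSuc_atLeastAtMost)
qed simp

definition pair_sum :: "(nat \<Rightarrow> real) \<Rightarrow> nat \<Rightarrow> real" where
  "pair_sum a n = (\<Sum>k=1..n. \<Sum>l=1..<k. a l * a k)"

text \<open>A sum of products over unordered pairs is determined by the sum and the sum of squares; the
  latter is rational for \<open>ecoeff\<close>.\<close>

lemma pair_sum_eq: "2 * pair_sum a n = (\<Sum>l=1..n. a l)\<^sup>2 - (\<Sum>l=1..n. (a l)\<^sup>2)"
  using sum_square_symmetric[of "\<lambda>i j. a i * a j" n]
  by (simp add: pair_sum_def power2_eq_square sum_product mult.commute)

definition var_partial :: "nat \<Rightarrow> real" where
  "var_partial n = (\<Sum>k=1..n. \<Sum>l=1..<k. var_term l k)"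

lemma var_partial_lower:
  "pair_sum (ecoeff 0) n / 2 + pair_sum (ecoeff 1) n / 24 + pair_sum (ecoeff 2) n / 80 +
    5 / 896 * pair_sum (ecoeff 3) n + 7 / 2304 * pair_sum (ecoeff 4) n \<le> var_partial n"
  unfolding var_partial_def pair_sum_def sum_divide_distrib sum_distrib_left sum.distrib[symmetric]
  by (intro sum_mono var_term_lower) auto

lemma var_partial_upper:
  "var_partial n \<le> pair_sum (ecoeff 0) n / 2 + pair_sum (ecoeff 1) n / 24 + pair_sum (ecoeff 2) n / 80 +
    9 / 1120 * pair_sum (ecoeff 3) n"
  unfolding var_partial_def pair_sum_def sum_divide_distrib sum_distrib_left sum.distrib[symmetric]
  by (intro sum_mono var_term_upper) auto

lemma var_partial_mono: "mono var_partial"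
proof (rule monoI)
  fix m n :: nat assume "m \<le> n"
  then show "var_partial m \<le> var_partial n"
    unfolding var_partial_def
    by (intro sum_mono2) (auto intro!: sum_nonneg var_term_nonneg)
qed

section \<open>Numerical bounds\<close>

lemma sd_coeff_ge: "a\<^sup>2 \<le> 1 / 2 ^ l - 1 / 4 ^ l \<Longrightarrow> a \<le> sd_coeff l"
  and sd_coeff_le: "1 / 2 ^ l - 1 / 4 ^ l \<le> b\<^sup>2 \<Longrightarrow> 0 \<le> b \<Longrightarrow> sd_coeff l \<le> b"
proof -
  have *: "sd_coeff l = sqrt (1 / 2 ^ l - 1 / 4 ^ l)"
    unfolding sd_coeff_squared[symmetric] by (simp add: sd_coeff_eq)
  show "a\<^sup>2 \<le> 1 / 2 ^ l - 1 / 4 ^ l \<Longrightarrow> a \<le> sd_coeff l"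
    unfolding * by (rule real_le_rsqrt)
  show "1 / 2 ^ l - 1 / 4 ^ l \<le> b\<^sup>2 \<Longrightarrow> 0 \<le> b \<Longrightarrow> sd_coeff l \<le> b"
    unfolding * by (rule real_le_lsqrt)
qed

text \<open>Ten decimals are enough for all numerical claims.\<close>

lemma sd_coeff_numerals:
  shows "1 / 2 \<le> sd_coeff 1" "sd_coeff 1 \<le> 1 / 2"
    and "0.4330127018 \<le> sd_coeff 2" "sd_coeff 2 \<le> 0.4330127019"
    and "0.3307189138 \<le> sd_coeff 3" "sd_coeff 3 \<le> 0.3307189139"
    and "0.2420614591 \<le> sd_coeff 4" "sd_coeff 4 \<le> 0.2420614592"
    and "0.1739926363 \<le> sd_coeff 5" "sd_coeff 5 \<le> 0.1739926364"
    and "0.1240195927 \<le> sd_coeff 6" "sd_coeff 6 \<le> 0.1240195928"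
    and "0.0880424036 \<le> sd_coeff 7" "sd_coeff 7 \<le> 0.0880424037"
    and "0.0623778102 \<le> sd_coeff 8" "sd_coeff 8 \<le> 0.0623778103"
    and "0.0441509943 \<le> sd_coeff 9" "sd_coeff 9 \<le> 0.0441509944"
    and "0.0312347374 \<le> sd_coeff 10" "sd_coeff 10 \<le> 0.0312347375"
    and "0.0220916914 \<le> sd_coeff 11" "sd_coeff 11 \<le> 0.0220916915"
    and "0.0156230925 \<le> sd_coeff 12" "sd_coeff 12 \<le> 0.0156230926"
    and "0.0110478690 \<le> sd_coeff 13" "sd_coeff 13 \<le> 0.0110478691"
    and "0.0078122615 \<le> sd_coeff 14" "sd_coeff 14 \<le> 0.0078122616"
    and "0.0055241874 \<le> sd_coeff 15" "sd_coeff 15 \<le> 0.0055241875"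
    and "0.0039062201 \<le> sd_coeff 16" "sd_coeff 16 \<le> 0.0039062202"
  by (rule sd_coeff_ge sd_coeff_le; simp add: power2_eq_square)+

lemma sum_1_to_12:
  fixes f :: "nat \<Rightarrow> real"
  shows "(\<Sum>l=1..12. f l) = f 1 + f 2 + f 3 + f 4 + f 5 + f 6 + f 7 + f 8 + f 9 + f 10 + f 11 + f 12"
  by (simp add: numeral_eq_Suc)

text \<open>The amount \<open>1 / 360000\<close> is reserved for the terms with index above 12.\<close>

lemma sum_ecoeff_numerals:
  shows "0.71637119 \<le> (\<Sum>l=1..12. ecoeff 0 l)"
    and "0.55615664 \<le> (\<Sum>l=1..12. ecoeff 1 l)"
    and "0.51707980 \<le> (\<Sum>l=1..12. ecoeff 2 l)"
    and "0.50548855 \<le> (\<Sum>l=1..12. ecoeff 3 l)"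
    and "0.50180194 \<le> (\<Sum>l=1..12. ecoeff 4 l)"
    and "(\<Sum>l=1..12. ecoeff 0 l) \<le> 0.71637398 - 1 / 360000"
    and "(\<Sum>l=1..12. ecoeff 1 l) \<le> 0.55615943 - 1 / 360000"
    and "(\<Sum>l=1..12. ecoeff 2 l) \<le> 0.51708260 - 1 / 360000"
    and "(\<Sum>l=1..12. ecoeff 3 l) \<le> 0.50549135 - 1 / 360000"
  unfolding sum_1_to_12 ecoeff_def using sd_coeff_numerals by simp_all

lemma sum_ecoeff_squared_numerals:
  shows "(\<Sum>l=1..12. (ecoeff 0 l)\<^sup>2) \<le> 0.27336182"
    and "(\<Sum>l=1..12. (ecoeff 1 l)\<^sup>2) \<le> 0.25236156"
    and "(\<Sum>l=1..12. (ecoeff 2 l)\<^sup>2) \<le> 0.25025814"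
    and "(\<Sum>l=1..12. (ecoeff 3 l)\<^sup>2) \<le> 0.25002860"
    and "(\<Sum>l=1..12. (ecoeff 4 l)\<^sup>2) \<le> 0.25000318"
    and "0.27336181 \<le> (\<Sum>l=1..12. (ecoeff 0 l)\<^sup>2)"
    and "0.25236155 \<le> (\<Sum>l=1..12. (ecoeff 1 l)\<^sup>2)"
    and "0.25025813 \<le> (\<Sum>l=1..12. (ecoeff 2 l)\<^sup>2)"
    and "0.25002859 \<le> (\<Sum>l=1..12. (ecoeff 3 l)\<^sup>2)"
  unfolding sum_1_to_12 ecoeff_def power_divide sd_coeff_squared by simp_all

lemma ecoeff_nonneg: "0 \<le> ecoeff m l"
  unfolding ecoeff_def by (intro divide_nonneg_nonneg zero_le_power) (auto simp: sd_coeff_eq)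

text \<open>The constant 90 is a lower bound for \<open>sqrt (2 ^ 13 - 1)\<close>.\<close>

lemma ecoeff_tail:
  assumes "l \<ge> 13"
  shows "ecoeff m l \<le> (1 / 2) ^ l / 90"
proof -
  have "(2::real) ^ 13 \<le> 2 ^ l"
    using assms by (intro power_increasing) auto
  then have big: "8191 \<le> (2::real) ^ l - 1"
    by simp
  have "90 \<le> sqrt (2 ^ l - 1 :: real)"
    using big by (intro real_le_rsqrt) (simp add: power2_eq_square)
  moreover have "sqrt (2 ^ l - 1) * sqrt (2 ^ l - 1) = (2 ^ l - 1 :: real)"
    using big by simp
  then have "ecoeff 0 l = (1 / 2) ^ l / sqrt (2 ^ l - 1)"
    using big by (simp add: ecoeff_def sd_coeff_eq power_divide field_simps)
  moreover have "(1 / 2) ^ l / sqrt (2 ^ l - 1) \<le> (1 / 2 :: real) ^ l / 90"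
    using calculation(1) big by (intro divide_left_mono) auto
  ultimately have 0: "ecoeff 0 l \<le> (1 / 2) ^ l / 90"
    by simp
  have "ecoeff m l = ecoeff 0 l / (2 ^ l - 1) ^ m"
    by (simp add: ecoeff_def)
  also have "\<dots> \<le> ecoeff 0 l / 1"
    using big ecoeff_nonneg[of 0 l] by (intro divide_left_mono one_le_power) auto
  finally show ?thesis
    using 0 by simp
qed

lemma sum_ecoeff_le:
  assumes "n \<ge> 12"
  shows "(\<Sum>l=1..n. ecoeff m l) \<le> (\<Sum>l=1..12. ecoeff m l) + 1 / 360000"
proof -
  have "(\<Sum>l=1..n. ecoeff m l) = (\<Sum>l=1..12. ecoeff m l) + (\<Sum>l=13..n. ecoeff m l)"
  proof -
    have "{1..n} = {1..12} \<union> {13..n}"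
      using assms by auto
    then show ?thesis
      by (simp add: sum.union_disjoint)
  qed
  also have "(\<Sum>l=13..n. ecoeff m l) \<le> (\<Sum>l=13..n. (1 / 2) ^ l / 90)"
    by (intro sum_mono ecoeff_tail) auto
  also have "\<dots> = (\<Sum>l=13..n. (1 / 2) ^ l) / 90"
    by (simp add: sum_divide_distrib)
  also have "(\<Sum>l=13..n. (1 / 2) ^ l) = (1 / 2) ^ 12 - (1 / 2 :: real) ^ n"
    using assms by (induction n rule: dec_induct) auto
  also have "((1 / 2) ^ 12 - (1 / 2 :: real) ^ n) / 90 \<le> 1 / 360000"
  proof -
    have "(1 / 2 :: real) ^ 12 = 1 / 4096"
      by (simp add: power_divide)
    moreover have "0 \<le> (1 / 2 :: real) ^ n"
      by simp
    ultimately have "(1 / 2) ^ 12 - (1 / 2 :: real) ^ n \<le> 1 / 4096"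
      by linarith
    then have "((1 / 2) ^ 12 - (1 / 2 :: real) ^ n) / 90 \<le> 1 / 4096 / 90"
      by (rule divide_right_mono) simp
    then show ?thesis
      by (rule order_trans) simp
  qed
  finally show ?thesis
    by simp
qed

lemma pair_sum_ecoeff_lower:
  assumes "0 \<le> a" "a \<le> (\<Sum>l=1..12. ecoeff m l)" "(\<Sum>l=1..12. (ecoeff m l)\<^sup>2) \<le> q"
  shows "(a\<^sup>2 - q) / 2 \<le> pair_sum (ecoeff m) 12"
proof -
  have "(a\<^sup>2 - q) / 2 \<le> p" if "2 * p = s - t" "a\<^sup>2 \<le> s" "t \<le> q" for p s t
    using that by simp
  from this[OF pair_sum_eq power_mono[OF assms(2,1)] assms(3)] show ?thesis .
qed

lemma pair_sum_ecoeff_upper: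
  assumes "n \<ge> 12" "(\<Sum>l=1..12. ecoeff m l) \<le> b - 1 / 360000" "q \<le> (\<Sum>l=1..12. (ecoeff m l)\<^sup>2)"
  shows "pair_sum (ecoeff m) n \<le> (b\<^sup>2 - q) / 2"
proof -
  have "(\<Sum>l=1..n. ecoeff m l) \<le> b"
    using sum_ecoeff_le[OF assms(1), of m] assms(2) by linarith
  then have "(\<Sum>l=1..n. ecoeff m l)\<^sup>2 \<le> b\<^sup>2"
    by (intro power_mono sum_nonneg ecoeff_nonneg)
  moreover have "q \<le> (\<Sum>l=1..n. (ecoeff m l)\<^sup>2)"
    using assms(1) by (intro order_trans[OF assms(3)] sum_mono2) auto
  moreover have "p \<le> (b\<^sup>2 - q) / 2" if "2 * p = s - t" "s \<le> b\<^sup>2" "q \<le> t" for p s t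
    using that by simp
  ultimately show ?thesis
    using pair_sum_eq[of "ecoeff m" n] by blast
qed

lemma var_partial_12_ge: "0.0612675 \<le> var_partial 12"
proof -
  note bounds = pair_sum_ecoeff_lower[OF _ sum_ecoeff_numerals(1) sum_ecoeff_squared_numerals(1)]
    pair_sum_ecoeff_lower[OF _ sum_ecoeff_numerals(2) sum_ecoeff_squared_numerals(2)]
    pair_sum_ecoeff_lower[OF _ sum_ecoeff_numerals(3) sum_ecoeff_squared_numerals(3)]
    pair_sum_ecoeff_lower[OF _ sum_ecoeff_numerals(4) sum_ecoeff_squared_numerals(4)]
    pair_sum_ecoeff_lower[OF _ sum_ecoeff_numerals(5) sum_ecoeff_squared_numerals(5)]
  show ?thesis
    using var_partial_lower[of 12] bounds by (simp add: power2_eq_square)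
qed

lemma var_partial_le: "var_partial n \<le> 0.061275"
proof -
  define k where "k = max n 12"
  have k: "k \<ge> 12" "n \<le> k"
    by (auto simp: k_def)
  note bounds = pair_sum_ecoeff_upper[OF k(1) sum_ecoeff_numerals(6) sum_ecoeff_squared_numerals(6)]
    pair_sum_ecoeff_upper[OF k(1) sum_ecoeff_numerals(7) sum_ecoeff_squared_numerals(7)]
    pair_sum_ecoeff_upper[OF k(1) sum_ecoeff_numerals(8) sum_ecoeff_squared_numerals(8)]
    pair_sum_ecoeff_upper[OF k(1) sum_ecoeff_numerals(9) sum_ecoeff_squared_numerals(9)]
  have "var_partial k \<le> 0.061275"
    using var_partial_upper[of k] bounds by (simp add: power2_eq_square)
  then show ?thesis
    using monoD[OF var_partial_mono k(2)] by linarith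
qed

text \<open>For large indices the standard deviations are nearly geometric, with a relative error of order
  \<open>2 ^ (- l)\<close>. This makes the tail of their slowly convergent series explicit.\<close>

lemma sd_coeff_root_bounds:
  "(1 / sqrt 2) ^ l * (1 - (1 / 2) ^ l) \<le> sd_coeff l" "sd_coeff l \<le> (1 / sqrt 2) ^ l"
proof -
  have p: "(1 / sqrt 2) ^ l = sqrt (1 / 2 ^ l)"
    by (simp add: real_sqrt_divide real_sqrt_power power_divide)
  have h: "(1 / 2 :: real) ^ l \<le> 1"
    by (rule power_le_one) auto
  have s: "sd_coeff l = sqrt (1 / 2 ^ l) * sqrt (1 - (1 / 2) ^ l)"
  proof -
    have "sd_coeff l = sqrt ((sd_coeff l)\<^sup>2)"
      by (simp add: sd_coeff_eq)
    also have "(sd_coeff l)\<^sup>2 = (1 / 2 ^ l) * (1 - (1 / 2) ^ l)"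
      unfolding sd_coeff_squared by (simp add: right_diff_distrib power_divide flip: power_mult_distrib)
    finally show ?thesis
      by (simp only: real_sqrt_mult)
  qed
  have "(1 - (1 / 2) ^ l)\<^sup>2 \<le> (1 - (1 / 2 :: real) ^ l) * 1"
    unfolding power2_eq_square using h by (intro mult_left_mono) auto
  then have "1 - (1 / 2) ^ l \<le> sqrt (1 - (1 / 2 :: real) ^ l)"
    by (intro real_le_rsqrt) simp
  then show "(1 / sqrt 2) ^ l * (1 - (1 / 2) ^ l) \<le> sd_coeff l"
    unfolding p s by (intro mult_left_mono) auto
  have "sqrt (1 - (1 / 2 :: real) ^ l) \<le> 1"
    by simp
  then show "sd_coeff l \<le> (1 / sqrt 2) ^ l"
    unfolding p s by (intro mult_left_le) auto
qed

lemma summable_sd_coeff: "summable (\<lambda>l. sd_coeff (Suc l))"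
proof -
  have "summable (\<lambda>l. sd_coeff l)"
  proof (rule summable_comparison_test')
    show "summable (\<lambda>l. (1 / sqrt 2 :: real) ^ l)"
      by (rule summable_geometric) simp
    show "norm (sd_coeff l) \<le> (1 / sqrt 2) ^ l" if "l \<ge> 0" for l
      using sd_coeff_root_bounds(2)[of l] by (simp add: sd_coeff_eq)
  qed
  then show ?thesis
    by (subst summable_Suc_iff)
qed

text \<open>Sixteen terms are taken from the table; the remainder lies between a geometric series with ratio
  \<open>1 / sqrt 2\<close> and \<open>1 - 2 ^ (- 17)\<close> times that series.\<close>

lemma suminf_sd_coeff_bounds:
  "2.105047 \<le> (\<Sum>l. sd_coeff (Suc l))" "(\<Sum>l. sd_coeff (Suc l)) \<le> 2.1050472"
proof -
  define r :: real where "r = 1 / sqrt 2"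
  have r: "0 \<le> r" "r < 1"
    by (auto simp: r_def)
  have geo: "(\<lambda>l. r ^ (l + 17)) sums (r ^ 17 * (1 / (1 - r)))"
    unfolding power_add using sums_mult2[OF geometric_sums[of r], of "r ^ 17"] r by (simp add: mult.commute)
  \<comment> \<open>The 17th power of \<open>1 / sqrt 2\<close> is \<open>1 / (256 * sqrt 2)\<close>.\<close>
  have val: "r ^ 17 * (1 / (1 - r)) = (sqrt 2 + 1) / 256"
  proof -
    have "r ^ 16 = (r\<^sup>2) ^ 8"
      by (simp flip: power_mult)
    then have "r ^ 17 = r / 256"
      by (simp add: r_def power_divide power_Suc[of _ 16, simplified])
    moreover have "r / (1 - r) = sqrt 2 + 1"
      by (simp add: r_def field_simps)
    ultimately show ?thesis
      by (metis (no_types, opaque_lifting) mult.right_neutral times_divide_eq_left times_divide_eq_right)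
  qed
  have root: "1.414213562 \<le> sqrt 2" "sqrt 2 \<le> 1.414213563"
    by (intro real_le_rsqrt real_le_lsqrt; simp add: power2_eq_square)+
  have tail: "summable (\<lambda>l. sd_coeff (Suc (l + 16)))"
    using summable_sd_coeff by (subst summable_iff_shift)
  have split: "(\<Sum>l. sd_coeff (Suc l)) = (\<Sum>l. sd_coeff (Suc (l + 16))) + (\<Sum>l<16. sd_coeff (Suc l))"
    by (rule suminf_split_initial_segment[OF summable_sd_coeff])
  have head: "(\<Sum>l<16. sd_coeff (Suc l)) = sd_coeff 1 + sd_coeff 2 + sd_coeff 3 + sd_coeff 4 + sd_coeff 5 + sd_coeff 6 + sd_coeff 7 + sd_coeff 8 + sd_coeff 9 + sd_coeff 10 + sd_coeff 11 + sd_coeff 12 + sd_coeff 13 + sd_coeff 14 + sd_coeff 15 + sd_coeff 16"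
    by (simp add: numeral_eq_Suc)
  have "(\<Sum>l. sd_coeff (Suc (l + 16))) \<le> (\<Sum>l. r ^ (l + 17))"
  proof (rule suminf_le[OF _ tail])
    show "sd_coeff (Suc (l + 16)) \<le> r ^ (l + 17)" for l
      using sd_coeff_root_bounds(2)[of "l + 17"] by (simp add: r_def add.commute)
    show "summable (\<lambda>l. r ^ (l + 17))"
      using geo by (rule sums_summable)
  qed
  also have "\<dots> = (sqrt 2 + 1) / 256"
    using geo val by (simp add: sums_iff)
  finally show "(\<Sum>l. sd_coeff (Suc l)) \<le> 2.1050472"
    unfolding split head using sd_coeff_numerals root by simp
  have "(sqrt 2 + 1) / 256 * (1 - (1 / 2) ^ 17) = (\<Sum>l. r ^ (l + 17) * (1 - (1 / 2) ^ 17))"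
    using sums_mult2[OF geo, of "1 - (1 / 2) ^ 17"] unfolding val by (rule sums_unique)
  also have "\<dots> \<le> (\<Sum>l. sd_coeff (Suc (l + 16)))"
  proof (rule suminf_le[OF _ _ tail])
    fix l
    have "(1 / 2 :: real) ^ (l + 17) \<le> (1 / 2) ^ 17"
      by (rule power_decreasing) auto
    then have "r ^ (l + 17) * (1 - (1 / 2) ^ 17) \<le> r ^ (l + 17) * (1 - (1 / 2) ^ (l + 17))"
      using r by (intro mult_left_mono) auto
    also have "\<dots> \<le> sd_coeff (l + 17)"
      unfolding r_def by (rule sd_coeff_root_bounds)
    finally show "r ^ (l + 17) * (1 - (1 / 2) ^ 17) \<le> sd_coeff (Suc (l + 16))"
      by (simp add: add.commute)
  next
    show "summable (\<lambda>l. r ^ (l + 17) * (1 - (1 / 2) ^ 17))"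
      using sums_mult2[OF geo] by (rule sums_summable)
  qed
  finally have "(sqrt 2 + 1) / 256 * (1 - (1 / 2) ^ 17) \<le> (\<Sum>l. sd_coeff (Suc (l + 16)))" .
  moreover have "(1 / 2 :: real) ^ 17 = 1 / 131072"
    by (simp add: power_divide)
  ultimately have "(sqrt 2 + 1) / 256 * (1 - 1 / 131072) \<le> (\<Sum>l. sd_coeff (Suc (l + 16)))"
    by simp
  then show "2.105047 \<le> (\<Sum>l. sd_coeff (Suc l))"
    unfolding split head using sd_coeff_numerals root by simp
qed

lemma mean_numeral:
  "\<bar>(2 * pi) powr (- 1 / 2) * (\<Sum>l. sd_coeff (Suc l)) - 0.839792\<bar> \<le> 5 / 10 ^ 7"
proof -
  have root: "2.50662827 \<le> sqrt (2 * pi)" "sqrt (2 * pi) \<le> 2.50662828"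
    using pi_approx by (intro real_le_rsqrt real_le_lsqrt; simp add: power2_eq_square)+
  have "(2 * pi) powr (- 1 / 2) = inverse ((2 * pi) powr (1 / 2))"
    by (simp add: powr_minus)
  then have "(2 * pi) powr (- 1 / 2) * (\<Sum>l. sd_coeff (Suc l)) = (\<Sum>l. sd_coeff (Suc l)) / sqrt (2 * pi)"
    by (simp add: powr_half_sqrt field_simps)
  moreover have "(\<Sum>l. sd_coeff (Suc l)) / sqrt (2 * pi) \<le> 0.8397925"
  proof -
    have "(\<Sum>l. sd_coeff (Suc l)) \<le> 0.8397925 * sqrt (2 * pi)"
      using suminf_sd_coeff_bounds(2) root by simp
    then show ?thesis
      by (simp add: divide_le_eq)
  qed
  moreover have "0.8397915 \<le> (\<Sum>l. sd_coeff (Suc l)) / sqrt (2 * pi)"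
  proof -
    have "0.8397915 * sqrt (2 * pi) \<le> (\<Sum>l. sd_coeff (Suc l))"
      using suminf_sd_coeff_bounds(1) root by simp
    then show ?thesis
      by (simp add: le_divide_eq)
  qed
  ultimately show ?thesis
    unfolding abs_le_iff by simp
qed

text \<open>The two bounds on \<open>S\<close> leave a margin on either side; the lower one is the tight
  one, since the exact variance is about 0.080066.\<close>

lemma variance_numeral:
  assumes "0.0612675 \<le> S" "S \<le> 0.061275"
  shows "\<bar>1 / pi * S + 1 / 6 * (1 - 2 / pi) - 0.08007\<bar> \<le> 5 / 10 ^ 6"
proof -
  define w where "w = (1 / 3 - S) / pi"
  have "1 / pi * S + 1 / 6 * (1 - 2 / pi) = 1 / 6 - w"
    by (simp add: w_def field_simps)
  moreover have "w \<le> 1 / 6 - 0.080065"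
    unfolding w_def using assms pi_approx by (simp add: divide_le_eq)
  moreover have "1 / 6 - 0.080075 \<le> w"
    unfolding w_def using assms pi_approx by (simp add: le_divide_eq)
  ultimately show ?thesis
    unfolding abs_le_iff by simp
qed

section \<open>Moments of the limit\<close>

lemma sqrt2_power_product: "a + b = 2 * l \<Longrightarrow> sqrt 2 ^ a * sqrt 2 ^ b = (2::real) ^ l"
  unfolding power_add[symmetric] by (simp add: power_mult)

text \<open>The coefficients of the linear form inside the absolute value of \<open>M_term\<close>, on an
  index range that may be longer than \<open>l\<close>, so that two forms can share one family.\<close>

definition form_coeff :: "nat \<Rightarrow> nat \<Rightarrow> real" where
  "form_coeff l j = (if j < l then 1 else if j = l then -1 else 0) * sqrt (2 ^ (j - 1)) / 2 ^ l"

lemma M_term_eq_form: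
  assumes "l \<ge> 1" "l \<le> K"
  shows "M_term Z l \<omega> = \<bar>\<Sum>j=1..K. form_coeff l j * Z j \<omega>\<bar>"
proof -
  have scale: "2 powr (- (real l + 1) / 2) = sqrt (2 ^ (l - 1)) / 2 ^ l"
  proof -
    have "2 powr (- (real l + 1) / 2) = 1 / sqrt 2 ^ (l + 1)"
      using two_powr_neg_half[of "l + 1"] by (simp add: add.commute)
    also have "\<dots> = sqrt 2 ^ (l - 1) / (sqrt 2 ^ (l + 1) * sqrt 2 ^ (l - 1))"
      by simp
    also have "sqrt 2 ^ (l + 1) * sqrt 2 ^ (l - 1) = (2 :: real) ^ l"
      using assms by (intro sqrt2_power_product) simp
    finally show ?thesis
      by (simp add: real_sqrt_power)
  qed
  have weight: "2 powr (- (real l + 1) / 2) * 2 powr (- (real l - real j) / 2) = sqrt (2 ^ (j - 1)) / 2 ^ l"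
    if "1 \<le> j" "j < l" for j
  proof -
    have "2 powr (- (real l + 1) / 2) * 2 powr (- (real l - real j) / 2) = 2 powr (- real (2 * l - (j - 1)) / 2)"
      unfolding powr_add[symmetric] using that by (intro arg_cong2[of _ _ _ _ "(powr)"]) (auto simp: of_nat_diff field_simps)
    also have "\<dots> = 1 / sqrt 2 ^ (2 * l - (j - 1))"
      by (rule two_powr_neg_half)
    also have "\<dots> = sqrt 2 ^ (j - 1) / (sqrt 2 ^ (2 * l - (j - 1)) * sqrt 2 ^ (j - 1))"
      by simp
    also have "sqrt 2 ^ (2 * l - (j - 1)) * sqrt 2 ^ (j - 1) = (2 :: real) ^ l"
      using that by (intro sqrt2_power_product) simp
    finally show ?thesis
      by (simp add: real_sqrt_power)
  qed
  have "(\<Sum>j=1..K. form_coeff l j * Z j \<omega>) = (\<Sum>j=1..l. form_coeff l j * Z j \<omega>)"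
    using assms by (intro sum.mono_neutral_right) (auto simp: form_coeff_def)
  also have "\<dots> = (\<Sum>j=1..<l. form_coeff l j * Z j \<omega>) + form_coeff l l * Z l \<omega>"
    using assms by (cases l) (auto simp: atLeastLessThanSuc_atLeastAtMost)
  also have "(\<Sum>j=1..<l. form_coeff l j * Z j \<omega>) =
      2 powr (- (real l + 1) / 2) * (\<Sum>j=1..<l. 2 powr (- (real l - real j) / 2) * Z j \<omega>)"
    unfolding sum_distrib_left
  proof (rule sum.cong)
    fix j assume "j \<in> {1..<l}"
    then have j: "1 \<le> j" "j < l"
      by auto
    show "form_coeff l j * Z j \<omega> = 2 powr (- (real l + 1) / 2) * (2 powr (- (real l - real j) / 2) * Z j \<omega>)"
      unfolding mult.assoc[symmetric] weight[OF j] using j by (simp add: form_coeff_def)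
  qed simp
  also have "form_coeff l l * Z l \<omega> = - (2 powr (- (real l + 1) / 2) * Z l \<omega>)"
    unfolding scale by (simp add: form_coeff_def)
  finally have "(\<Sum>j=1..K. form_coeff l j * Z j \<omega>) =
      2 powr (- (real l + 1) / 2) * ((\<Sum>j=1..<l. 2 powr (- (real l - real j) / 2) * Z j \<omega>) - Z l \<omega>)"
    by (simp add: right_diff_distrib)
  then show ?thesis
    by (simp add: M_term_def abs_mult)
qed

lemma sum_two_powers_less: "1 \<le> l \<Longrightarrow> (\<Sum>j=1..<l. 2 ^ (j - 1)) = (2 ^ (l - 1) - 1 :: real)"
  using sum_two_powers[of "l - 1"] by (cases l) (auto simp: atLeastLessThanSuc_atLeastAtMost)

lemma sum_form_coeff_product:
  assumes "1 \<le> l" "l \<le> k" "k \<le> K"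
  shows "(\<Sum>j=1..K. form_coeff l j * form_coeff k j) =
    (if l = k then 1 / 2 ^ l - 1 / 4 ^ l else - 1 / (2 ^ l * 2 ^ k))"
proof -
  have "(\<Sum>j=1..K. form_coeff l j * form_coeff k j) = (\<Sum>j=1..l. form_coeff l j * form_coeff k j)"
    using assms by (intro sum.mono_neutral_right) (auto simp: form_coeff_def)
  also have "\<dots> = (\<Sum>j=1..<l. form_coeff l j * form_coeff k j) + form_coeff l l * form_coeff k l"
    using assms by (cases l) (auto simp: atLeastLessThanSuc_atLeastAtMost)
  also have "(\<Sum>j=1..<l. form_coeff l j * form_coeff k j) = (\<Sum>j=1..<l. 2 ^ (j - 1)) / (2 ^ l * 2 ^ k)"
    unfolding sum_divide_distrib using assms by (intro sum.cong) (auto simp: form_coeff_def)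
  also have "(\<Sum>j=1..<l. 2 ^ (j - 1)) = (2 ^ (l - 1) - 1 :: real)"
    by (rule sum_two_powers_less[OF assms(1)])
  also have "form_coeff l l * form_coeff k l = (if l = k then 1 else -1) * 2 ^ (l - 1) / (2 ^ l * 2 ^ k)"
    using assms by (auto simp: form_coeff_def)
  finally have *: "(\<Sum>j=1..K. form_coeff l j * form_coeff k j) =
      (2 ^ (l - 1) - 1 + (if l = k then 1 else -1) * 2 ^ (l - 1)) / (2 ^ l * 2 ^ k)"
    by (simp add: add_divide_distrib)
  show ?thesis
  proof (cases "l = k")
    case True
    have "2 ^ (l - 1) - 1 + 2 ^ (l - 1) = (2 ^ l - 1 :: real)"
      using assms by (cases l) auto
    moreover have "(2::real) ^ l * 2 ^ l = 4 ^ l"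
      by (simp flip: power_mult_distrib)
    ultimately have "(\<Sum>j=1..K. form_coeff l j * form_coeff k j) = (2 ^ l - 1) / (2 ^ l * 2 ^ l)"
      using * True by simp
    also have "\<dots> = 1 / 2 ^ l - 1 / 4 ^ l"
      unfolding \<open>(2::real) ^ l * 2 ^ l = 4 ^ l\<close>[symmetric] by (simp add: diff_divide_distrib)
    finally show ?thesis
      using True by simp
  next
    case False
    then show ?thesis
      using * by simp
  qed
qed

lemma sum_form_coeff_squared:
  assumes "1 \<le> l" "l \<le> K"
  shows "sqrt (\<Sum>j=1..K. (form_coeff l j)\<^sup>2) = sd_coeff l"
  using sum_form_coeff_product[of l l K] assms
  by (simp add: power2_eq_square sd_coeff_squared[symmetric] flip: power2_eq_square) (simp add: sd_coeff_eq)

context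
  fixes Q :: "'b measure" and Z :: "nat \<Rightarrow> 'b \<Rightarrow> real"
  assumes Q: "prob_space Q" and fam: "gauss_family Q Z {1..}"
begin

lemma finite_std_gauss: "gauss_family Q Z {1..K}"
  by (rule gauss_family_subset[OF fam]) auto

lemma M_term_nonneg: "0 \<le> M_term Z l \<omega>"
  by (simp add: M_term_def)

lemma M_term_expectation:
  assumes "l \<ge> 1"
  shows "integrable Q (M_term Z l)" "(\<integral>\<omega>. M_term Z l \<omega> \<partial>Q) = sqrt (2 / pi) * sd_coeff l"
proof -
  have eq: "M_term Z l = (\<lambda>\<omega>. \<bar>\<Sum>j=1..l. form_coeff l j * Z j \<omega>\<bar>)"
    by (intro ext M_term_eq_form[OF assms order_refl])
  have ne: "{1..l} \<noteq> {}"
    using assms by simp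
  show "integrable Q (M_term Z l)"
    unfolding eq by (rule gauss_family_abs_form(1)[OF Q finite_std_gauss _ ne]) simp
  show "(\<integral>\<omega>. M_term Z l \<omega> \<partial>Q) = sqrt (2 / pi) * sd_coeff l"
    unfolding eq using gauss_family_abs_form(2)[OF Q finite_std_gauss _ ne, of "form_coeff l"]
      sum_form_coeff_squared[OF assms order_refl] by simp
qed

lemma M_term_second_moment:
  assumes "l \<ge> 1"
  shows "integrable Q (\<lambda>\<omega>. M_term Z l \<omega> * M_term Z l \<omega>)"
    and "(\<integral>\<omega>. M_term Z l \<omega> * M_term Z l \<omega> \<partial>Q) = (sd_coeff l)\<^sup>2"
proof -
  have eq: "M_term Z l \<omega> * M_term Z l \<omega> = (\<Sum>j=1..l. form_coeff l j * Z j \<omega>) * (\<Sum>j=1..l. form_coeff l j * Z j \<omega>)" for \<omega>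
    unfolding M_term_eq_form[OF assms order_refl] by simp
  note cov = gauss_family_covariance[OF Q finite_std_gauss[of l] finite_atLeastAtMost, of "form_coeff l" "form_coeff l"]
  show "integrable Q (\<lambda>\<omega>. M_term Z l \<omega> * M_term Z l \<omega>)"
    unfolding eq by (rule cov(1))
  show "(\<integral>\<omega>. M_term Z l \<omega> * M_term Z l \<omega> \<partial>Q) = (sd_coeff l)\<^sup>2"
    unfolding eq cov(2) sd_coeff_squared using sum_form_coeff_product[of l l l] assms by simp
qed

text \<open>The forms inside two distinct terms have a correlation of absolute value below 1. The indices 1 and 2 only serve as
  the two coordinates to which the forms are reduced; they exist because \<open>k\<close> is at
  least 2.\<close>

lemma M_term_mixed_moment:
  assumes "1 \<le> l" "l < k"
  shows "integrable Q (\<lambda>\<omega>. M_term Z l \<omega> * M_term Z k \<omega>)"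
    and "(\<integral>\<omega>. M_term Z l \<omega> * M_term Z k \<omega> \<partial>Q) =
      2 / pi * (sd_coeff l * sd_coeff k) * (sqrt (1 - (rho l k)\<^sup>2) + rho l k * arcsin (rho l k))"
proof -
  have eq: "M_term Z l \<omega> * M_term Z k \<omega> = \<bar>\<Sum>j=1..k. form_coeff l j * Z j \<omega>\<bar> * \<bar>\<Sum>j=1..k. form_coeff k j * Z j \<omega>\<bar>" for \<omega>
    using M_term_eq_form[of l k Z \<omega>] M_term_eq_form[of k k Z \<omega>] assms by simp
  have sl: "sqrt (\<Sum>j=1..k. (form_coeff l j)\<^sup>2) = sd_coeff l" and sk: "sqrt (\<Sum>j=1..k. (form_coeff k j)\<^sup>2) = sd_coeff k"
    using sum_form_coeff_squared[of l k] sum_form_coeff_squared[of k k] assms by auto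
  have cov: "(\<Sum>j=1..k. form_coeff l j * form_coeff k j) = - 1 / (2 ^ l * 2 ^ k)"
    using sum_form_coeff_product[of l k k] assms by simp
  have r: "- 1 / (2 ^ l * 2 ^ k) / (sd_coeff l * sd_coeff k) = rho l k"
    by (simp add: rho_eq sd_coeff_eq)
  have pos: "0 < sd_coeff l" "0 < sd_coeff k"
    using sd_coeff_pos[of l] sd_coeff_pos[of k] assms by auto
  have idx: "(1::nat) \<in> {1..k}" "2 \<in> {1..k}" "(1::nat) \<noteq> 2"
    using assms by auto
  note prod = gauss_family_abs_product[OF Q finite_std_gauss[of k] finite_atLeastAtMost idx,
      where a = "form_coeff l" and b = "form_coeff k", unfolded sl sk cov r, OF pos rho_less_1[OF assms]]
  show "integrable Q (\<lambda>\<omega>. M_term Z l \<omega> * M_term Z k \<omega>)"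
    unfolding eq by (rule prod(1))
  show "(\<integral>\<omega>. M_term Z l \<omega> * M_term Z k \<omega> \<partial>Q) =
      2 / pi * (sd_coeff l * sd_coeff k) * (sqrt (1 - (rho l k)\<^sup>2) + rho l k * arcsin (rho l k))"
    unfolding eq by (rule prod(2))
qed

lemma M_term_covariance:
  assumes "1 \<le> l" "l < k"
  shows "(\<integral>\<omega>. M_term Z l \<omega> * M_term Z k \<omega> \<partial>Q) - (\<integral>\<omega>. M_term Z l \<omega> \<partial>Q) * (\<integral>\<omega>. M_term Z k \<omega> \<partial>Q) = 2 / pi * var_term l k"
  using M_term_mixed_moment(2)[OF assms] M_term_expectation(2)[of l] M_term_expectation(2)[of k] assms
  by (simp add: var_term_def algebra_simps flip: power2_eq_square)

lemma M_term_AE_summable: "AE \<omega> in Q. summable (\<lambda>l. M_term Z (Suc l) \<omega>)"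
  using summable_mult[OF summable_sd_coeff, of "sqrt (2 / pi)"]
  by (intro AE_summable_of_summable_integrals M_term_expectation(1) M_term_nonneg) (simp_all add: M_term_expectation(2))

lemma M_limit_expectation:
  shows "integrable Q (M_limit Z)"
    and "(\<integral>\<omega>. M_limit Z \<omega> \<partial>Q) = (2 * pi) powr (- 1 / 2) * (\<Sum>l. sd_coeff (Suc l))"
proof -
  have int: "integrable Q (M_term Z (Suc l))" for l
    by (rule M_term_expectation(1)) simp
  have val: "(\<integral>\<omega>. M_term Z (Suc l) \<omega> \<partial>Q) = sqrt (2 / pi) * sd_coeff (Suc l)" for l
    by (rule M_term_expectation(2)) simp
  have abs: "norm (M_term Z (Suc l) \<omega>) = M_term Z (Suc l) \<omega>" for l \<omega>
    using M_term_nonneg by simp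
  have AE: "AE \<omega> in Q. summable (\<lambda>l. norm (M_term Z (Suc l) \<omega>))"
    unfolding abs by (rule M_term_AE_summable)
  have sum: "summable (\<lambda>l. \<integral>\<omega>. norm (M_term Z (Suc l) \<omega>) \<partial>Q)"
    unfolding abs val by (rule summable_mult[OF summable_sd_coeff])
  show "integrable Q (M_limit Z)"
    unfolding M_limit_def[abs_def] by (intro integrable_mult_right integrable_suminf int AE sum)
  have "(\<integral>\<omega>. M_limit Z \<omega> \<partial>Q) = 1 / 2 * (\<Sum>l. sqrt (2 / pi) * sd_coeff (Suc l))"
    unfolding M_limit_def[abs_def] using integral_suminf[OF int AE sum] by (simp add: val)
  also have "\<dots> = 1 / 2 * sqrt (2 / pi) * (\<Sum>l. sd_coeff (Suc l))"
    by (simp add: suminf_mult[OF summable_sd_coeff])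
  also have "1 / 2 * sqrt (2 / pi) = (2 * pi) powr (- 1 / 2)"
  proof -
    have "(2 * pi) powr (- 1 / 2) = 1 / (sqrt 2 * sqrt pi)"
      by (simp add: powr_minus powr_half_sqrt inverse_eq_divide real_sqrt_mult flip: minus_divide_left)
    moreover have "1 / 2 * (sqrt 2 / sqrt pi) = 1 / (sqrt 2 * sqrt pi)"
      using real_sqrt_mult_self[of 2] by (simp add: field_simps)
    ultimately show ?thesis
      by (simp add: real_sqrt_divide)
  qed
  finally show "(\<integral>\<omega>. M_limit Z \<omega> \<partial>Q) = (2 * pi) powr (- 1 / 2) * (\<Sum>l. sd_coeff (Suc l))" .
qed

text \<open>Square integrability is transferred from the coupled copy of \<open>M\<close>, where the
  envelope dominates it.\<close>

lemma M_limit_square_integrable: "integrable Q (\<lambda>\<omega>. (M_limit Z \<omega>)\<^sup>2)"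
proof -
  let ?Y = "\<lambda>j z. z j :: real"
  have mZ: "M_limit Z \<in> borel_measurable Q"
    using gauss_family_measurable(1)[OF fam] by (intro M_limit_measurable(2)) auto
  have mY: "M_limit ?Y \<in> borel_measurable gauss_seq"
    by (rule M_limit_measurable(2)) simp
  have "distr Q borel (M_limit Z) = distr gauss_seq borel (M_limit ?Y)"
    by (rule M_limit_law[OF fam gauss_family_subset[OF gauss_family_coordinates]]) simp
  moreover have "integrable gauss_seq (\<lambda>z. (M_limit ?Y z)\<^sup>2)"
    using INL_stat_bisect_conv_Lp(2)[of 1 1] by (simp add: conv_Lp_def in_Lp_def)
  ultimately show ?thesis
    using integrable_distr_eq[OF mZ, of "\<lambda>x. x\<^sup>2"] integrable_distr_eq[OF mY, of "\<lambda>x. x\<^sup>2"] by simp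
qed

text \<open>The diagonal terms give the variances of the absolute values, the off-diagonal ones their
  covariances, each pair being counted twice.\<close>

lemma partial_sum_variance:
  "(\<integral>\<omega>. (\<Sum>l=1..n. M_term Z l \<omega>)\<^sup>2 \<partial>Q) - (\<integral>\<omega>. (\<Sum>l=1..n. M_term Z l \<omega>) \<partial>Q)\<^sup>2 =
    (1 - 2 / pi) * (\<Sum>l=1..n. 1 / 2 ^ l - 1 / 4 ^ l) + 4 / pi * var_partial n"
proof -
  let ?E = "\<lambda>l. \<integral>\<omega>. M_term Z l \<omega> \<partial>Q"
  let ?E2 = "\<lambda>l k. \<integral>\<omega>. M_term Z l \<omega> * M_term Z k \<omega> \<partial>Q"
  have int1: "integrable Q (M_term Z l)" if "l \<in> {1..n}" for l
    using that by (intro M_term_expectation(1)) simp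
  have int2: "integrable Q (\<lambda>\<omega>. M_term Z l \<omega> * M_term Z k \<omega>)" if "l \<in> {1..n}" "k \<in> {1..n}" for l k
    using that M_term_mixed_moment(1)[of l k] M_term_mixed_moment(1)[of k l] M_term_second_moment(1)[of l]
    by (cases l k rule: linorder_cases) (simp_all add: mult.commute)
  have "(\<integral>\<omega>. (\<Sum>l=1..n. M_term Z l \<omega>)\<^sup>2 \<partial>Q) = (\<Sum>l=1..n. \<Sum>k=1..n. ?E2 l k)"
    unfolding power2_eq_square sum_product
    by (subst Bochner_Integration.integral_sum, intro Bochner_Integration.integrable_sum int2, assumption+)
      (intro sum.cong refl Bochner_Integration.integral_sum int2)
  moreover have "(\<integral>\<omega>. (\<Sum>l=1..n. M_term Z l \<omega>) \<partial>Q)\<^sup>2 = (\<Sum>l=1..n. \<Sum>k=1..n. ?E l * ?E k)"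
    by (subst Bochner_Integration.integral_sum[OF int1], assumption) (simp only: power2_eq_square sum_product)
  ultimately have "(\<integral>\<omega>. (\<Sum>l=1..n. M_term Z l \<omega>)\<^sup>2 \<partial>Q) - (\<integral>\<omega>. (\<Sum>l=1..n. M_term Z l \<omega>) \<partial>Q)\<^sup>2 =
      (\<Sum>l=1..n. \<Sum>k=1..n. ?E2 l k - ?E l * ?E k)"
    by (simp add: sum_subtractf)
  also have "\<dots> = (\<Sum>l=1..n. ?E2 l l - ?E l * ?E l) + 2 * (\<Sum>k=1..n. \<Sum>l=1..<k. ?E2 l k - ?E l * ?E k)"
    by (rule sum_square_symmetric) (simp add: mult.commute)
  also have "(\<Sum>l=1..n. ?E2 l l - ?E l * ?E l) = (\<Sum>l=1..n. (1 - 2 / pi) * (1 / 2 ^ l - 1 / 4 ^ l))"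
  proof (rule sum.cong)
    fix l assume "l \<in> {1..n}"
    then have l: "1 \<le> l"
      by simp
    have "?E2 l l - ?E l * ?E l = (1 - 2 / pi) * (sd_coeff l)\<^sup>2"
      unfolding M_term_second_moment(2)[OF l] M_term_expectation(2)[OF l]
      using real_sqrt_mult_self[of "2 / pi"] by (simp add: power2_eq_square algebra_simps)
    then show "?E2 l l - ?E l * ?E l = (1 - 2 / pi) * (1 / 2 ^ l - 1 / 4 ^ l)"
      by (simp only: sd_coeff_squared)
  qed simp
  also have "(\<Sum>k=1..n. \<Sum>l=1..<k. ?E2 l k - ?E l * ?E k) = (\<Sum>k=1..n. \<Sum>l=1..<k. 2 / pi * var_term l k)"
    by (intro sum.cong refl M_term_covariance) auto
  also have "\<dots> = 2 / pi * var_partial n"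
    by (simp only: var_partial_def sum_distrib_left)
  finally show ?thesis
    by (simp add: sum_distrib_left)
qed

text \<open>The partial sums of the series for \<open>2 M\<close> increase to their limit and are dominated
  by it, so their variances converge.\<close>

lemma variance_partial_limit:
  "var_partial \<longlonglongrightarrow> pi * (prob_space.variance Q (M_limit Z) - 1 / 6 * (1 - 2 / pi))"
proof -
  interpret prob_space Q by (rule Q)
  let ?S = "\<lambda>n \<omega>. \<Sum>l=1..n. M_term Z l \<omega>"
  have mM [measurable]: "M_limit Z \<in> borel_measurable Q"
    using M_limit_expectation(1) by simp
  have mS [measurable]: "?S n \<in> borel_measurable Q" for n
    using M_term_expectation(1) by (intro borel_measurable_sum) auto
  have S: "?S n \<omega> = (\<Sum>l<n. M_term Z (Suc l) \<omega>)" for n \<omega>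
    unfolding One_nat_def sum.atLeast1_atMost_eq ..
  have lim: "AE \<omega> in Q. (\<lambda>n. ?S n \<omega>) \<longlonglongrightarrow> 2 * M_limit Z \<omega>"
    using M_term_AE_summable
  proof eventually_elim
    case (elim \<omega>)
    then show ?case
      unfolding S M_limit_def using summable_LIMSEQ[OF elim] by simp
  qed
  have le: "AE \<omega> in Q. ?S n \<omega> \<le> 2 * M_limit Z \<omega>" for n
    using M_term_AE_summable
  proof eventually_elim
    case (elim \<omega>)
    then show ?case
      unfolding S M_limit_def using sum_le_suminf[OF elim, of "{..<n}"] M_term_nonneg by simp
  qed
  have pos: "0 \<le> ?S n \<omega>" for n \<omega>
    by (intro sum_nonneg M_term_nonneg)
  have lim1: "(\<lambda>n. \<integral>\<omega>. ?S n \<omega> \<partial>Q) \<longlonglongrightarrow> (\<integral>\<omega>. 2 * M_limit Z \<omega> \<partial>Q)"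
    by (rule integral_dominated_convergence[OF _ mS _ lim, where w = "\<lambda>\<omega>. 2 * M_limit Z \<omega>"])
      (use M_limit_expectation(1) le pos in auto)
  have lim2: "(\<lambda>n. \<integral>\<omega>. (?S n \<omega>)\<^sup>2 \<partial>Q) \<longlonglongrightarrow> (\<integral>\<omega>. (2 * M_limit Z \<omega>)\<^sup>2 \<partial>Q)"
  proof (rule integral_dominated_convergence[where w = "\<lambda>\<omega>. (2 * M_limit Z \<omega>)\<^sup>2"])
    show "integrable Q (\<lambda>\<omega>. (2 * M_limit Z \<omega>)\<^sup>2)"
      using M_limit_square_integrable by (simp add: power_mult_distrib)
    show "AE \<omega> in Q. (\<lambda>n. (?S n \<omega>)\<^sup>2) \<longlonglongrightarrow> (2 * M_limit Z \<omega>)\<^sup>2"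
      using lim by eventually_elim (rule tendsto_power)
    show "AE \<omega> in Q. norm ((?S n \<omega>)\<^sup>2) \<le> (2 * M_limit Z \<omega>)\<^sup>2" for n
      using le[of n]
    proof eventually_elim
      case (elim \<omega>)
      have "(?S n \<omega>)\<^sup>2 \<le> (2 * M_limit Z \<omega>)\<^sup>2"
        by (rule power_mono[OF elim pos])
      then show ?case
        by (simp only: real_norm_def abs_power2)
    qed
  qed measurable
  have "(\<integral>\<omega>. (2 * M_limit Z \<omega>)\<^sup>2 \<partial>Q) - (\<integral>\<omega>. 2 * M_limit Z \<omega> \<partial>Q)\<^sup>2 = 4 * variance (M_limit Z)"
    using variance_eq[OF M_limit_expectation(1) M_limit_square_integrable] by (simp add: power_mult_distrib)
  then have "(\<lambda>n. (1 - 2 / pi) * (\<Sum>l=1..n. 1 / 2 ^ l - 1 / 4 ^ l) + 4 / pi * var_partial n) \<longlonglongrightarrow> 4 * variance (M_limit Z)"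
    using tendsto_diff[OF lim2 tendsto_power[OF lim1, of 2]] unfolding partial_sum_variance by simp
  moreover have "(\<lambda>n. (1 - 2 / pi) * (\<Sum>l=1..n. 1 / 2 ^ l - 1 / 4 ^ l)) \<longlonglongrightarrow> (1 - 2 / pi) * (2 / 3)"
  proof (rule tendsto_mult_left)
    have geo: "(\<lambda>n. \<Sum>l<n. q ^ Suc l) \<longlonglongrightarrow> q / (1 - q)" if "\<bar>q\<bar> < 1" for q :: real
      using sums_mult[OF geometric_sums[of q], of q] that by (simp add: sums_def)
    have "(\<Sum>l=1..n. 1 / 2 ^ l - 1 / 4 ^ l) = (\<Sum>l<n. (1 / 2) ^ Suc l) - (\<Sum>l<n. (1 / 4 :: real) ^ Suc l)" for n
      unfolding One_nat_def sum.atLeast1_atMost_eq sum_subtractf by (simp add: power_divide)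
    then show "(\<lambda>n. \<Sum>l=1..n. 1 / 2 ^ l - 1 / 4 ^ l) \<longlonglongrightarrow> (2 / 3 :: real)"
      using tendsto_diff[OF geo[of "1 / 2"] geo[of "1 / 4"]] by simp
  qed
  ultimately have "(\<lambda>n. 4 / pi * var_partial n) \<longlonglongrightarrow> 4 * variance (M_limit Z) - (1 - 2 / pi) * (2 / 3)"
    using tendsto_diff by fastforce
  from tendsto_mult_left[OF this, of "pi / 4"] show ?thesis
    by (simp add: algebra_simps diff_divide_distrib)
qed

end

text \<open>Nonnegativity bounds all finite sums by \<open>L\<close>, and every finite subset of \<open>A\<close> is contained in some
  \<open>F n\<close>, so that the sequence \<open>F\<close> is cofinal among the finite subsets.\<close>

lemma has_sum_of_exhaustion:
  fixes f :: "'i \<Rightarrow> real"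
  assumes nonneg: "\<And>x. x \<in> A \<Longrightarrow> 0 \<le> f x"
    and fin: "\<And>n. finite (F n)" and sub: "\<And>n. F n \<subseteq> A" and mono: "incseq F" and cover: "A \<subseteq> (\<Union>n. F n)"
    and lim: "(\<lambda>n. sum f (F n)) \<longlonglongrightarrow> L"
  shows "(f has_sum L) A"
proof -
  have exhaust: "\<exists>n. X \<subseteq> F n" if "finite X" "X \<subseteq> A" for X
    using that
  proof (induction X rule: finite_induct)
    case (insert x X)
    then obtain n m where "X \<subseteq> F n" "x \<in> F m"
      using cover by blast
    then have "insert x X \<subseteq> F (max n m)"
      using monoD[OF mono, of n "max n m"] monoD[OF mono, of m "max n m"] by auto
    then show ?case
      by blast
  qed simp
  have "incseq (\<lambda>n. sum f (F n))"
    using fin sub nonneg monoD[OF mono] by (intro monoI sum_mono2) blast+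
  then have bound: "sum f (F n) \<le> L" for n
    by (rule incseq_le[OF _ lim])
  have "f summable_on A"
  proof (rule nonneg_bdd_above_summable_on[OF nonneg])
    show "bdd_above (sum f ` {X. X \<subseteq> A \<and> finite X})"
    proof (rule bdd_aboveI2)
      fix X assume "X \<in> {X. X \<subseteq> A \<and> finite X}"
      then obtain n where "X \<subseteq> F n"
        using exhaust by blast
      then have "sum f X \<le> sum f (F n)"
        by (intro sum_mono2) (use fin sub nonneg \<open>X \<subseteq> F n\<close> in blast)+
      then show "sum f X \<le> L"
        using bound[of n] by simp
    qed
  qed
  then have sum: "(f has_sum infsum f A) A"
    by (rule has_sum_infsum)
  have "filterlim F (finite_subsets_at_top A) sequentially"
    unfolding filterlim_finite_subsets_at_top
  proof (intro allI impI)
    fix X assume "finite X \<and> X \<subseteq> A"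
    then obtain n where n: "X \<subseteq> F n"
      using exhaust by blast
    show "\<forall>\<^sub>F m in sequentially. finite (F m) \<and> X \<subseteq> F m \<and> F m \<subseteq> A"
      using n fin sub monoD[OF mono, of n] by (intro eventually_sequentiallyI[of n]) blast
  qed
  then have "(\<lambda>n. sum f (F n)) \<longlonglongrightarrow> infsum f A"
    using sum unfolding has_sum_def by (rule filterlim_compose[rotated])
  then have "infsum f A = L"
    using lim by (rule LIMSEQ_unique)
  then show ?thesis
    using sum by simp
qed

lemma var_term_has_sum:
  assumes "var_partial \<longlonglongrightarrow> L"
  shows "((\<lambda>(l, k). var_term l k) has_sum L) {(l, k). 1 \<le> l \<and> l < k}"
proof -
  define F where "F n = (\<lambda>(k, l). (l, k)) ` (SIGMA k:{1..n}. {1..<k})" for n :: nat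
  have F: "F n = {(l, k). 1 \<le> l \<and> l < k \<and> k \<le> n}" for n
    by (auto simp: F_def image_iff)
  have sum: "sum (\<lambda>(l, k). var_term l k) (F n) = var_partial n" for n
  proof -
    have "sum (\<lambda>(l, k). var_term l k) (F n) = sum (\<lambda>(k, l). var_term l k) (SIGMA k:{1..n}. {1..<k})"
      unfolding F_def by (subst sum.reindex) (auto simp: inj_on_def intro!: sum.cong)
    also have "\<dots> = var_partial n"
      by (simp add: var_partial_def sum.Sigma)
    finally show ?thesis .
  qed
  show ?thesis
  proof (rule has_sum_of_exhaustion[where F = F])
    show "finite (F n)" for n
      unfolding F_def by simp
    show "incseq F"
      by (auto simp: F incseq_def)
    show "{(l, k). 1 \<le> l \<and> l < k} \<subseteq> (\<Union>n. F n)"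
      by (auto simp: F)
    show "(\<lambda>n. sum (\<lambda>(l, k). var_term l k) (F n)) \<longlonglongrightarrow> L"
      unfolding sum by (rule assms)
  qed (auto simp: F intro: var_term_nonneg)
qed

theorem theorem3p1:
  fixes P :: "'a measure" and Q :: "'b measure"
    and Iu :: "nat \<Rightarrow> 'a \<Rightarrow> real" and Z :: "nat \<Rightarrow> 'b \<Rightarrow> real"
    and Ibar \<sigma> :: real
  assumes "Ibar > 0" and "\<sigma> > 0"
    and "prob_space P" and "iid_normal P Iu Ibar \<sigma>"
    and "prob_space Q" and "iid_normal Q Z 0 1"
  shows "(AE \<omega> in Q. summable (\<lambda>l. M_term Z (Suc l) \<omega>)) \<and>
     M_limit Z \<in> borel_measurable Q \<and>
     weak_conv_m (\<lambda>N. distr P borel (normalized_INL_max \<sigma> Iu N)) (distr Q borel (M_limit Z)) \<and>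
     (\<exists>(R :: (nat \<Rightarrow> real) measure) T' M'.
       prob_space R \<and>
       M' \<in> borel_measurable R \<and> distr R borel M' = distr Q borel (M_limit Z) \<and>
       (\<forall>N\<ge>1. T' N \<in> borel_measurable R \<and>
          distr R borel (T' N) = distr P borel (normalized_INL_max \<sigma> Iu N)) \<and>
       conv_Lp R 1 T' M' \<and> conv_Lp R 2 T' M') \<and>
     integrable Q (M_limit Z) \<and>
     summable (\<lambda>l. sd_coeff (Suc l)) \<and>
     prob_space.expectation Q (M_limit Z) = (2 * pi) powr (- 1 / 2) * (\<Sum>l. sd_coeff (Suc l)) \<and>
     \<bar>prob_space.expectation Q (M_limit Z) - 0.839792\<bar> \<le> 5 / 10 ^ 7 \<and>
     integrable Q (\<lambda>\<omega>. (M_limit Z \<omega>)\<^sup>2) \<and>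
     (\<lambda>(l, k). var_term l k) summable_on {(l, k). 1 \<le> l \<and> l < k} \<and>
     prob_space.variance Q (M_limit Z) =
       1 / pi * (\<Sum>\<^sub>\<infinity>(l, k)\<in>{(l, k). 1 \<le> l \<and> l < k}. var_term l k) + 1 / 6 * (1 - 2 / pi) \<and>
     \<bar>prob_space.variance Q (M_limit Z) - 0.08007\<bar> \<le> 5 / 10 ^ 6"
proof -
  note fam = iid_normal_gauss_family[OF assms(5,6)]
  let ?T = "\<lambda>N z. INL_stat Ibar \<sigma> N (bisect_piece z)" and ?M = "M_limit (\<lambda>j z. z j)"
  have law: "distr gauss_seq borel ?M = distr Q borel (M_limit Z)"
    by (rule M_limit_law[OF gauss_family_subset[OF gauss_family_coordinates] fam]) simp
  have "\<exists>(R :: (nat \<Rightarrow> real) measure) T' M'.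
       prob_space R \<and>
       M' \<in> borel_measurable R \<and> distr R borel M' = distr Q borel (M_limit Z) \<and>
       (\<forall>N\<ge>1. T' N \<in> borel_measurable R \<and>
          distr R borel (T' N) = distr P borel (normalized_INL_max \<sigma> Iu N)) \<and>
       conv_Lp R 1 T' M' \<and> conv_Lp R 2 T' M'"
  proof (intro exI conjI allI impI)
    show "prob_space gauss_seq"
      by (rule prob_space_gauss_seq)
    show "?M \<in> borel_measurable gauss_seq"
      by (rule M_limit_measurable(2)) simp
    show "distr gauss_seq borel ?M = distr Q borel (M_limit Z)"
      by (rule law)
    show "?T N \<in> borel_measurable gauss_seq" for N
      by (rule INL_stat_bisect_measurable)
    show "distr gauss_seq borel (?T N) = distr P borel (normalized_INL_max \<sigma> Iu N)" if "N \<ge> 1" for N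
      by (rule INL_stat_bisect_law[OF assms(3,4,2) that])
    show "conv_Lp gauss_seq 1 ?T ?M" "conv_Lp gauss_seq 2 ?T ?M"
      by (rule INL_stat_bisect_conv_Lp[OF assms(1)])+
  qed
  moreover have "weak_conv_m (\<lambda>N. distr P borel (normalized_INL_max \<sigma> Iu N)) (distr Q borel (M_limit Z))"
    unfolding law[symmetric] by (rule normalized_INL_max_weak_conv[OF assms(3,4,2,1)])
  moreover have lim: "var_partial \<longlonglongrightarrow> pi * (prob_space.variance Q (M_limit Z) - 1 / 6 * (1 - 2 / pi))"
    by (rule variance_partial_limit[OF assms(5) fam])
  define S where "S = (\<Sum>\<^sub>\<infinity>(l, k)\<in>{(l, k). 1 \<le> l \<and> l < k}. var_term l k)"
  note sum = var_term_has_sum[OF lim]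
  have S: "S = pi * (prob_space.variance Q (M_limit Z) - 1 / 6 * (1 - 2 / pi))"
    unfolding S_def by (rule infsumI[OF sum])
  have "prob_space.variance Q (M_limit Z) = 1 / pi * S + 1 / 6 * (1 - 2 / pi)"
    unfolding S by simp
  moreover have "\<bar>1 / pi * S + 1 / 6 * (1 - 2 / pi) - 0.08007\<bar> \<le> 5 / 10 ^ 6"
  proof (rule variance_numeral)
    show "0.0612675 \<le> S"
      using incseq_le[OF var_partial_mono lim, of 12] var_partial_12_ge S by linarith
    show "S \<le> 0.061275"
      unfolding S by (rule LIMSEQ_le_const2[OF lim]) (use var_partial_le in auto)
  qed
  ultimately show ?thesis
    using M_term_AE_summable[OF assms(5) fam] M_limit_expectation[OF assms(5) fam]
      M_limit_square_integrable[OF assms(5) fam] has_sum_imp_summable[OF sum]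
      summable_sd_coeff mean_numeral
    unfolding S_def by (auto simp: borel_measurable_integrable)
qed

end
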